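(* Let $P$ be a Hopf algebra over a field $k$ with a bicovariant differential calculus $\Omega^*P$, let $M$ be an algebra with a differential calculus $\Omega^*M$, and suppose that $P$ coacts on $M$ by a differentiable left coaction $\lambda:M\to P\otimes M$. Let $i:{}^{coP}(\Omega^*M)\to\Omega^*M$ be the inclusion of the complex of left invariant forms, and $H(i)$ the induced map on cohomology. 1) If $P$ has a normalised left integral, then $H(i)$ is an isomorphism $H(i):H^n({}^{coP}(\Omega^*M),\mathrm{d})\to{}^{coP}(H^n_{dR}(M))$ for every $n$. 2) If $P$ is connected, then ${}^{coP}(H^n_{dR}(M))=H^n_{dR}(M)$ for every $n$. 3) If $P$ is a connected cosemisimple Hopf algebra, then ${}^{coP}(H^n_{dR}(M))=H^n_{dR}(M)=H^n({}^{coP}(\Omega^*M),\mathrm{d})$ for every $n$, where the last identification is via $H(i)$.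
   Context: All algebras and tensor products are over a field $k$. A differential calculus on an algebra $A$ is a differential graded algebra $\Omega A=\bigoplus_{n\ge0}\Omega^nA$ with $\Omega^0A=A$ and differential $\mathrm{d}:\Omega^nA\to\Omega^{n+1}A$, such that every $\omega\in\Omega^1A$ is a finite sum $\sum_i a_i\,\mathrm{d}b_i$ with $a_i,b_i\in A$. Its cohomology is $H^*_{dR}(A)$; in particular $H^0_{dR}(A)=\ker(\mathrm{d}:A\to\Omega^1A)$. "Bicovariant" is in the sense of Woronowicz. The tensor product calculus is $\Omega^n(P\otimes M)=\bigoplus_{r=0}^n\Omega^rP\otimes\Omega^{n-r}M$, with differential $\mathrm{d}\otimes\mathrm{id}+(-1)^r\,\mathrm{id}\otimes\mathrm{d}$ on $\Omega^rP\otimes\Omega^sM$. Let $\Pi_r:\Omega^n(P\otimes M)\to\Omega^rP\otimes\Omega^{n-r}M$ be the projections. A left coaction $\lambda:M\to P\otimes M$ is differentiable if it extends to a map $\lambda_*:\Omega^nM\to\Omega^n(P\otimes M)$, $n\ge 0$, commuting with $\mathrm{d}$. In this situation $\bar\lambda=\Pi_0\circ\lambda_*:\Omega^nM\to P\otimes\Omega^nM$ is a left $P$-coaction, $\mathrm{d}:\Omega^nM\to\Omega^{n+1}M$ is a left $P$-comodule map, and there is an induced left coaction $\tilde\lambda:H^*_{dR}(M)\to P\otimes H^*_{dR}(M)$, $[\omega]\mapsto(\mathrm{id}\otimes[\,\cdot\,])\bar\lambda(\omega)$ (these facts are part of the set-up). For a left $P$-comodule $E$ with coaction $\rho_E$,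 ${}^{coP}E=\{e\in E:\rho_E(e)=1_P\otimes e\}$. The coaction on $\Omega^nM$ is $\bar\lambda$, and on $H^n_{dR}(M)$ it is $\tilde\lambda$. ${}^{coP}(\Omega^*M)$ is a subcomplex of $(\Omega^*M,\mathrm{d})$. A left integral on $P$ is a linear map $\int:P\to k$ with $(\int\otimes\mathrm{id})\Delta(p)=\int(p)\,1_P$ for all $p\in P$; it is normalised if $\int 1_P=1$. $P$ is cosemisimple if it is a sum of simple coalgebras; over a field this is equivalent to having a normalised left integral. $P$ (with its given calculus) is connected if $H^0_{dR}(P)=k$, i.e. $\ker(\mathrm{d}:P\to\Omega^1P)=k\,1_P$. *)

theory Defs
  imports "HOL-Algebra.Module" "HOL-Algebra.AbelCoset"
begin

text \<open>
  Vector spaces over \<open>k\<close> are the \<^locale>\<open>module\<close>s of HOL-Algebra over a \<^locale>\<open>field\<close> \<open>k\<close>.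
  The record fields for multiplication and unit are irrelevant for a mere vector space; they are
  used only when the record is at the same time an algebra.
\<close>

section \<open>Linear algebra\<close>

definition linmap :: "'k ring \<Rightarrow> ('k, 'v) module \<Rightarrow> ('k, 'w) module \<Rightarrow> ('v \<Rightarrow> 'w) set"
  where "linmap k V W =
    {f \<in> hom (add_monoid V) (add_monoid W).
      \<forall>a\<in>carrier k. \<forall>x\<in>carrier V. f (a \<odot>\<^bsub>V\<^esub> x) = a \<odot>\<^bsub>W\<^esub> f x}"

definition lin_iso :: "'k ring \<Rightarrow> ('k, 'v) module \<Rightarrow> ('k, 'w) module \<Rightarrow> ('v \<Rightarrow> 'w) \<Rightarrow> bool"
  where "lin_iso k V W f \<longleftrightarrow> f \<in> linmap k V W \<and> bij_betw f (carrier V) (carrier W)"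

definition bilinear_map ::
    "'k ring \<Rightarrow> ('k, 'v) module \<Rightarrow> ('k, 'w) module \<Rightarrow> ('k, 'z) module \<Rightarrow> ('v \<Rightarrow> 'w \<Rightarrow> 'z) \<Rightarrow> bool"
  where "bilinear_map k V W Z \<phi> \<longleftrightarrow>
    (\<forall>x\<in>carrier V. \<phi> x \<in> linmap k W Z) \<and> (\<forall>y\<in>carrier W. (\<lambda>x. \<phi> x y) \<in> linmap k V Z)"

definition scalar_space :: "'k ring \<Rightarrow> ('k, 'k) module"
  where "scalar_space k = \<lparr>carrier = carrier k, mult = mult k, one = one k,
    zero = zero k, add = add k, smult = mult k\<rparr>"

definition lin_span :: "'k ring \<Rightarrow> ('k, 'v) module \<Rightarrow> 'v set \<Rightarrow> 'v set"
  where "lin_span k V X = \<Inter>{H. submodule H k V \<and> X \<subseteq> H}"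

definition quot_space :: "('k, 'v) module \<Rightarrow> 'v set \<Rightarrow> ('k, 'v set) module"
  where "quot_space V U = \<lparr>carrier = a_rcosets\<^bsub>V\<^esub> U, mult = undefined, one = undefined,
    zero = U, add = set_add V, smult = (\<lambda>a X. \<Union>x\<in>X. U +>\<^bsub>V\<^esub> (a \<odot>\<^bsub>V\<^esub> x))\<rparr>"

definition free_space :: "'k ring \<Rightarrow> 'a set \<Rightarrow> ('k, 'a \<Rightarrow> 'k) module"
  where "free_space k A = \<lparr>
    carrier = {f \<in> UNIV \<rightarrow> carrier k. finite {x. f x \<noteq> \<zero>\<^bsub>k\<^esub>} \<and> {x. f x \<noteq> \<zero>\<^bsub>k\<^esub>} \<subseteq> A},
    mult = undefined, one = undefined,
    zero = (\<lambda>_. \<zero>\<^bsub>k\<^esub>), add = (\<lambda>f g x. f x \<oplus>\<^bsub>k\<^esub> g x), smult = (\<lambda>a f x. a \<otimes>\<^bsub>k\<^esub> f x)\<rparr>"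

definition free_gen :: "'k ring \<Rightarrow> 'a \<Rightarrow> 'a \<Rightarrow> 'k"
  where "free_gen k x = (\<lambda>y. if y = x then \<one>\<^bsub>k\<^esub> else \<zero>\<^bsub>k\<^esub>)"


section \<open>Tensor products\<close>

text \<open>The tensor product is the free vector space on pairs modulo the bilinearity relations.\<close>

type_synonym ('k, 'v, 'w) tens = "('v \<times> 'w \<Rightarrow> 'k) set"

definition tensor_relators ::
    "'k ring \<Rightarrow> ('k, 'v) module \<Rightarrow> ('k, 'w) module \<Rightarrow> ('v \<times> 'w \<Rightarrow> 'k) set"
  where "tensor_relators k V W =
    (let F = free_space k (carrier V \<times> carrier W); g = (\<lambda>x y. free_gen k (x, y)) in
      {g (x \<oplus>\<^bsub>V\<^esub> x') y \<ominus>\<^bsub>F\<^esub> (g x y \<oplus>\<^bsub>F\<^esub> g x' y) | x x' y.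
          x \<in> carrier V \<and> x' \<in> carrier V \<and> y \<in> carrier W}
    \<union> {g x (y \<oplus>\<^bsub>W\<^esub> y') \<ominus>\<^bsub>F\<^esub> (g x y \<oplus>\<^bsub>F\<^esub> g x y') | x y y'.
          x \<in> carrier V \<and> y \<in> carrier W \<and> y' \<in> carrier W}
    \<union> {g (a \<odot>\<^bsub>V\<^esub> x) y \<ominus>\<^bsub>F\<^esub> (a \<odot>\<^bsub>F\<^esub> g x y) | a x y.
          a \<in> carrier k \<and> x \<in> carrier V \<and> y \<in> carrier W}
    \<union> {g x (a \<odot>\<^bsub>W\<^esub> y) \<ominus>\<^bsub>F\<^esub> (a \<odot>\<^bsub>F\<^esub> g x y) | a x y.
          a \<in> carrier k \<and> x \<in> carrier V \<and> y \<in> carrier W})"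

definition tensor_null ::
    "'k ring \<Rightarrow> ('k, 'v) module \<Rightarrow> ('k, 'w) module \<Rightarrow> ('v \<times> 'w \<Rightarrow> 'k) set"
  where "tensor_null k V W =
    lin_span k (free_space k (carrier V \<times> carrier W)) (tensor_relators k V W)"

definition tensor ::
    "'k ring \<Rightarrow> ('k, 'v) module \<Rightarrow> ('k, 'w) module \<Rightarrow> ('k, ('k, 'v, 'w) tens) module"
  where "tensor k V W =
    quot_space (free_space k (carrier V \<times> carrier W)) (tensor_null k V W)"

definition tens ::
    "'k ring \<Rightarrow> ('k, 'v) module \<Rightarrow> ('k, 'w) module \<Rightarrow> 'v \<Rightarrow> 'w \<Rightarrow> ('k, 'v, 'w) tens"
  where "tens k V W x y =
    tensor_null k V W +>\<^bsub>free_space k (carrier V \<times> carrier W)\<^esub> free_gen k (x, y)"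

text \<open>The linear map on the tensor product induced by a bilinear map \<open>\<phi>\<close> into \<open>Z\<close>.\<close>

definition tensor_lift ::
    "'k ring \<Rightarrow> ('k, 'v) module \<Rightarrow> ('k, 'w) module \<Rightarrow> ('k, 'z) module \<Rightarrow>
      ('v \<Rightarrow> 'w \<Rightarrow> 'z) \<Rightarrow> ('k, 'v, 'w) tens \<Rightarrow> 'z"
  where "tensor_lift k V W Z \<phi> =
    (THE h. h \<in> linmap k (tensor k V W) Z \<inter> extensional (carrier (tensor k V W)) \<and>
      (\<forall>x\<in>carrier V. \<forall>y\<in>carrier W. h (tens k V W x y) = \<phi> x y))"

text \<open>\<open>tensor_map k V W V' W' f g\<close> is \<open>f \<otimes> g : V \<otimes> W \<rightarrow> V' \<otimes> W'\<close>.\<close>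

definition tensor_map ::
    "'k ring \<Rightarrow> ('k, 'v) module \<Rightarrow> ('k, 'w) module \<Rightarrow> ('k, 'v2) module \<Rightarrow> ('k, 'w2) module \<Rightarrow>
      ('v \<Rightarrow> 'v2) \<Rightarrow> ('w \<Rightarrow> 'w2) \<Rightarrow> ('k, 'v, 'w) tens \<Rightarrow> ('k, 'v2, 'w2) tens"
  where "tensor_map k V W V' W' f g =
    tensor_lift k V W (tensor k V' W') (\<lambda>x y. tens k V' W' (f x) (g y))"

text \<open>The canonical map \<open>(U \<otimes> V) \<otimes> W \<rightarrow> U \<otimes> (V \<otimes> W)\<close>.\<close>

definition tensor_assoc ::
    "'k ring \<Rightarrow> ('k, 'u) module \<Rightarrow> ('k, 'v) module \<Rightarrow> ('k, 'w) module \<Rightarrow>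
      ('k, ('k, 'u, 'v) tens, 'w) tens \<Rightarrow> ('k, 'u, ('k, 'v, 'w) tens) tens"
  where "tensor_assoc k U V W =
    tensor_lift k (tensor k U V) W (tensor k U (tensor k V W))
      (\<lambda>t w. tensor_lift k U V (tensor k U (tensor k V W))
        (\<lambda>u v. tens k U (tensor k V W) u (tens k V W v w)) t)"

text \<open>
  The product \<open>(u \<otimes> v)(u' \<otimes> v') = f u u' \<otimes> g v v'\<close> in \<open>U'' \<otimes> V''\<close>.  No Koszul sign appears: below
  the first factor always lies in degree zero.
\<close>

definition tensor_prod ::
    "'k ring \<Rightarrow> ('k, 'u) module \<Rightarrow> ('k, 'v) module \<Rightarrow> ('k, 'u2) module \<Rightarrow> ('k, 'v2) module \<Rightarrow>
      ('k, 'u3) module \<Rightarrow> ('k, 'v3) module \<Rightarrow> ('u \<Rightarrow> 'u2 \<Rightarrow> 'u3) \<Rightarrow> ('v \<Rightarrow> 'v2 \<Rightarrow> 'v3) \<Rightarrow>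
      ('k, 'u, 'v) tens \<Rightarrow> ('k, 'u2, 'v2) tens \<Rightarrow> ('k, 'u3, 'v3) tens"
  where "tensor_prod k U V U' V' U'' V'' f g t t' =
    tensor_lift k U V (tensor k U'' V'')
      (\<lambda>u v. tensor_lift k U' V' (tensor k U'' V'')
        (\<lambda>u' v'. tens k U'' V'' (f u u') (g v v')) t') t"


section \<open>Algebras, comodules and Hopf algebras\<close>

definition assoc_algebra :: "'k ring \<Rightarrow> ('k, 'a) module \<Rightarrow> bool"
  where "assoc_algebra k A \<longleftrightarrow> field k \<and> module k A \<and> ring A \<and>
    (\<forall>a\<in>carrier k. \<forall>x\<in>carrier A. \<forall>y\<in>carrier A.
      (a \<odot>\<^bsub>A\<^esub> x) \<otimes>\<^bsub>A\<^esub> y = a \<odot>\<^bsub>A\<^esub> (x \<otimes>\<^bsub>A\<^esub> y) \<and>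
      x \<otimes>\<^bsub>A\<^esub> (a \<odot>\<^bsub>A\<^esub> y) = a \<odot>\<^bsub>A\<^esub> (x \<otimes>\<^bsub>A\<^esub> y))"

definition left_coaction ::
    "'k ring \<Rightarrow> ('k, 'p) module \<Rightarrow> ('p \<Rightarrow> ('k, 'p, 'p) tens) \<Rightarrow> ('p \<Rightarrow> 'k) \<Rightarrow>
      ('k, 'e) module \<Rightarrow> ('e \<Rightarrow> ('k, 'p, 'e) tens) \<Rightarrow> bool"
  where "left_coaction k P \<Delta> \<epsilon> E \<rho> \<longleftrightarrow>
    \<rho> \<in> linmap k E (tensor k P E) \<and>
    (\<forall>e\<in>carrier E.
      tensor_assoc k P P E (tensor_map k P E (tensor k P P) E \<Delta> (\<lambda>x. x) (\<rho> e)) =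
      tensor_map k P E P (tensor k P E) (\<lambda>x. x) \<rho> (\<rho> e)) \<and>
    (\<forall>e\<in>carrier E. tensor_lift k P E E (\<lambda>p x. \<epsilon> p \<odot>\<^bsub>E\<^esub> x) (\<rho> e) = e)"

definition coalgebra ::
    "'k ring \<Rightarrow> ('k, 'p) module \<Rightarrow> ('p \<Rightarrow> ('k, 'p, 'p) tens) \<Rightarrow> ('p \<Rightarrow> 'k) \<Rightarrow> bool"
  where "coalgebra k P \<Delta> \<epsilon> \<longleftrightarrow>
    field k \<and> module k P \<and>
    \<Delta> \<in> linmap k P (tensor k P P) \<and> \<epsilon> \<in> linmap k P (scalar_space k) \<and>
    (\<forall>p\<in>carrier P.
      tensor_assoc k P P P (tensor_map k P P (tensor k P P) P \<Delta> (\<lambda>x. x) (\<Delta> p)) =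
      tensor_map k P P P (tensor k P P) (\<lambda>x. x) \<Delta> (\<Delta> p)) \<and>
    (\<forall>p\<in>carrier P.
      tensor_lift k P P P (\<lambda>x y. \<epsilon> x \<odot>\<^bsub>P\<^esub> y) (\<Delta> p) = p \<and>
      tensor_lift k P P P (\<lambda>x y. \<epsilon> y \<odot>\<^bsub>P\<^esub> x) (\<Delta> p) = p)"

locale hopf_algebra =
  fixes k :: "'k ring" and P :: "('k, 'p) module"
    and \<Delta> :: "'p \<Rightarrow> ('k, 'p, 'p) tens" and \<epsilon> :: "'p \<Rightarrow> 'k" and S :: "'p \<Rightarrow> 'p"
  assumes algebra: "assoc_algebra k P"
    and coalgebra: "coalgebra k P \<Delta> \<epsilon>"
    and comult_mult: "\<lbrakk>p \<in> carrier P; q \<in> carrier P\<rbrakk> \<Longrightarrow>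
      \<Delta> (p \<otimes>\<^bsub>P\<^esub> q) = tensor_prod k P P P P P P (mult P) (mult P) (\<Delta> p) (\<Delta> q)"
    and comult_one: "\<Delta> \<one>\<^bsub>P\<^esub> = tens k P P \<one>\<^bsub>P\<^esub> \<one>\<^bsub>P\<^esub>"
    and counit_mult: "\<lbrakk>p \<in> carrier P; q \<in> carrier P\<rbrakk> \<Longrightarrow> \<epsilon> (p \<otimes>\<^bsub>P\<^esub> q) = \<epsilon> p \<otimes>\<^bsub>k\<^esub> \<epsilon> q"
    and counit_one: "\<epsilon> \<one>\<^bsub>P\<^esub> = \<one>\<^bsub>k\<^esub>"
    and antipode_lin: "S \<in> linmap k P P"
    and antipode_left: "p \<in> carrier P \<Longrightarrow>
      tensor_lift k P P P (\<lambda>x y. S x \<otimes>\<^bsub>P\<^esub> y) (\<Delta> p) = \<epsilon> p \<odot>\<^bsub>P\<^esub> \<one>\<^bsub>P\<^esub>"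
    and antipode_right: "p \<in> carrier P \<Longrightarrow>
      tensor_lift k P P P (\<lambda>x y. x \<otimes>\<^bsub>P\<^esub> S y) (\<Delta> p) = \<epsilon> p \<odot>\<^bsub>P\<^esub> \<one>\<^bsub>P\<^esub>"

definition coinvariants ::
    "'k ring \<Rightarrow> ('k, 'p) module \<Rightarrow> ('k, 'e) module \<Rightarrow> ('e \<Rightarrow> ('k, 'p, 'e) tens) \<Rightarrow> 'e set"
  where "coinvariants k P E \<rho> = {e \<in> carrier E. \<rho> e = tens k P E \<one>\<^bsub>P\<^esub> e}"

definition coinv_space ::
    "'k ring \<Rightarrow> ('k, 'p) module \<Rightarrow> ('k, 'e) module \<Rightarrow> ('e \<Rightarrow> ('k, 'p, 'e) tens) \<Rightarrow> ('k, 'e) module"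
  where "coinv_space k P E \<rho> = E\<lparr>carrier := coinvariants k P E \<rho>\<rparr>"

text \<open>In \<open>left_integral\<close> the space \<open>k \<otimes> P\<close> is identified with \<open>P\<close>.\<close>

definition left_integral ::
    "'k ring \<Rightarrow> ('k, 'p) module \<Rightarrow> ('p \<Rightarrow> ('k, 'p, 'p) tens) \<Rightarrow> ('p \<Rightarrow> 'k) \<Rightarrow> bool"
  where "left_integral k P \<Delta> I \<longleftrightarrow>
    I \<in> linmap k P (scalar_space k) \<and>
    (\<forall>p\<in>carrier P. tensor_lift k P P P (\<lambda>x y. I x \<odot>\<^bsub>P\<^esub> y) (\<Delta> p) = I p \<odot>\<^bsub>P\<^esub> \<one>\<^bsub>P\<^esub>)"

definition normalised_left_integral ::
    "'k ring \<Rightarrow> ('k, 'p) module \<Rightarrow> ('p \<Rightarrow> ('k, 'p, 'p) tens) \<Rightarrow> ('p \<Rightarrow> 'k) \<Rightarrow> bool"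
  where "normalised_left_integral k P \<Delta> I \<longleftrightarrow> left_integral k P \<Delta> I \<and> I \<one>\<^bsub>P\<^esub> = \<one>\<^bsub>k\<^esub>"

text \<open>\<open>\<Delta>(C) \<subseteq> C \<otimes> C\<close>, where \<open>C \<otimes> C\<close> means its image in \<open>P \<otimes> P\<close>.\<close>

definition subcoalgebra ::
    "'k ring \<Rightarrow> ('k, 'p) module \<Rightarrow> ('p \<Rightarrow> ('k, 'p, 'p) tens) \<Rightarrow> 'p set \<Rightarrow> bool"
  where "subcoalgebra k P \<Delta> C \<longleftrightarrow>
    submodule C k P \<and>
    (let C' = P\<lparr>carrier := C\<rparr> in
      \<Delta> ` C \<subseteq> tensor_map k C' C' P P (\<lambda>x. x) (\<lambda>x. x) ` carrier (tensor k C' C'))"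

definition simple_subcoalgebra ::
    "'k ring \<Rightarrow> ('k, 'p) module \<Rightarrow> ('p \<Rightarrow> ('k, 'p, 'p) tens) \<Rightarrow> 'p set \<Rightarrow> bool"
  where "simple_subcoalgebra k P \<Delta> C \<longleftrightarrow>
    subcoalgebra k P \<Delta> C \<and> C \<noteq> {\<zero>\<^bsub>P\<^esub>} \<and>
    (\<forall>D. subcoalgebra k P \<Delta> D \<and> D \<subseteq> C \<longrightarrow> D = {\<zero>\<^bsub>P\<^esub>} \<or> D = C)"

definition cosemisimple ::
    "'k ring \<Rightarrow> ('k, 'p) module \<Rightarrow> ('p \<Rightarrow> ('k, 'p, 'p) tens) \<Rightarrow> bool"
  where "cosemisimple k P \<Delta> \<longleftrightarrow>
    carrier P = lin_span k P (\<Union>{C. simple_subcoalgebra k P \<Delta> C})"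


section \<open>Cochain complexes\<close>

definition cocycles :: "(nat \<Rightarrow> ('k, 'w) module) \<Rightarrow> (nat \<Rightarrow> 'w \<Rightarrow> 'w) \<Rightarrow> nat \<Rightarrow> 'w set"
  where "cocycles V d n = {x \<in> carrier (V n). d n x = \<zero>\<^bsub>V (Suc n)\<^esub>}"

definition coboundaries :: "(nat \<Rightarrow> ('k, 'w) module) \<Rightarrow> (nat \<Rightarrow> 'w \<Rightarrow> 'w) \<Rightarrow> nat \<Rightarrow> 'w set"
  where "coboundaries V d n =
    (case n of 0 \<Rightarrow> {\<zero>\<^bsub>V 0\<^esub>} | Suc m \<Rightarrow> d m ` carrier (V m))"

definition cocycle_space ::
    "(nat \<Rightarrow> ('k, 'w) module) \<Rightarrow> (nat \<Rightarrow> 'w \<Rightarrow> 'w) \<Rightarrow> nat \<Rightarrow> ('k, 'w) module"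
  where "cocycle_space V d n = (V n)\<lparr>carrier := cocycles V d n\<rparr>"

definition cohomology ::
    "(nat \<Rightarrow> ('k, 'w) module) \<Rightarrow> (nat \<Rightarrow> 'w \<Rightarrow> 'w) \<Rightarrow> nat \<Rightarrow> ('k, 'w set) module"
  where "cohomology V d n = quot_space (cocycle_space V d n) (coboundaries V d n)"

definition coh_class ::
    "(nat \<Rightarrow> ('k, 'w) module) \<Rightarrow> (nat \<Rightarrow> 'w \<Rightarrow> 'w) \<Rightarrow> nat \<Rightarrow> 'w \<Rightarrow> 'w set"
  where "coh_class V d n x = coboundaries V d n +>\<^bsub>cocycle_space V d n\<^esub> x"

text \<open>The map \<open>H(f)\<close> on cohomology induced by a cochain map \<open>f : (V, d) \<rightarrow> (W, e)\<close>.\<close>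

definition cohomology_map ::
    "(nat \<Rightarrow> ('k, 'v) module) \<Rightarrow> (nat \<Rightarrow> 'v \<Rightarrow> 'v) \<Rightarrow>
     (nat \<Rightarrow> ('k, 'w) module) \<Rightarrow> (nat \<Rightarrow> 'w \<Rightarrow> 'w) \<Rightarrow>
     (nat \<Rightarrow> 'v \<Rightarrow> 'w) \<Rightarrow> nat \<Rightarrow> 'v set \<Rightarrow> 'w set"
  where "cohomology_map V d W e f n h =
    (THE y. \<exists>x\<in>cocycles V d n. h = coh_class V d n x \<and> y = coh_class W e n (f n x))"


section \<open>Differential calculi\<close>

text \<open>
  The homogeneous components \<open>\<Omega>\<^sup>n\<close> are given as a family of vector spaces, with the total space
  their external direct sum; the product is given on homogeneous elements.
\<close>

record ('k, 'w) dga =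
  forms :: "nat \<Rightarrow> ('k, 'w) module"
  wedge :: "nat \<Rightarrow> nat \<Rightarrow> 'w \<Rightarrow> 'w \<Rightarrow> 'w"
  diff :: "nat \<Rightarrow> 'w \<Rightarrow> 'w"

definition koszul_sign :: "('k, 'w) module \<Rightarrow> nat \<Rightarrow> 'w \<Rightarrow> 'w"
  where "koszul_sign V r x = (if even r then x else \<ominus>\<^bsub>V\<^esub> x)"

locale differential_calculus =
  fixes k :: "'k ring" and A :: "('k, 'w) module" and \<Omega> :: "('k, 'w) dga"
  assumes algebra: "assoc_algebra k A"
    and forms_0: "forms \<Omega> 0 = A"
    and forms_space: "module k (forms \<Omega> n)"
    and wedge_bilinear:
      "bilinear_map k (forms \<Omega> m) (forms \<Omega> n) (forms \<Omega> (m + n)) (wedge \<Omega> m n)"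
    and wedge_0_0: "\<lbrakk>x \<in> carrier A; y \<in> carrier A\<rbrakk> \<Longrightarrow> wedge \<Omega> 0 0 x y = x \<otimes>\<^bsub>A\<^esub> y"
    and wedge_assoc:
      "\<lbrakk>x \<in> carrier (forms \<Omega> l); y \<in> carrier (forms \<Omega> m); z \<in> carrier (forms \<Omega> n)\<rbrakk> \<Longrightarrow>
        wedge \<Omega> (l + m) n (wedge \<Omega> l m x y) z = wedge \<Omega> l (m + n) x (wedge \<Omega> m n y z)"
    and wedge_one_left: "x \<in> carrier (forms \<Omega> n) \<Longrightarrow> wedge \<Omega> 0 n \<one>\<^bsub>A\<^esub> x = x"
    and wedge_one_right: "x \<in> carrier (forms \<Omega> n) \<Longrightarrow> wedge \<Omega> n 0 x \<one>\<^bsub>A\<^esub> = x"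
    and diff_lin: "diff \<Omega> n \<in> linmap k (forms \<Omega> n) (forms \<Omega> (Suc n))"
    and diff_diff: "x \<in> carrier (forms \<Omega> n) \<Longrightarrow>
        diff \<Omega> (Suc n) (diff \<Omega> n x) = \<zero>\<^bsub>forms \<Omega> (Suc (Suc n))\<^esub>"
    and leibniz: "\<lbrakk>x \<in> carrier (forms \<Omega> m); y \<in> carrier (forms \<Omega> n)\<rbrakk> \<Longrightarrow>
        diff \<Omega> (m + n) (wedge \<Omega> m n x y) =
        wedge \<Omega> (Suc m) n (diff \<Omega> m x) y \<oplus>\<^bsub>forms \<Omega> (Suc (m + n))\<^esub>
        koszul_sign (forms \<Omega> (Suc (m + n))) m (wedge \<Omega> m (Suc n) x (diff \<Omega> n y))"
    and one_forms: "\<omega> \<in> carrier (forms \<Omega> 1) \<Longrightarrow>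
        \<exists>(N::nat) a b. a \<in> {..<N} \<rightarrow> carrier A \<and> b \<in> {..<N} \<rightarrow> carrier A \<and>
          \<omega> = (\<Oplus>\<^bsub>forms \<Omega> 1\<^esub>i\<in>{..<N}. wedge \<Omega> 0 1 (a i) (diff \<Omega> 0 (b i)))"

abbreviation de_rham :: "('k, 'w) dga \<Rightarrow> nat \<Rightarrow> ('k, 'w set) module"
  where "de_rham \<Omega> n \<equiv> cohomology (forms \<Omega>) (diff \<Omega>) n"

definition connected_calculus :: "'k ring \<Rightarrow> ('k, 'p) module \<Rightarrow> ('k, 'p) dga \<Rightarrow> bool"
  where "connected_calculus k P \<Omega> \<longleftrightarrow>
    {p \<in> carrier P. diff \<Omega> 0 p = \<zero>\<^bsub>forms \<Omega> 1\<^esub>} = {a \<odot>\<^bsub>P\<^esub> \<one>\<^bsub>P\<^esub> | a. a \<in> carrier k}"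

text \<open>
  Woronowicz: a relation \<open>\<Sum> a\<^sub>i db\<^sub>i = 0\<close> in \<open>\<Omega>\<^sup>1P\<close> implies \<open>\<Sum> \<Delta>(a\<^sub>i) (id \<otimes> d)\<Delta>(b\<^sub>i) = 0\<close> in
  \<open>P \<otimes> \<Omega>\<^sup>1P\<close> (left covariance) and \<open>\<Sum> \<Delta>(a\<^sub>i) (d \<otimes> id)\<Delta>(b\<^sub>i) = 0\<close> in \<open>\<Omega>\<^sup>1P \<otimes> P\<close> (right covariance).
\<close>

definition left_covariant ::
    "'k ring \<Rightarrow> ('k, 'p) module \<Rightarrow> ('p \<Rightarrow> ('k, 'p, 'p) tens) \<Rightarrow> ('k, 'p) dga \<Rightarrow> bool"
  where "left_covariant k P \<Delta> \<Omega> \<longleftrightarrow>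
    (\<forall>(N::nat) a b. a \<in> {..<N} \<rightarrow> carrier P \<longrightarrow> b \<in> {..<N} \<rightarrow> carrier P \<longrightarrow>
      (\<Oplus>\<^bsub>forms \<Omega> 1\<^esub>i\<in>{..<N}. wedge \<Omega> 0 1 (a i) (diff \<Omega> 0 (b i))) = \<zero>\<^bsub>forms \<Omega> 1\<^esub> \<longrightarrow>
      (\<Oplus>\<^bsub>tensor k P (forms \<Omega> 1)\<^esub>i\<in>{..<N}.
        tensor_prod k P P P (forms \<Omega> 1) P (forms \<Omega> 1) (mult P) (wedge \<Omega> 0 1) (\<Delta> (a i))
          (tensor_map k P P P (forms \<Omega> 1) (\<lambda>x. x) (diff \<Omega> 0) (\<Delta> (b i))))
      = \<zero>\<^bsub>tensor k P (forms \<Omega> 1)\<^esub>)"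

definition right_covariant ::
    "'k ring \<Rightarrow> ('k, 'p) module \<Rightarrow> ('p \<Rightarrow> ('k, 'p, 'p) tens) \<Rightarrow> ('k, 'p) dga \<Rightarrow> bool"
  where "right_covariant k P \<Delta> \<Omega> \<longleftrightarrow>
    (\<forall>(N::nat) a b. a \<in> {..<N} \<rightarrow> carrier P \<longrightarrow> b \<in> {..<N} \<rightarrow> carrier P \<longrightarrow>
      (\<Oplus>\<^bsub>forms \<Omega> 1\<^esub>i\<in>{..<N}. wedge \<Omega> 0 1 (a i) (diff \<Omega> 0 (b i))) = \<zero>\<^bsub>forms \<Omega> 1\<^esub> \<longrightarrow>
      (\<Oplus>\<^bsub>tensor k (forms \<Omega> 1) P\<^esub>i\<in>{..<N}.
        tensor_prod k P P (forms \<Omega> 1) P (forms \<Omega> 1) P (wedge \<Omega> 0 1) (mult P) (\<Delta> (a i))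
          (tensor_map k P P (forms \<Omega> 1) P (diff \<Omega> 0) (\<lambda>x. x) (\<Delta> (b i))))
      = \<zero>\<^bsub>tensor k (forms \<Omega> 1) P\<^esub>)"

definition bicovariant ::
    "'k ring \<Rightarrow> ('k, 'p) module \<Rightarrow> ('p \<Rightarrow> ('k, 'p, 'p) tens) \<Rightarrow> ('k, 'p) dga \<Rightarrow> bool"
  where "bicovariant k P \<Delta> \<Omega> \<longleftrightarrow> left_covariant k P \<Delta> \<Omega> \<and> right_covariant k P \<Delta> \<Omega>"


section \<open>Differentiable coactions\<close>

text \<open>
  \<open>\<Omega>\<^sup>n(P \<otimes> M)\<close> is the external direct sum of the \<open>\<Omega>\<^sup>rP \<otimes> \<Omega>\<^sup>n\<^sup>-\<^sup>rM\<close>, \<open>r \<le> n\<close>: an element \<open>t\<close> is the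
  family of its components \<open>t r\<close>, so that the projection \<open>\<Pi>\<^sub>r\<close> is evaluation at \<open>r\<close>.
\<close>

definition tensor_forms ::
    "'k ring \<Rightarrow> ('k, 'p) dga \<Rightarrow> ('k, 'm) dga \<Rightarrow> nat \<Rightarrow> ('k, nat \<Rightarrow> ('k, 'p, 'm) tens) module"
  where "tensor_forms k \<Omega>P \<Omega>M n =
    (let T = (\<lambda>r. tensor k (forms \<Omega>P r) (forms \<Omega>M (n - r))) in
      \<lparr>carrier = (\<Pi>\<^sub>E r\<in>{..n}. carrier (T r)), mult = undefined, one = undefined,
       zero = (\<lambda>r\<in>{..n}. \<zero>\<^bsub>T r\<^esub>), add = (\<lambda>s t. \<lambda>r\<in>{..n}. s r \<oplus>\<^bsub>T r\<^esub> t r),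
       smult = (\<lambda>a t. \<lambda>r\<in>{..n}. a \<odot>\<^bsub>T r\<^esub> t r)\<rparr>)"

definition form_proj :: "nat \<Rightarrow> (nat \<Rightarrow> ('k, 'p, 'm) tens) \<Rightarrow> ('k, 'p, 'm) tens"
  where "form_proj r t = t r"

text \<open>
  The component in \<open>\<Omega>\<^sup>rP \<otimes> \<Omega>\<^sup>n\<^sup>+\<^sup>1\<^sup>-\<^sup>rM\<close> of \<open>dt\<close>, for \<open>t \<in> \<Omega>\<^sup>n(P \<otimes> M)\<close>, is
  \<open>(d \<otimes> id) t\<^sub>r\<^sub>-\<^sub>1 + (-1)\<^sup>r (id \<otimes> d) t\<^sub>r\<close>.
\<close>

definition tensor_diff ::
    "'k ring \<Rightarrow> ('k, 'p) dga \<Rightarrow> ('k, 'm) dga \<Rightarrow> nat \<Rightarrow>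
      (nat \<Rightarrow> ('k, 'p, 'm) tens) \<Rightarrow> (nat \<Rightarrow> ('k, 'p, 'm) tens)"
  where "tensor_diff k \<Omega>P \<Omega>M n t =
    (\<lambda>r\<in>{..Suc n}. let T = tensor k (forms \<Omega>P r) (forms \<Omega>M (Suc n - r)) in
      (case r of 0 \<Rightarrow> \<zero>\<^bsub>T\<^esub>
       | Suc q \<Rightarrow> tensor_map k (forms \<Omega>P q) (forms \<Omega>M (n - q)) (forms \<Omega>P r) (forms \<Omega>M (Suc n - r))
           (diff \<Omega>P q) (\<lambda>x. x) (t q))
      \<oplus>\<^bsub>T\<^esub>
      (if r \<le> n then koszul_sign T r
         (tensor_map k (forms \<Omega>P r) (forms \<Omega>M (n - r)) (forms \<Omega>P r) (forms \<Omega>M (Suc n - r))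
           (\<lambda>x. x) (diff \<Omega>M (n - r)) (t r))
       else \<zero>\<^bsub>T\<^esub>))"

text \<open>
  \<open>lam_star\<close> is an extension of \<open>lam : M \<rightarrow> P \<otimes> M\<close> to forms that commutes with the differentials;
  \<open>lam\<close> is differentiable if there is one.
\<close>

definition differentiable_extension ::
    "'k ring \<Rightarrow> ('k, 'm) module \<Rightarrow> ('k, 'p) dga \<Rightarrow> ('k, 'm) dga \<Rightarrow>
      ('m \<Rightarrow> ('k, 'p, 'm) tens) \<Rightarrow> (nat \<Rightarrow> 'm \<Rightarrow> nat \<Rightarrow> ('k, 'p, 'm) tens) \<Rightarrow> bool"
  where "differentiable_extension k M \<Omega>P \<Omega>M lam lam_star \<longleftrightarrow>
    (\<forall>n. lam_star n \<in> linmap k (forms \<Omega>M n) (tensor_forms k \<Omega>P \<Omega>M n)) \<and>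
    (\<forall>m\<in>carrier M. form_proj 0 (lam_star 0 m) = lam m) \<and>
    (\<forall>n. \<forall>\<omega>\<in>carrier (forms \<Omega>M n).
      lam_star (Suc n) (diff \<Omega>M n \<omega>) = tensor_diff k \<Omega>P \<Omega>M n (lam_star n \<omega>))"

text \<open>
  That the next map is a \<open>P\<close>-coaction on \<open>\<Omega>\<^sup>nM\<close> is part of what is meant by a differentiable coaction;
  it does not follow from \<open>differentiable_extension\<close> alone, since \<open>\<Omega>\<^sup>nM\<close> need not be generated by
  \<open>M\<close> and \<open>dM\<close>.
\<close>

definition lam_bar ::
    "(nat \<Rightarrow> 'm \<Rightarrow> nat \<Rightarrow> ('k, 'p, 'm) tens) \<Rightarrow> nat \<Rightarrow> 'm \<Rightarrow> ('k, 'p, 'm) tens"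
  where "lam_bar lam_star n \<omega> = form_proj 0 (lam_star n \<omega>)"

text \<open>
  The coaction \<open>[\<omega>] \<mapsto> (id \<otimes> [\<cdot>]) lam_bar(\<omega>)\<close> on cohomology.  The class \<open>[\<cdot>]\<close> is only defined on
  the cocycles \<open>Z\<close>, so \<open>lam_bar(\<omega>) \<in> P \<otimes> \<Omega>\<^sup>nM\<close> is first written as the image of some \<open>t \<in> P \<otimes> Z\<close>.
\<close>

definition lam_tilde ::
    "'k ring \<Rightarrow> ('k, 'p) module \<Rightarrow> ('k, 'm) dga \<Rightarrow>
      (nat \<Rightarrow> 'm \<Rightarrow> nat \<Rightarrow> ('k, 'p, 'm) tens) \<Rightarrow> nat \<Rightarrow> 'm set \<Rightarrow> ('k, 'p, 'm set) tens"
  where "lam_tilde k P \<Omega> lam_star n h =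
    (let Z = cocycle_space (forms \<Omega>) (diff \<Omega>) n in
      THE y. \<exists>\<omega>\<in>carrier Z. \<exists>t\<in>carrier (tensor k P Z).
        h = coh_class (forms \<Omega>) (diff \<Omega>) n \<omega> \<and>
        tensor_map k P Z P (forms \<Omega> n) (\<lambda>x. x) (\<lambda>x. x) t = lam_bar lam_star n \<omega> \<and>
        y = tensor_map k P Z P (de_rham \<Omega> n) (\<lambda>x. x) (coh_class (forms \<Omega>) (diff \<Omega>) n) t)"

text \<open>The subcomplex of left invariant forms; its differential is that of \<open>\<Omega>\<close>.\<close>

definition inv_forms ::
    "'k ring \<Rightarrow> ('k, 'p) module \<Rightarrow> ('k, 'm) dga \<Rightarrow>
      (nat \<Rightarrow> 'm \<Rightarrow> nat \<Rightarrow> ('k, 'p, 'm) tens) \<Rightarrow> nat \<Rightarrow> ('k, 'm) module"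
  where "inv_forms k P \<Omega> lam_star n = coinv_space k P (forms \<Omega> n) (lam_bar lam_star n)"

abbreviation inv_cohomology ::
    "'k ring \<Rightarrow> ('k, 'p) module \<Rightarrow> ('k, 'm) dga \<Rightarrow>
      (nat \<Rightarrow> 'm \<Rightarrow> nat \<Rightarrow> ('k, 'p, 'm) tens) \<Rightarrow> nat \<Rightarrow> ('k, 'm set) module"
  where "inv_cohomology k P \<Omega> lam_star n \<equiv>
    cohomology (inv_forms k P \<Omega> lam_star) (diff \<Omega>) n"

text \<open>\<open>H(i)\<close> for the inclusion \<open>i\<close> of the left invariant forms.\<close>

definition H_incl ::
    "'k ring \<Rightarrow> ('k, 'p) module \<Rightarrow> ('k, 'm) dga \<Rightarrow>
      (nat \<Rightarrow> 'm \<Rightarrow> nat \<Rightarrow> ('k, 'p, 'm) tens) \<Rightarrow> nat \<Rightarrow> 'm set \<Rightarrow> 'm set"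
  where "H_incl k P \<Omega> lam_star =
    cohomology_map (inv_forms k P \<Omega> lam_star) (diff \<Omega>) (forms \<Omega>) (diff \<Omega>) (\<lambda>_ \<omega>. \<omega>)"

abbreviation coinv_cohomology ::
    "'k ring \<Rightarrow> ('k, 'p) module \<Rightarrow> ('k, 'm) dga \<Rightarrow>
      (nat \<Rightarrow> 'm \<Rightarrow> nat \<Rightarrow> ('k, 'p, 'm) tens) \<Rightarrow> nat \<Rightarrow> ('k, 'm set) module"
  where "coinv_cohomology k P \<Omega> lam_star n \<equiv>
    coinv_space k P (de_rham \<Omega> n) (lam_tilde k P \<Omega> lam_star n)"

end

theory Submission
  imports Defs
begin

text \<open>
  If \<open>I\<close> is a normalised left integral, then \<open>R = (I \<otimes> id) \<circ> \<rho>\<close> projects every comodule onto its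
  coinvariants, naturally in the comodule; on forms it therefore commutes with \<open>d\<close>, which makes
  \<open>H(i)\<close> injective, and \<open>[R \<omega>] = [\<omega>]\<close> for a coinvariant class \<open>[\<omega>]\<close>, which makes it surjective.

  If \<open>d\<omega> = 0\<close>, the component of \<open>d \<lambda>\<^sub>*(\<omega>) = 0\<close> in \<open>\<Omega>\<^sup>1P \<otimes> \<Omega>\<^sup>nM\<close> says that \<open>(d \<otimes> id) \<lambda>(\<omega>)\<close> lies in the
  image of \<open>id \<otimes> d\<close>, so that \<open>d \<otimes> id\<close> kills the coaction of the class \<open>[\<omega>]\<close>.  For connected \<open>P\<close> this
  puts it in \<open>1 \<otimes> H\<^sup>n(M)\<close>, and the counit identifies it as \<open>1 \<otimes> [\<omega>]\<close>.

  A cosemisimple Hopf algebra has a normalised left integral: convolving functionals shows that \<open>1\<close>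
  is not in the span of the simple subcoalgebras other than \<open>k1\<close>, and a functional that vanishes on
  that span and maps \<open>1\<close> to \<open>1\<close> is left invariant.

  Exactness of tensor products over a field enters only through generalised inverses: a linear map
  \<open>d\<close> has a linear \<open>s\<close> with \<open>d s d = d\<close>, and \<open>1 - s d\<close> is then a projection onto \<open>ker d\<close>.
\<close>

section \<open>Linear maps\<close>

text \<open>Tensors are cosets without normal form, and \<open>tensor_lift\<close>,
  \<open>cohomology_map\<close> and \<open>lam_tilde\<close> are definite descriptions. Once the
  universal property is available, identities between linear maps are checked on pure tensors only.
  \<open>lam_tilde\<close> is the hardest case, since it asks for a preimage in P \<otimes> Z of an
  element of P \<otimes> V. A generalised inverse settles this: d s d = d is an equation, so it
  survives tensoring with P, and every element of ker (id \<otimes> d) is fixed by id \<otimes> (1 -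
  s d).

  Convolution yields the integral because \<Delta> 1 = 1 \<otimes> 1 keeps a product of functionals
  normalised at 1, while \<Delta> C \<subseteq> C \<otimes> C makes the product vanish on C as soon
  as one factor does. This treats finitely many subcoalgebras at a time, which is enough to decide
  membership in a span. Invariance of the resulting functional is checked on each simple C: both
  sides are zero if 1 \<notin> C, and simplicity forces C = k1 if 1 \<in> C.\<close>

lemma (in abelian_group) a_inv_zero: "\<ominus> \<zero> = \<zero>"
  using add.inv_one by (simp add: a_inv_def)

lemma (in abelian_group) minus_eq_zero_iff:
  assumes "x \<in> carrier G" "y \<in> carrier G"
  shows "x \<ominus> y = \<zero> \<longleftrightarrow> x = y"
proof
  assume "x \<ominus> y = \<zero>"
  then have "x = \<ominus> (\<ominus> y)" using assms by (intro minus_equality[symmetric]) (auto simp: a_minus_def)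
  then show "x = y" using assms by simp
qed (use assms in \<open>simp add: a_minus_def r_neg\<close>)

lemma (in abelian_group) minus_minus_cancel:
  assumes "x \<in> carrier G" "y \<in> carrier G" "z \<in> carrier G"
  shows "(x \<ominus> y) \<ominus> (x \<ominus> z) = z \<ominus> y"
proof -
  have "(x \<ominus> y) \<ominus> (x \<ominus> z) = (x \<oplus> \<ominus> x) \<oplus> (z \<ominus> y)"
    using assms by (simp add: a_minus_def minus_add a_ac)
  then show ?thesis using assms by (simp add: r_neg)
qed

lemma linmapI:
  assumes "\<And>x. x \<in> carrier V \<Longrightarrow> f x \<in> carrier W"
    and "\<And>x y. \<lbrakk>x \<in> carrier V; y \<in> carrier V\<rbrakk> \<Longrightarrow> f (x \<oplus>\<^bsub>V\<^esub> y) = f x \<oplus>\<^bsub>W\<^esub> f y"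
    and "\<And>a x. \<lbrakk>a \<in> carrier k; x \<in> carrier V\<rbrakk> \<Longrightarrow> f (a \<odot>\<^bsub>V\<^esub> x) = a \<odot>\<^bsub>W\<^esub> f x"
  shows "f \<in> linmap k V W"
  using assms by (auto simp: linmap_def hom_def)

lemma linmap_closed: "\<lbrakk>f \<in> linmap k V W; x \<in> carrier V\<rbrakk> \<Longrightarrow> f x \<in> carrier W"
  by (auto simp: linmap_def hom_def)

lemma linmap_add:
  "\<lbrakk>f \<in> linmap k V W; x \<in> carrier V; y \<in> carrier V\<rbrakk> \<Longrightarrow> f (x \<oplus>\<^bsub>V\<^esub> y) = f x \<oplus>\<^bsub>W\<^esub> f y"
  by (auto simp: linmap_def hom_def)

lemma linmap_smult:
  "\<lbrakk>f \<in> linmap k V W; a \<in> carrier k; x \<in> carrier V\<rbrakk> \<Longrightarrow> f (a \<odot>\<^bsub>V\<^esub> x) = a \<odot>\<^bsub>W\<^esub> f x"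
  by (auto simp: linmap_def)

lemma linmap_group_hom:
  assumes "module k V" "module k W" "f \<in> linmap k V W"
  shows "group_hom (add_monoid V) (add_monoid W) f"
  using assms(3) abelian_group.a_group[OF module.axioms(2)[OF assms(1)]]
    abelian_group.a_group[OF module.axioms(2)[OF assms(2)]]
  by (simp add: group_hom_def group_hom_axioms_def linmap_def)

lemma linmap_zero:
  assumes "module k V" "module k W" "f \<in> linmap k V W"
  shows "f \<zero>\<^bsub>V\<^esub> = \<zero>\<^bsub>W\<^esub>"
  using group_hom.hom_one[OF linmap_group_hom[OF assms]] by simp

lemma linmap_a_inv:
  assumes "module k V" "module k W" "f \<in> linmap k V W" "x \<in> carrier V"
  shows "f (\<ominus>\<^bsub>V\<^esub> x) = \<ominus>\<^bsub>W\<^esub> f x"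
  using group_hom.hom_inv[OF linmap_group_hom[OF assms(1-3)]] assms(4) by (simp add: a_inv_def)

lemma linmap_minus:
  assumes "module k V" "module k W" "f \<in> linmap k V W" "x \<in> carrier V" "y \<in> carrier V"
  shows "f (x \<ominus>\<^bsub>V\<^esub> y) = f x \<ominus>\<^bsub>W\<^esub> f y"
proof -
  interpret V: module k V by fact
  show ?thesis
    using assms linmap_a_inv[OF assms(1-3)] by (simp add: a_minus_def linmap_add)
qed

lemma linmap_id [simp]: "(\<lambda>x. x) \<in> linmap k V V"
  by (rule linmapI) auto

lemma linmap_inclusion: "C \<subseteq> carrier V \<Longrightarrow> (\<lambda>x. x) \<in> linmap k (V\<lparr>carrier := C\<rparr>) V"
  by (rule linmapI) auto

lemma linmap_restrict_dom:
  "\<lbrakk>f \<in> linmap k V W; C \<subseteq> carrier V\<rbrakk> \<Longrightarrow> f \<in> linmap k (V\<lparr>carrier := C\<rparr>) W"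
  by (rule linmapI) (auto simp: linmap_closed linmap_add linmap_smult subset_eq)

lemma linmap_restrict_codom:
  "\<lbrakk>f \<in> linmap k V W; \<And>x. x \<in> carrier V \<Longrightarrow> f x \<in> C\<rbrakk> \<Longrightarrow> f \<in> linmap k V (W\<lparr>carrier := C\<rparr>)"
  by (rule linmapI) (auto simp: linmap_add linmap_smult)

lemma linmap_comp:
  "\<lbrakk>f \<in> linmap k U V; g \<in> linmap k V W\<rbrakk> \<Longrightarrow> (\<lambda>x. g (f x)) \<in> linmap k U W"
  by (rule linmapI) (auto simp: linmap_closed linmap_add linmap_smult)

lemma linmap_diff:
  assumes "module k V" "module k W" "f \<in> linmap k V W" "g \<in> linmap k V W"
  shows "(\<lambda>x. f x \<ominus>\<^bsub>W\<^esub> g x) \<in> linmap k V W"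
proof -
  interpret W: module k W by fact
  show ?thesis
    by (rule linmapI)
      (use assms in \<open>auto simp: linmap_closed linmap_add linmap_smult a_minus_def W.minus_add W.smult_r_distr W.smult_r_minus W.a_ac\<close>)
qed

lemma linmap_const_zero:
  assumes "module k W"
  shows "(\<lambda>x. \<zero>\<^bsub>W\<^esub>) \<in> linmap k V W"
proof -
  interpret W: module k W by fact
  show ?thesis by (rule linmapI) auto
qed

section \<open>Subspaces, equalisers and linear spans\<close>

lemma submodule_subset: "submodule U k V \<Longrightarrow> U \<subseteq> carrier V"
  using subgroup.subset[OF submodule.axioms(1)] by auto

lemma submodule_zero: "submodule U k V \<Longrightarrow> \<zero>\<^bsub>V\<^esub> \<in> U"
  using subgroup.one_closed[OF submodule.axioms(1)] by auto

lemma submodule_add: "\<lbrakk>submodule U k V; x \<in> U; y \<in> U\<rbrakk> \<Longrightarrow> x \<oplus>\<^bsub>V\<^esub> y \<in> U"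
  using subgroup.m_closed[OF submodule.axioms(1)] by fastforce

lemma submodule_smult: "\<lbrakk>submodule U k V; a \<in> carrier k; x \<in> U\<rbrakk> \<Longrightarrow> a \<odot>\<^bsub>V\<^esub> x \<in> U"
  using submodule.smult_closed by metis

text \<open>Negation is multiplication by the scalar -1, so closure under inverses follows from
  closure under scalars.\<close>

lemma submoduleI':
  assumes "module k V" "U \<subseteq> carrier V" "\<zero>\<^bsub>V\<^esub> \<in> U"
    and "\<And>x y. \<lbrakk>x \<in> U; y \<in> U\<rbrakk> \<Longrightarrow> x \<oplus>\<^bsub>V\<^esub> y \<in> U"
    and "\<And>a x. \<lbrakk>a \<in> carrier k; x \<in> U\<rbrakk> \<Longrightarrow> a \<odot>\<^bsub>V\<^esub> x \<in> U"
  shows "submodule U k V"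
proof -
  interpret V: module k V by fact
  have "\<ominus>\<^bsub>V\<^esub> x \<in> U" if "x \<in> U" for x
    using assms(5)[of "\<ominus>\<^bsub>k\<^esub> \<one>\<^bsub>k\<^esub>" x] that assms(2) by (auto simp: V.smult_l_minus)
  then show ?thesis using assms by (intro V.submoduleI) auto
qed

lemma submodule_minus:
  assumes "module k V" "submodule U k V" "x \<in> U" "y \<in> U"
  shows "x \<ominus>\<^bsub>V\<^esub> y \<in> U"
  using assms module.submoduleE(3)[OF assms(1,2)] by (simp add: a_minus_def submodule_add)

lemma submodule_module: "\<lbrakk>module k V; submodule U k V\<rbrakk> \<Longrightarrow> module k (V\<lparr>carrier := U\<rparr>)"
  by (rule submodule.submodule_is_module)

text \<open>Used in two ways: coinvariants are the equaliser of the coaction and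
  \<open>1 \<otimes> -\<close>, and two linear maps that agree on a spanning set agree on its
  span.\<close>

lemma submodule_equalizer:
  assumes V: "module k V" and W: "module k W" and f: "f \<in> linmap k V W" and g: "g \<in> linmap k V W"
  shows "submodule {x \<in> carrier V. f x = g x} k V"
proof -
  interpret V: module k V by fact
  show ?thesis
    by (rule submoduleI'[OF V])
      (use assms in \<open>auto simp: linmap_add linmap_smult linmap_zero\<close>)
qed

lemma submodule_kernel:
  assumes "module k V" "module k W" "f \<in> linmap k V W"
  shows "submodule {x \<in> carrier V. f x = \<zero>\<^bsub>W\<^esub>} k V"
  using submodule_equalizer[OF assms linmap_const_zero[OF assms(2)]] .

lemma submodule_image:
  assumes V: "module k V" and W: "module k W" and f: "f \<in> linmap k V W"
  shows "submodule (f ` carrier V) k W"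
proof -
  interpret V: module k V by fact
  show ?thesis
  proof (rule submoduleI'[OF W])
    show "f ` carrier V \<subseteq> carrier W" using f by (auto simp: linmap_closed)
    show "\<zero>\<^bsub>W\<^esub> \<in> f ` carrier V"
      using linmap_zero[OF assms] by (metis V.zero_closed imageI)
  next
    fix x y assume "x \<in> f ` carrier V" "y \<in> f ` carrier V"
    then show "x \<oplus>\<^bsub>W\<^esub> y \<in> f ` carrier V"
      using f by (auto simp: linmap_add[symmetric])
  next
    fix a x assume "a \<in> carrier k" "x \<in> f ` carrier V"
    then show "a \<odot>\<^bsub>W\<^esub> x \<in> f ` carrier V"
      using f by (auto simp: linmap_smult[symmetric])
  qed
qed

text \<open>Needed because cohomology is a quotient of the cocycle space, whereas the coboundaries
  are first seen as a subspace of all cochains.\<close>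

lemma submodule_restrict:
  assumes "submodule U k V" "submodule C k V" "module k V" "U \<subseteq> C"
  shows "submodule U k (V\<lparr>carrier := C\<rparr>)"
  using assms(4) submodule_zero[OF assms(1)] submodule_add[OF assms(1)] submodule_smult[OF assms(1)]
  by (intro submoduleI'[OF submodule_module[OF assms(3,2)]]) auto

text \<open>Acts as the induction principle for spans, with \<open>H\<close> the set of vectors
  having the desired property.\<close>

lemma lin_span_minimal: "\<lbrakk>submodule H k V; X \<subseteq> H\<rbrakk> \<Longrightarrow> lin_span k V X \<subseteq> H"
  by (auto simp: lin_span_def)

lemma lin_span_superset: "X \<subseteq> lin_span k V X"
  by (auto simp: lin_span_def)

lemma lin_span_submodule:
  assumes "module k V" "X \<subseteq> carrier V"
  shows "submodule (lin_span k V X) k V"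
proof (rule submoduleI'[OF assms(1)])
  show "lin_span k V X \<subseteq> carrier V"
    using assms module.carrier_is_submodule lin_span_minimal by blast
qed (auto simp: lin_span_def submodule_zero submodule_add submodule_smult)

lemma scalar_space_module: "cring k \<Longrightarrow> module k (scalar_space k)"
proof -
  assume "cring k"
  then interpret cring k .
  have 1: "abelian_group (scalar_space k)"
    by (rule abelian_groupI) (auto simp: scalar_space_def a_ac l_neg intro: l_neg a_inv_closed)
  show ?thesis
    by (rule moduleI[OF \<open>cring k\<close> 1]) (auto simp: scalar_space_def l_distr r_distr m_assoc)
qed

lemma scalar_space_simps [simp]:
  "carrier (scalar_space k) = carrier k" "\<zero>\<^bsub>scalar_space k\<^esub> = \<zero>\<^bsub>k\<^esub>"
  "add (scalar_space k) = add k" "smult (scalar_space k) = mult k"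
  by (simp_all add: scalar_space_def)

section \<open>Quotient spaces\<close>

locale quotient =
  fixes k :: "'k ring" and V :: "('k, 'v) module" and U :: "'v set"
  assumes V: "module k V" and U: "submodule U k V"
begin

sublocale V: module k V by (rule V)

lemma U_carrier: "x \<in> U \<Longrightarrow> x \<in> carrier V"
  using submodule_subset[OF U] by auto

sublocale U: abelian_subgroup U V
  by (rule abelian_subgroupI3)
    (use U in \<open>auto simp: additive_subgroup_def submodule_def intro: V.abelian_group_axioms\<close>)

lemma coset_eq_iff:
  assumes "x \<in> carrier V" "y \<in> carrier V"
  shows "U +>\<^bsub>V\<^esub> x = U +>\<^bsub>V\<^esub> y \<longleftrightarrow> x \<ominus>\<^bsub>V\<^esub> y \<in> U"
proof -
  have "U +>\<^bsub>V\<^esub> x = U +>\<^bsub>V\<^esub> y \<longleftrightarrow> x \<in> U +>\<^bsub>V\<^esub> y"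
    using assms U.a_rcos_self[of x] U.a_repr_independence'[of x y] by metis
  then show ?thesis using assms U.a_rcos_module[of y x] by (simp add: a_minus_def)
qed

lemma quot_carrier: "carrier (quot_space V U) = (\<lambda>x. U +>\<^bsub>V\<^esub> x) ` carrier V"
  by (auto simp: quot_space_def A_RCOSETS_def')

lemma quot_zero: "\<zero>\<^bsub>quot_space V U\<^esub> = U +>\<^bsub>V\<^esub> \<zero>\<^bsub>V\<^esub>"
  using submodule_subset[OF U] by (simp add: quot_space_def)

lemma quot_add:
  assumes "x \<in> carrier V" "y \<in> carrier V"
  shows "(U +>\<^bsub>V\<^esub> x) \<oplus>\<^bsub>quot_space V U\<^esub> (U +>\<^bsub>V\<^esub> y) = U +>\<^bsub>V\<^esub> (x \<oplus>\<^bsub>V\<^esub> y)"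
  using U.a_rcos_sum assms by (simp add: quot_space_def)

text \<open>The scalar action on a coset is a union over its representatives; it collapses to one
  coset because representatives differ by some u in \<open>U\<close>, and their multiples by a u,
  again in \<open>U\<close>.\<close>

lemma quot_smult:
  assumes "a \<in> carrier k" "x \<in> carrier V"
  shows "a \<odot>\<^bsub>quot_space V U\<^esub> (U +>\<^bsub>V\<^esub> x) = U +>\<^bsub>V\<^esub> (a \<odot>\<^bsub>V\<^esub> x)"
proof -
  have "U +>\<^bsub>V\<^esub> (a \<odot>\<^bsub>V\<^esub> z) = U +>\<^bsub>V\<^esub> (a \<odot>\<^bsub>V\<^esub> x)" if z: "z \<in> U +>\<^bsub>V\<^esub> x" for z
  proof -
    obtain u where u: "u \<in> U" "z = u \<oplus>\<^bsub>V\<^esub> x" using z by (auto simp: a_r_coset_def')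
    then have "a \<odot>\<^bsub>V\<^esub> z \<ominus>\<^bsub>V\<^esub> a \<odot>\<^bsub>V\<^esub> x = a \<odot>\<^bsub>V\<^esub> u"
      using assms U_carrier by (simp add: V.smult_r_distr a_minus_def V.a_assoc V.r_neg)
    then show ?thesis
      using u assms U_carrier by (subst coset_eq_iff) (auto simp: submodule_smult[OF U])
  qed
  moreover have "x \<in> U +>\<^bsub>V\<^esub> x" by (rule U.a_rcos_self[OF assms(2)])
  ultimately have "(\<Union>z\<in>U +>\<^bsub>V\<^esub> x. U +>\<^bsub>V\<^esub> (a \<odot>\<^bsub>V\<^esub> z)) = U +>\<^bsub>V\<^esub> (a \<odot>\<^bsub>V\<^esub> x)"
    by (intro SUP_eq_const; blast)
  then show ?thesis by (simp add: quot_space_def)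
qed

lemma quot_module: "module k (quot_space V U)"
proof (rule moduleI)
  show "abelian_group (quot_space V U)"
  proof (rule abelian_groupI)
    fix X assume "X \<in> carrier (quot_space V U)"
    then obtain x where "x \<in> carrier V" "X = U +>\<^bsub>V\<^esub> x" by (auto simp: quot_carrier)
    then show "\<exists>Y\<in>carrier (quot_space V U). Y \<oplus>\<^bsub>quot_space V U\<^esub> X = \<zero>\<^bsub>quot_space V U\<^esub>"
      by (intro bexI[of _ "U +>\<^bsub>V\<^esub> (\<ominus>\<^bsub>V\<^esub> x)"]) (auto simp: quot_carrier quot_add quot_zero V.l_neg simp del: V.a_coset_add_zero)
  qed (auto simp: quot_carrier quot_zero quot_add V.a_ac simp del: V.a_coset_add_zero)
qed (auto simp: quot_carrier quot_add quot_smult V.smult_l_distr V.smult_r_distr V.smult_assoc1 V.is_cring)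

lemma coset_linmap: "(\<lambda>x. U +>\<^bsub>V\<^esub> x) \<in> linmap k V (quot_space V U)"
  by (rule linmapI) (auto simp: quot_carrier quot_add quot_smult)

lemma coset_eq_zero_iff:
  assumes "x \<in> carrier V"
  shows "U +>\<^bsub>V\<^esub> x = \<zero>\<^bsub>quot_space V U\<^esub> \<longleftrightarrow> x \<in> U"
  unfolding quot_zero using assms by (subst coset_eq_iff) (auto simp: a_minus_def V.a_inv_zero)

text \<open>The universal property of the quotient: \<open>f\<close> is constant on cosets, so its
  value at a chosen representative is independent of the choice.\<close>

lemma quot_lift:
  assumes W: "module k W" and f: "f \<in> linmap k V W" and f0: "\<And>u. u \<in> U \<Longrightarrow> f u = \<zero>\<^bsub>W\<^esub>"
  shows "\<exists>g\<in>linmap k (quot_space V U) W. \<forall>x\<in>carrier V. g (U +>\<^bsub>V\<^esub> x) = f x"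
proof -
  interpret W: module k W by fact
  define g where "g X = f (SOME x. x \<in> carrier V \<and> X = U +>\<^bsub>V\<^esub> x)" for X
  have g: "g (U +>\<^bsub>V\<^esub> x) = f x" if x: "x \<in> carrier V" for x
  proof -
    define y where "y = (SOME y. y \<in> carrier V \<and> U +>\<^bsub>V\<^esub> x = U +>\<^bsub>V\<^esub> y)"
    have y: "y \<in> carrier V \<and> U +>\<^bsub>V\<^esub> x = U +>\<^bsub>V\<^esub> y" unfolding y_def by (rule someI[of _ x]) (use x in auto)
    then have "x \<ominus>\<^bsub>V\<^esub> y \<in> U" using x coset_eq_iff by auto
    then have "f x \<ominus>\<^bsub>W\<^esub> f y = \<zero>\<^bsub>W\<^esub>" using f0 linmap_minus[OF V W f x] y by metis
    then have "f x = f y" using x y f by (simp add: linmap_closed W.minus_eq_zero_iff)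
    then show ?thesis by (simp add: g_def y_def)
  qed
  show ?thesis
  proof (rule bexI[of _ g])
    show "g \<in> linmap k (quot_space V U) W"
      by (rule linmapI)
        (use f in \<open>auto simp: quot_carrier quot_add quot_smult g linmap_closed linmap_add linmap_smult\<close>)
  qed (use g in auto)
qed

end

section \<open>Free spaces and tensor products\<close>

lemma free_carrier_iff:
  "f \<in> carrier (free_space k A) \<longleftrightarrow>
    (\<forall>x. f x \<in> carrier k) \<and> finite {x. f x \<noteq> \<zero>\<^bsub>k\<^esub>} \<and> {x. f x \<noteq> \<zero>\<^bsub>k\<^esub>} \<subseteq> A"
  by (auto simp: free_space_def)

lemma free_space_simps:
  "\<zero>\<^bsub>free_space k A\<^esub> = (\<lambda>_. \<zero>\<^bsub>k\<^esub>)"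
  "f \<oplus>\<^bsub>free_space k A\<^esub> g = (\<lambda>x. f x \<oplus>\<^bsub>k\<^esub> g x)"
  "a \<odot>\<^bsub>free_space k A\<^esub> f = (\<lambda>x. a \<otimes>\<^bsub>k\<^esub> f x)"
  by (simp_all add: free_space_def)

context
  fixes k :: "'k ring" (structure)
  assumes k: "cring k"
begin

interpretation cring k by (rule k)

lemma free_add_closed:
  assumes "f \<in> carrier (free_space k A)" "g \<in> carrier (free_space k A)"
  shows "(\<lambda>x. f x \<oplus> g x) \<in> carrier (free_space k A)"
proof -
  have "{x. f x \<oplus> g x \<noteq> \<zero>} \<subseteq> {x. f x \<noteq> \<zero>} \<union> {x. g x \<noteq> \<zero>}" by auto
  then show ?thesis
    using assms finite_subset[of "{x. f x \<oplus> g x \<noteq> \<zero>}" "{x. f x \<noteq> \<zero>} \<union> {x. g x \<noteq> \<zero>}"]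
    unfolding free_carrier_iff by (simp; blast)
qed

lemma free_smult_closed:
  assumes "a \<in> carrier k" "f \<in> carrier (free_space k A)"
  shows "(\<lambda>x. a \<otimes> f x) \<in> carrier (free_space k A)"
proof -
  have "{x. a \<otimes> f x \<noteq> \<zero>} \<subseteq> {x. f x \<noteq> \<zero>}" using assms by auto
  then show ?thesis
    using assms finite_subset[of "{x. a \<otimes> f x \<noteq> \<zero>}" "{x. f x \<noteq> \<zero>}"]
    unfolding free_carrier_iff by (simp; blast)
qed

lemma free_gen_closed: "x \<in> A \<Longrightarrow> free_gen k x \<in> carrier (free_space k A)"
  by (auto simp: free_carrier_iff free_gen_def)

lemma free_space_module: "module k (free_space k A)"
proof (rule moduleI)
  show "abelian_group (free_space k A)"
  proof (rule abelian_groupI)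
    fix f assume f: "f \<in> carrier (free_space k A)"
    have "(\<lambda>x. \<ominus> \<one> \<otimes> f x) \<in> carrier (free_space k A)"
      using f by (intro free_smult_closed) auto
    moreover have "(\<lambda>x. \<ominus> \<one> \<otimes> f x) \<oplus>\<^bsub>free_space k A\<^esub> f = \<zero>\<^bsub>free_space k A\<^esub>"
      using f by (auto simp: free_space_simps free_carrier_iff l_minus l_neg)
    ultimately show "\<exists>g\<in>carrier (free_space k A). g \<oplus>\<^bsub>free_space k A\<^esub> f = \<zero>\<^bsub>free_space k A\<^esub>"
      by blast
  next
    fix f g h assume "f \<in> carrier (free_space k A)" "g \<in> carrier (free_space k A)" "h \<in> carrier (free_space k A)"
    then show "f \<oplus>\<^bsub>free_space k A\<^esub> g \<oplus>\<^bsub>free_space k A\<^esub> h = f \<oplus>\<^bsub>free_space k A\<^esub> (g \<oplus>\<^bsub>free_space k A\<^esub> h)"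
      by (simp add: free_space_simps free_carrier_iff a_assoc)
  next
    fix f g assume "f \<in> carrier (free_space k A)" "g \<in> carrier (free_space k A)"
    then show "f \<oplus>\<^bsub>free_space k A\<^esub> g = g \<oplus>\<^bsub>free_space k A\<^esub> f"
      by (simp add: free_space_simps free_carrier_iff a_comm)
  next
    fix f assume "f \<in> carrier (free_space k A)"
    then show "\<zero>\<^bsub>free_space k A\<^esub> \<oplus>\<^bsub>free_space k A\<^esub> f = f"
      by (simp add: free_space_simps free_carrier_iff)
  next
    show "\<zero>\<^bsub>free_space k A\<^esub> \<in> carrier (free_space k A)"
      by (simp add: free_space_simps free_carrier_iff)
  qed (simp add: free_space_simps free_add_closed)
next
  fix a f assume "a \<in> carrier k" "f \<in> carrier (free_space k A)"
  then show "a \<odot>\<^bsub>free_space k A\<^esub> f \<in> carrier (free_space k A)"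
    by (simp add: free_space_simps free_smult_closed)
qed (auto simp: free_space_simps free_carrier_iff l_distr r_distr m_assoc is_cring)

text \<open>Induction on the finite support: resetting one value to zero removes one point from the
  support, and the lost term is a multiple of a generator.\<close>

lemma free_induct [consumes 1, case_names zero add]:
  assumes f: "f \<in> carrier (free_space k A)"
    and zero: "Q \<zero>\<^bsub>free_space k A\<^esub>"
    and add: "\<And>a x g. \<lbrakk>a \<in> carrier k; x \<in> A; g \<in> carrier (free_space k A); Q g\<rbrakk> \<Longrightarrow>
      Q (a \<odot>\<^bsub>free_space k A\<^esub> free_gen k x \<oplus>\<^bsub>free_space k A\<^esub> g)"
  shows "Q f"
proof -
  have "finite {x. f x \<noteq> \<zero>}" using f by (simp add: free_carrier_iff)
  then show ?thesis using f
  proof (induction "{x. f x \<noteq> \<zero>}" arbitrary: f rule: finite_induct)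
    case empty
    then have "f = \<zero>\<^bsub>free_space k A\<^esub>" by (auto simp: free_space_simps)
    then show ?case using zero by simp
  next
    case (insert x S)
    have fc: "\<And>y. f y \<in> carrier k" and SA: "insert x S \<subseteq> A"
      using insert by (auto simp: free_carrier_iff)
    have S: "S = {y. (f(x := \<zero>)) y \<noteq> \<zero>}" using insert(2,4) by auto
    have g: "f(x := \<zero>) \<in> carrier (free_space k A)"
      using fc SA insert(1) S unfolding free_carrier_iff by (metis fun_upd_apply insert_subset zero_closed)
    have "f = f x \<odot>\<^bsub>free_space k A\<^esub> free_gen k x \<oplus>\<^bsub>free_space k A\<^esub> f(x := \<zero>)"
      using fc by (auto simp: free_space_simps free_gen_def)
    then show ?case using add[OF fc _ g insert(3)[OF S g], of x x] SA by simp
  qed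
qed

end

text \<open>The universal property of the free space; the extension is the linear combination of the
  values \<phi> x over the support.\<close>

lemma free_extend:
  assumes Z: "module k Z" and \<phi>: "\<And>x. x \<in> A \<Longrightarrow> \<phi> x \<in> carrier Z"
  obtains h where "h \<in> linmap k (free_space k A) Z" "\<And>x. x \<in> A \<Longrightarrow> h (free_gen k x) = \<phi> x"
proof -
  interpret Z: module k Z by fact
  define h where "h f = (\<Oplus>\<^bsub>Z\<^esub>x\<in>{x. f x \<noteq> \<zero>\<^bsub>k\<^esub>}. f x \<odot>\<^bsub>Z\<^esub> \<phi> x)" for f
  \<comment> \<open>The sum may run over any finite set between the support and \<open>A\<close>.
    This allows f, g and their sum, whose supports differ, to be summed over one index set.\<close>
  have h: "h f = (\<Oplus>\<^bsub>Z\<^esub>x\<in>T. f x \<odot>\<^bsub>Z\<^esub> \<phi> x)"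
    if "\<And>x. f x \<in> carrier k" "finite T" "{x. f x \<noteq> \<zero>\<^bsub>k\<^esub>} \<subseteq> T" "T \<subseteq> A" for f T
    unfolding h_def
    by (rule Z.add.finprod_mono_neutral_cong_left) (use that \<phi> in \<open>auto\<close>)
  show ?thesis
  proof (rule that[of h])
    show "h (free_gen k x) = \<phi> x" if "x \<in> A" for x
      using that \<phi> by (subst h[of _ "{x}"]) (auto simp: free_gen_def)
    show "h \<in> linmap k (free_space k A) Z"
    proof (rule linmapI)
      fix f assume "f \<in> carrier (free_space k A)"
      then show "h f \<in> carrier Z"
        unfolding h_def by (intro Z.finsum_closed) (use \<phi> in \<open>auto simp: free_carrier_iff\<close>)
    next
      fix f g assume fg: "f \<in> carrier (free_space k A)" "g \<in> carrier (free_space k A)"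
      let ?T = "{x. f x \<noteq> \<zero>\<^bsub>k\<^esub>} \<union> {x. g x \<noteq> \<zero>\<^bsub>k\<^esub>}"
      have T: "finite ?T" "?T \<subseteq> A" and c: "\<And>x. f x \<in> carrier k" "\<And>x. g x \<in> carrier k"
        using fg by (auto simp: free_carrier_iff)
      have p: "\<phi> x \<in> carrier Z" if "x \<in> ?T" for x using that T \<phi> by blast
      have "h (\<lambda>x. f x \<oplus>\<^bsub>k\<^esub> g x) = (\<Oplus>\<^bsub>Z\<^esub>x\<in>?T. (f x \<oplus>\<^bsub>k\<^esub> g x) \<odot>\<^bsub>Z\<^esub> \<phi> x)"
        by (rule h) (use c T in auto)
      also have "\<dots> = (\<Oplus>\<^bsub>Z\<^esub>x\<in>?T. f x \<odot>\<^bsub>Z\<^esub> \<phi> x \<oplus>\<^bsub>Z\<^esub> g x \<odot>\<^bsub>Z\<^esub> \<phi> x)"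
        by (rule Z.finsum_cong') (use c p in \<open>auto simp: Z.smult_l_distr\<close>)
      also have "\<dots> = (\<Oplus>\<^bsub>Z\<^esub>x\<in>?T. f x \<odot>\<^bsub>Z\<^esub> \<phi> x) \<oplus>\<^bsub>Z\<^esub> (\<Oplus>\<^bsub>Z\<^esub>x\<in>?T. g x \<odot>\<^bsub>Z\<^esub> \<phi> x)"
        by (rule Z.finsum_addf) (use c p in auto)
      also have "\<dots> = h f \<oplus>\<^bsub>Z\<^esub> h g"
        using c T by (simp add: h[of f ?T] h[of g ?T])
      finally show "h (f \<oplus>\<^bsub>free_space k A\<^esub> g) = h f \<oplus>\<^bsub>Z\<^esub> h g"
        by (simp add: free_space_simps)
    next
      fix a f assume a: "a \<in> carrier k" and f: "f \<in> carrier (free_space k A)"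
      let ?T = "{x. f x \<noteq> \<zero>\<^bsub>k\<^esub>}"
      have T: "finite ?T" "?T \<subseteq> A" and c: "\<And>x. f x \<in> carrier k"
        using f by (auto simp: free_carrier_iff)
      have p: "\<phi> x \<in> carrier Z" if "x \<in> ?T" for x using that T \<phi> by blast
      have "h (\<lambda>x. a \<otimes>\<^bsub>k\<^esub> f x) = (\<Oplus>\<^bsub>Z\<^esub>x\<in>?T. (a \<otimes>\<^bsub>k\<^esub> f x) \<odot>\<^bsub>Z\<^esub> \<phi> x)"
        by (rule h) (use a c T in auto)
      also have "\<dots> = (\<Oplus>\<^bsub>Z\<^esub>x\<in>?T. a \<odot>\<^bsub>Z\<^esub> (f x \<odot>\<^bsub>Z\<^esub> \<phi> x))"
        by (rule Z.finsum_cong') (use a c p in \<open>auto simp: Z.smult_assoc1\<close>)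
      also have "\<dots> = a \<odot>\<^bsub>Z\<^esub> h f"
        unfolding h_def by (rule Z.finsum_smult_ldistr[symmetric]) (use a c p T in auto)
      finally show "h (a \<odot>\<^bsub>free_space k A\<^esub> f) = a \<odot>\<^bsub>Z\<^esub> h f"
        by (simp add: free_space_simps)
    qed
  qed
qed

section \<open>Bilinear maps and the universal property of the tensor product\<close>

lemma bilinear_mapI:
  assumes "\<And>x y. \<lbrakk>x \<in> carrier V; y \<in> carrier W\<rbrakk> \<Longrightarrow> \<phi> x y \<in> carrier Z"
    and "\<And>x x' y. \<lbrakk>x \<in> carrier V; x' \<in> carrier V; y \<in> carrier W\<rbrakk> \<Longrightarrow>
      \<phi> (x \<oplus>\<^bsub>V\<^esub> x') y = \<phi> x y \<oplus>\<^bsub>Z\<^esub> \<phi> x' y"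
    and "\<And>x y y'. \<lbrakk>x \<in> carrier V; y \<in> carrier W; y' \<in> carrier W\<rbrakk> \<Longrightarrow>
      \<phi> x (y \<oplus>\<^bsub>W\<^esub> y') = \<phi> x y \<oplus>\<^bsub>Z\<^esub> \<phi> x y'"
    and "\<And>a x y. \<lbrakk>a \<in> carrier k; x \<in> carrier V; y \<in> carrier W\<rbrakk> \<Longrightarrow>
      \<phi> (a \<odot>\<^bsub>V\<^esub> x) y = a \<odot>\<^bsub>Z\<^esub> \<phi> x y"
    and "\<And>a x y. \<lbrakk>a \<in> carrier k; x \<in> carrier V; y \<in> carrier W\<rbrakk> \<Longrightarrow>
      \<phi> x (a \<odot>\<^bsub>W\<^esub> y) = a \<odot>\<^bsub>Z\<^esub> \<phi> x y"
  shows "bilinear_map k V W Z \<phi>"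
  using assms unfolding bilinear_map_def by (auto intro!: linmapI)

lemma bilinear_mapD:
  assumes "bilinear_map k V W Z \<phi>" "x \<in> carrier V" "y \<in> carrier W"
  shows "\<phi> x y \<in> carrier Z"
    and "x' \<in> carrier V \<Longrightarrow> \<phi> (x \<oplus>\<^bsub>V\<^esub> x') y = \<phi> x y \<oplus>\<^bsub>Z\<^esub> \<phi> x' y"
    and "y' \<in> carrier W \<Longrightarrow> \<phi> x (y \<oplus>\<^bsub>W\<^esub> y') = \<phi> x y \<oplus>\<^bsub>Z\<^esub> \<phi> x y'"
    and "a \<in> carrier k \<Longrightarrow> \<phi> (a \<odot>\<^bsub>V\<^esub> x) y = a \<odot>\<^bsub>Z\<^esub> \<phi> x y"
    and "a \<in> carrier k \<Longrightarrow> \<phi> x (a \<odot>\<^bsub>W\<^esub> y) = a \<odot>\<^bsub>Z\<^esub> \<phi> x y"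
proof -
  have l: "\<phi> x \<in> linmap k W Z" "(\<lambda>x. \<phi> x y) \<in> linmap k V Z"
    using assms by (auto simp: bilinear_map_def)
  show "\<phi> x y \<in> carrier Z" using linmap_closed[OF l(1)] assms by auto
  show "x' \<in> carrier V \<Longrightarrow> \<phi> (x \<oplus>\<^bsub>V\<^esub> x') y = \<phi> x y \<oplus>\<^bsub>Z\<^esub> \<phi> x' y" using linmap_add[OF l(2)] assms by auto
  show "y' \<in> carrier W \<Longrightarrow> \<phi> x (y \<oplus>\<^bsub>W\<^esub> y') = \<phi> x y \<oplus>\<^bsub>Z\<^esub> \<phi> x y'" using linmap_add[OF l(1)] assms by auto
  show "a \<in> carrier k \<Longrightarrow> \<phi> (a \<odot>\<^bsub>V\<^esub> x) y = a \<odot>\<^bsub>Z\<^esub> \<phi> x y" using linmap_smult[OF l(2)] assms by auto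
  show "a \<in> carrier k \<Longrightarrow> \<phi> x (a \<odot>\<^bsub>W\<^esub> y) = a \<odot>\<^bsub>Z\<^esub> \<phi> x y" using linmap_smult[OF l(1)] assms by auto
qed

context
  fixes k :: "'k ring" and V :: "('k, 'v) module" and W :: "('k, 'w) module"
  assumes V: "module k V" and W: "module k W"
begin

interpretation V: module k V by (rule V)
interpretation W: module k W by (rule W)

private abbreviation "F \<equiv> free_space k (carrier V \<times> carrier W)"

private lemma F: "module k F"
  by (rule free_space_module[OF V.is_cring])

private lemma gen: "\<lbrakk>x \<in> carrier V; y \<in> carrier W\<rbrakk> \<Longrightarrow> free_gen k (x, y) \<in> carrier F"
  by (auto intro: free_gen_closed[OF V.is_cring])

private lemma relators_subset: "tensor_relators k V W \<subseteq> carrier F"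
proof -
  interpret F: module k F by (rule F)
  show ?thesis unfolding tensor_relators_def Let_def by (auto intro!: gen)
qed

private lemma quotient: "quotient k F (tensor_null k V W)"
  unfolding quotient_def tensor_null_def
  using F lin_span_submodule[OF F relators_subset] by simp

interpretation Q: quotient k F "tensor_null k V W"
  by (rule quotient)

lemma tensor_module: "module k (tensor k V W)"
  unfolding tensor_def by (rule Q.quot_module)

lemma tens_closed: "\<lbrakk>x \<in> carrier V; y \<in> carrier W\<rbrakk> \<Longrightarrow> tens k V W x y \<in> carrier (tensor k V W)"
  unfolding tensor_def tens_def using gen by (auto simp: Q.quot_carrier)

private lemma null_relator: "r \<in> tensor_relators k V W \<Longrightarrow> r \<in> tensor_null k V W"
  unfolding tensor_null_def by (rule subsetD[OF lin_span_superset])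

lemma tens_bilinear: "bilinear_map k V W (tensor k V W) (tens k V W)"
proof (rule bilinear_mapI)
  fix x y assume "x \<in> carrier V" "y \<in> carrier W"
  then show "tens k V W x y \<in> carrier (tensor k V W)" by (rule tens_closed)
next
  fix x x' y assume *: "x \<in> carrier V" "x' \<in> carrier V" "y \<in> carrier W"
  show "tens k V W (x \<oplus>\<^bsub>V\<^esub> x') y = tens k V W x y \<oplus>\<^bsub>tensor k V W\<^esub> tens k V W x' y"
    unfolding tens_def tensor_def
    using * by (simp add: Q.quot_add gen Q.coset_eq_iff, intro null_relator)
      (auto simp: tensor_relators_def Let_def)
next
  fix x y y' assume *: "x \<in> carrier V" "y \<in> carrier W" "y' \<in> carrier W"
  show "tens k V W x (y \<oplus>\<^bsub>W\<^esub> y') = tens k V W x y \<oplus>\<^bsub>tensor k V W\<^esub> tens k V W x y'"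
    unfolding tens_def tensor_def
    using * by (simp add: Q.quot_add gen Q.coset_eq_iff, intro null_relator)
      (auto simp: tensor_relators_def Let_def)
next
  fix a x y assume *: "a \<in> carrier k" "x \<in> carrier V" "y \<in> carrier W"
  show "tens k V W (a \<odot>\<^bsub>V\<^esub> x) y = a \<odot>\<^bsub>tensor k V W\<^esub> tens k V W x y"
    unfolding tens_def tensor_def
    using * by (simp add: Q.quot_smult gen Q.coset_eq_iff, intro null_relator)
      (auto simp: tensor_relators_def Let_def)
  show "tens k V W x (a \<odot>\<^bsub>W\<^esub> y) = a \<odot>\<^bsub>tensor k V W\<^esub> tens k V W x y"
    unfolding tens_def tensor_def
    using * by (simp add: Q.quot_smult gen Q.coset_eq_iff, intro null_relator)
      (auto simp: tensor_relators_def Let_def)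
qed

lemmas tens_simps = bilinear_mapD(2-5)[OF tens_bilinear]

lemma tens_zero_left: "y \<in> carrier W \<Longrightarrow> tens k V W \<zero>\<^bsub>V\<^esub> y = \<zero>\<^bsub>tensor k V W\<^esub>"
  using linmap_zero[OF V tensor_module, of "\<lambda>x. tens k V W x y"] tens_bilinear
  by (auto simp: bilinear_map_def)

lemma tens_zero_right: "x \<in> carrier V \<Longrightarrow> tens k V W x \<zero>\<^bsub>W\<^esub> = \<zero>\<^bsub>tensor k V W\<^esub>"
  using linmap_zero[OF W tensor_module, of "tens k V W x"] tens_bilinear
  by (auto simp: bilinear_map_def)

lemma tens_linmap_right: "x \<in> carrier V \<Longrightarrow> tens k V W x \<in> linmap k W (tensor k V W)"
  using tens_bilinear by (simp add: bilinear_map_def)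

text \<open>No scalar case and no zero case are required: a scalar is absorbed into the left factor
  of a pure tensor, and zero is the pure tensor of two zeros.\<close>

lemma tensor_induct [consumes 1, case_names tens add]:
  assumes t: "t \<in> carrier (tensor k V W)"
    and tens: "\<And>x y. \<lbrakk>x \<in> carrier V; y \<in> carrier W\<rbrakk> \<Longrightarrow> Q (tens k V W x y)"
    and add: "\<And>s t. \<lbrakk>s \<in> carrier (tensor k V W); t \<in> carrier (tensor k V W); Q s; Q t\<rbrakk> \<Longrightarrow>
      Q (s \<oplus>\<^bsub>tensor k V W\<^esub> t)"
  shows "Q t"
proof -
  let ?c = "\<lambda>f. tensor_null k V W +>\<^bsub>F\<^esub> f"
  obtain f where f: "f \<in> carrier F" "t = ?c f"
    using t by (auto simp: tensor_def Q.quot_carrier)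
  have "Q (?c f)" using f(1)
  proof (induction f rule: free_induct[OF V.is_cring, consumes 1, case_names zero add])
    case zero
    have "Q \<zero>\<^bsub>tensor k V W\<^esub>"
      using tens[of "\<zero>\<^bsub>V\<^esub>" "\<zero>\<^bsub>W\<^esub>"] tens_zero_left by simp
    then show ?case by (simp only: tensor_def Q.quot_zero)
  next
    case (add a z g)
    obtain x y where z: "z = (x, y)" "x \<in> carrier V" "y \<in> carrier W" using add.hyps by auto
    have c: "?c (a \<odot>\<^bsub>F\<^esub> free_gen k z) = tens k V W (a \<odot>\<^bsub>V\<^esub> x) y"
      using z add.hyps by (simp add: tens_simps, simp add: tens_def tensor_def gen Q.quot_smult)
    have "?c (a \<odot>\<^bsub>F\<^esub> free_gen k z \<oplus>\<^bsub>F\<^esub> g) = tens k V W (a \<odot>\<^bsub>V\<^esub> x) y \<oplus>\<^bsub>tensor k V W\<^esub> ?c g"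
      unfolding c[symmetric] tensor_def using add.hyps z by (simp add: Q.quot_add gen Q.V.smult_closed)
    moreover have "?c g \<in> carrier (tensor k V W)"
      using add.hyps by (auto simp: tensor_def Q.quot_carrier)
    ultimately show ?case
      using assms(3)[OF tens_closed[of "a \<odot>\<^bsub>V\<^esub> x" y], of "?c g"] tens[of "a \<odot>\<^bsub>V\<^esub> x" y] add z by simp
  qed
  then show ?thesis using f by simp
qed

text \<open>The main tool for tensor identities: together with the values of lifts on pure tensors
  it replaces any handling of cosets.\<close>

lemma linmap_tensor_eqI:
  assumes "f \<in> linmap k (tensor k V W) Z" "g \<in> linmap k (tensor k V W) Z"
    and "\<And>x y. \<lbrakk>x \<in> carrier V; y \<in> carrier W\<rbrakk> \<Longrightarrow> f (tens k V W x y) = g (tens k V W x y)"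
    and "t \<in> carrier (tensor k V W)"
  shows "f t = g t"
  using assms(4)
  by (induction t rule: tensor_induct) (simp_all add: assms(3) linmap_add[OF assms(1)] linmap_add[OF assms(2)])

text \<open>Bilinearity of \<phi> says exactly that its linear extension to the free space kills the
  relators, so it descends to the quotient. A linear map is determined only on the carrier;
  extensionality fixes its values elsewhere and makes the definite description in
  \<open>tensor_lift\<close> meaningful.\<close>

lemma tensor_lift_ex1:
  assumes Z: "module k Z" and \<phi>: "bilinear_map k V W Z \<phi>"
  shows "\<exists>!h. h \<in> linmap k (tensor k V W) Z \<inter> extensional (carrier (tensor k V W)) \<and>
      (\<forall>x\<in>carrier V. \<forall>y\<in>carrier W. h (tens k V W x y) = \<phi> x y)"
proof -
  interpret Z: module k Z by (rule Z)
  have c: "case_prod \<phi> z \<in> carrier Z" if "z \<in> carrier V \<times> carrier W" for z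
    using that by (auto intro: bilinear_mapD(1)[OF \<phi>])
  obtain e where e: "e \<in> linmap k F Z" "\<And>z. z \<in> carrier V \<times> carrier W \<Longrightarrow> e (free_gen k z) = case_prod \<phi> z"
    by (rule free_extend[OF Z, of "carrier V \<times> carrier W" "case_prod \<phi>"]; (erule c | erule that)) simp
  have e': "e (free_gen k (x, y)) = \<phi> x y" if "x \<in> carrier V" "y \<in> carrier W" for x y
    using e(2) that by auto
  have "tensor_relators k V W \<subseteq> {f \<in> carrier F. e f = \<zero>\<^bsub>Z\<^esub>}"
    unfolding tensor_relators_def Let_def
    by (intro Un_least subsetI; clarify)
      (simp_all add: bilinear_mapD[OF \<phi>] gen e' linmap_minus[OF F Z e(1)] linmap_add[OF e(1)]
        linmap_smult[OF e(1)] Z.minus_eq_zero_iff Q.V.M.a_closed Q.V.smult_closed Q.V.M.minus_closed)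
  then have "tensor_null k V W \<subseteq> {f \<in> carrier F. e f = \<zero>\<^bsub>Z\<^esub>}"
    unfolding tensor_null_def by (rule lin_span_minimal[OF submodule_kernel[OF F Z e(1)]])
  then have null: "e u = \<zero>\<^bsub>Z\<^esub>" if "u \<in> tensor_null k V W" for u
    using that by auto
  have "\<exists>g\<in>linmap k (tensor k V W) Z. \<forall>f\<in>carrier F. g (tensor_null k V W +>\<^bsub>F\<^esub> f) = e f"
    unfolding tensor_def by (rule Q.quot_lift[OF Z e(1) null])
  then obtain g where g: "g \<in> linmap k (tensor k V W) Z"
      "\<And>f. f \<in> carrier F \<Longrightarrow> g (tensor_null k V W +>\<^bsub>F\<^esub> f) = e f"
    by (elim bexE) simp
  interpret T: module k "tensor k V W" by (rule tensor_module)
  have g': "restrict g (carrier (tensor k V W)) \<in> linmap k (tensor k V W) Z"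
    using g(1) by (auto intro!: linmapI simp: linmap_closed linmap_add linmap_smult)
  show ?thesis
  proof (rule ex1I[of _ "restrict g (carrier (tensor k V W))"])
    show "restrict g (carrier (tensor k V W)) \<in> linmap k (tensor k V W) Z \<inter> extensional (carrier (tensor k V W)) \<and>
      (\<forall>x\<in>carrier V. \<forall>y\<in>carrier W. restrict g (carrier (tensor k V W)) (tens k V W x y) = \<phi> x y)"
      using g' tens_closed g(2) gen e' by (auto simp: tens_def)
  next
    fix h assume h: "h \<in> linmap k (tensor k V W) Z \<inter> extensional (carrier (tensor k V W)) \<and>
      (\<forall>x\<in>carrier V. \<forall>y\<in>carrier W. h (tens k V W x y) = \<phi> x y)"
    have "h t = g t" if "t \<in> carrier (tensor k V W)" for t
      by (rule linmap_tensor_eqI[OF _ g(1) _ that]) (use h g(2) gen e' in \<open>auto simp: tens_def\<close>)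
    then show "h = restrict g (carrier (tensor k V W))"
      using h by (intro extensionalityI[of _ "carrier (tensor k V W)"]) auto
  qed
qed

lemma tensor_lift_linmap:
  assumes "module k Z" "bilinear_map k V W Z \<phi>"
  shows "tensor_lift k V W Z \<phi> \<in> linmap k (tensor k V W) Z"
  using theI'[OF tensor_lift_ex1[OF assms]] unfolding tensor_lift_def by blast

lemma tensor_lift_tens:
  assumes "module k Z" "bilinear_map k V W Z \<phi>" "x \<in> carrier V" "y \<in> carrier W"
  shows "tensor_lift k V W Z \<phi> (tens k V W x y) = \<phi> x y"
  using theI'[OF tensor_lift_ex1[OF assms(1,2)]] assms(3,4) unfolding tensor_lift_def by blast

end

section \<open>Tensor products of linear maps\<close>

lemma bilinear_map_comp:
  assumes "bilinear_map k V' W' Z \<phi>" "f \<in> linmap k V V'" "g \<in> linmap k W W'"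
  shows "bilinear_map k V W Z (\<lambda>x y. \<phi> (f x) (g y))"
  by (rule bilinear_mapI)
    (use bilinear_mapD[OF assms(1)] in
      \<open>simp_all add: linmap_closed[OF assms(2)] linmap_closed[OF assms(3)] linmap_add[OF assms(2)]
        linmap_add[OF assms(3)] linmap_smult[OF assms(2)] linmap_smult[OF assms(3)]\<close>)

context
  fixes k :: "'k ring" and V :: "('k, 'v) module" and W :: "('k, 'w) module"
    and V' :: "('k, 'v2) module" and W' :: "('k, 'w2) module" and f g
  assumes V: "module k V" and W: "module k W" and V': "module k V'" and W': "module k W'"
    and f: "f \<in> linmap k V V'" and g: "g \<in> linmap k W W'"
begin

lemma tensor_map_linmap: "tensor_map k V W V' W' f g \<in> linmap k (tensor k V W) (tensor k V' W')"
  unfolding tensor_map_def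
  by (rule tensor_lift_linmap[OF V W tensor_module[OF V' W']
        bilinear_map_comp[OF tens_bilinear[OF V' W'] f g]])

lemma tensor_map_tens:
  "\<lbrakk>x \<in> carrier V; y \<in> carrier W\<rbrakk> \<Longrightarrow>
    tensor_map k V W V' W' f g (tens k V W x y) = tens k V' W' (f x) (g y)"
  unfolding tensor_map_def
  by (rule tensor_lift_tens[OF V W tensor_module[OF V' W']
        bilinear_map_comp[OF tens_bilinear[OF V' W'] f g]])

end

lemmas tensor_map_closed = linmap_closed[OF tensor_map_linmap]

lemma tensor_map_comp:
  assumes "module k V" "module k W" "module k V'" "module k W'" "module k V''" "module k W''"
    and f: "f \<in> linmap k V V'" and g: "g \<in> linmap k W W'"
    and f': "f' \<in> linmap k V' V''" and g': "g' \<in> linmap k W' W''"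
    and t: "t \<in> carrier (tensor k V W)"
  shows "tensor_map k V' W' V'' W'' f' g' (tensor_map k V W V' W' f g t) =
    tensor_map k V W V'' W'' (\<lambda>x. f' (f x)) (\<lambda>y. g' (g y)) t"
proof (rule linmap_tensor_eqI[OF assms(1,2) _ _ _ t])
  show "(\<lambda>t. tensor_map k V' W' V'' W'' f' g' (tensor_map k V W V' W' f g t))
      \<in> linmap k (tensor k V W) (tensor k V'' W'')"
    by (rule linmap_comp[OF tensor_map_linmap tensor_map_linmap]) fact+
  show "tensor_map k V W V'' W'' (\<lambda>x. f' (f x)) (\<lambda>y. g' (g y))
      \<in> linmap k (tensor k V W) (tensor k V'' W'')"
    by (rule tensor_map_linmap) (use assms in \<open>auto intro: linmap_comp\<close>)
next
  fix x y assume "x \<in> carrier V" "y \<in> carrier W"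
  then show "tensor_map k V' W' V'' W'' f' g' (tensor_map k V W V' W' f g (tens k V W x y)) =
      tensor_map k V W V'' W'' (\<lambda>x. f' (f x)) (\<lambda>y. g' (g y)) (tens k V W x y)"
    using assms by (simp add: tensor_map_tens linmap_closed linmap_comp[of f k V V' f' V''] linmap_comp[of g k W W' g' W''])
qed

lemma tensor_map_cong:
  assumes "module k V" "module k W" "module k V'" "module k W'"
    and f: "f \<in> linmap k V V'" and g: "g \<in> linmap k W W'"
    and f': "f' \<in> linmap k V V'" and g': "g' \<in> linmap k W W'"
    and "\<And>x. x \<in> carrier V \<Longrightarrow> f x = f' x" "\<And>y. y \<in> carrier W \<Longrightarrow> g y = g' y"
    and t: "t \<in> carrier (tensor k V W)"
  shows "tensor_map k V W V' W' f g t = tensor_map k V W V' W' f' g' t"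
  by (rule linmap_tensor_eqI[OF assms(1,2) tensor_map_linmap tensor_map_linmap _ t])
    (use assms in \<open>simp_all add: tensor_map_tens\<close>)

lemma tensor_map_zero_right:
  assumes "module k V" "module k W" "module k V'" "module k W'"
    and f: "f \<in> linmap k V V'" and t: "t \<in> carrier (tensor k V W)"
  shows "tensor_map k V W V' W' f (\<lambda>y. \<zero>\<^bsub>W'\<^esub>) t = \<zero>\<^bsub>tensor k V' W'\<^esub>"
  by (rule linmap_tensor_eqI[OF assms(1,2) tensor_map_linmap linmap_const_zero _ t])
    (use assms in \<open>simp_all add: tensor_map_tens tens_zero_right linmap_const_zero tensor_module linmap_closed\<close>)

section \<open>Splittings over a field\<close>

lemma field_cring: "field k \<Longrightarrow> cring k"
  by (simp add: field_def domain_def)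

text \<open>Zorn's lemma gives a \<open>W\<close> maximal among the subspaces meeting
  \<open>U\<close> only in zero. If some v were outside U + W, adjoining v to \<open>W\<close> would
  contradict maximality.\<close>

lemma submodule_complement:
  assumes k: "field k" and V: "module k V" and U: "submodule U k V"
  obtains W where "submodule W k V" "U \<inter> W = {\<zero>\<^bsub>V\<^esub>}"
    "\<And>v. v \<in> carrier V \<Longrightarrow> \<exists>u\<in>U. v \<ominus>\<^bsub>V\<^esub> u \<in> W"
proof -
  interpret k: field k by (rule k)
  interpret V: module k V by (rule V)
  define \<W> where "\<W> = {W. submodule W k V \<and> U \<inter> W = {\<zero>\<^bsub>V\<^esub>}}"
  have zero: "{\<zero>\<^bsub>V\<^esub>} \<in> \<W>"
    unfolding \<W>_def using submodule_zero[OF U] by (auto intro!: submoduleI'[OF V])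
  have "\<exists>M\<in>\<W>. \<forall>X\<in>\<W>. M \<subseteq> X \<longrightarrow> X = M"
  proof (rule subset_Zorn_nonempty)
    show "\<W> \<noteq> {}" using zero by blast
  next
    fix \<C> assume ne: "\<C> \<noteq> {}" and chain: "subset.chain \<W> \<C>"
    have sub: "submodule W k V" "U \<inter> W = {\<zero>\<^bsub>V\<^esub>}" if "W \<in> \<C>" for W
      using chain that by (auto simp: subset.chain_def \<W>_def)
    have lin: "W \<subseteq> W' \<or> W' \<subseteq> W" if "W \<in> \<C>" "W' \<in> \<C>" for W W'
      using chain that by (auto simp: subset.chain_def)
    have "submodule (\<Union>\<C>) k V"
    proof (rule submoduleI'[OF V])
      show "\<Union>\<C> \<subseteq> carrier V" using submodule_subset[OF sub(1)] by blast
      show "\<zero>\<^bsub>V\<^esub> \<in> \<Union>\<C>" using submodule_zero[OF sub(1)] ne by blast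
    next
      fix x y assume "x \<in> \<Union>\<C>" "y \<in> \<Union>\<C>"
      then obtain W where "W \<in> \<C>" "x \<in> W" "y \<in> W" using lin by blast
      then show "x \<oplus>\<^bsub>V\<^esub> y \<in> \<Union>\<C>" using submodule_add[OF sub(1)] by blast
    next
      fix a x assume "a \<in> carrier k" "x \<in> \<Union>\<C>"
      then show "a \<odot>\<^bsub>V\<^esub> x \<in> \<Union>\<C>" using submodule_smult[OF sub(1)] by blast
    qed
    moreover have "U \<inter> \<Union>\<C> = {\<zero>\<^bsub>V\<^esub>}" using sub(2) ne by blast
    ultimately show "\<Union>\<C> \<in> \<W>" by (simp add: \<W>_def)
  qed
  then obtain W where W: "submodule W k V" "U \<inter> W = {\<zero>\<^bsub>V\<^esub>}"
    and max: "\<And>X. \<lbrakk>submodule X k V; U \<inter> X = {\<zero>\<^bsub>V\<^esub>}; W \<subseteq> X\<rbrakk> \<Longrightarrow> X = W"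
    by (auto simp: \<W>_def)
  have Uc: "\<And>x. x \<in> U \<Longrightarrow> x \<in> carrier V" and Wc: "\<And>x. x \<in> W \<Longrightarrow> x \<in> carrier V"
    using submodule_subset[OF U] submodule_subset[OF W(1)] by auto
  have "\<exists>u\<in>U. v \<ominus>\<^bsub>V\<^esub> u \<in> W" if v: "v \<in> carrier V" for v
  proof (rule ccontr)
    assume no: "\<not> (\<exists>u\<in>U. v \<ominus>\<^bsub>V\<^esub> u \<in> W)"
    \<comment> \<open>\<open>X\<close> is W + k v, the candidate for a larger subspace.\<close>
    define X where "X = {w \<oplus>\<^bsub>V\<^esub> a \<odot>\<^bsub>V\<^esub> v | w a. w \<in> W \<and> a \<in> carrier k}"
    have "submodule X k V"
    proof (rule submoduleI'[OF V])
      show "X \<subseteq> carrier V" using Wc v by (auto simp: X_def)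
      have "\<zero>\<^bsub>V\<^esub> = \<zero>\<^bsub>V\<^esub> \<oplus>\<^bsub>V\<^esub> \<zero>\<^bsub>k\<^esub> \<odot>\<^bsub>V\<^esub> v" using v by simp
      then show "\<zero>\<^bsub>V\<^esub> \<in> X" unfolding X_def using submodule_zero[OF W(1)] k.zero_closed by blast
    next
      fix x y assume "x \<in> X" "y \<in> X"
      then obtain w a w' a' where *: "x = w \<oplus>\<^bsub>V\<^esub> a \<odot>\<^bsub>V\<^esub> v" "y = w' \<oplus>\<^bsub>V\<^esub> a' \<odot>\<^bsub>V\<^esub> v"
        "w \<in> W" "w' \<in> W" "a \<in> carrier k" "a' \<in> carrier k" unfolding X_def by blast
      then have "x \<oplus>\<^bsub>V\<^esub> y = (w \<oplus>\<^bsub>V\<^esub> w') \<oplus>\<^bsub>V\<^esub> (a \<oplus>\<^bsub>k\<^esub> a') \<odot>\<^bsub>V\<^esub> v"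
        using v Wc by (simp add: V.smult_l_distr V.M.a_ac)
      then show "x \<oplus>\<^bsub>V\<^esub> y \<in> X"
        unfolding X_def using * submodule_add[OF W(1)] k.a_closed by blast
    next
      fix b x assume b: "b \<in> carrier k" and "x \<in> X"
      then obtain w a where *: "x = w \<oplus>\<^bsub>V\<^esub> a \<odot>\<^bsub>V\<^esub> v" "w \<in> W" "a \<in> carrier k"
        unfolding X_def by blast
      then have "b \<odot>\<^bsub>V\<^esub> x = (b \<odot>\<^bsub>V\<^esub> w) \<oplus>\<^bsub>V\<^esub> (b \<otimes>\<^bsub>k\<^esub> a) \<odot>\<^bsub>V\<^esub> v"
        using v Wc b by (simp add: V.smult_r_distr V.smult_assoc1)
      then show "b \<odot>\<^bsub>V\<^esub> x \<in> X"
        unfolding X_def using * b submodule_smult[OF W(1)] k.m_closed by blast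
    qed
    moreover have "W \<subseteq> X"
    proof
      fix w assume w: "w \<in> W"
      then have "w = w \<oplus>\<^bsub>V\<^esub> \<zero>\<^bsub>k\<^esub> \<odot>\<^bsub>V\<^esub> v" using v Wc by simp
      then show "w \<in> X" unfolding X_def using w k.zero_closed by blast
    qed
    moreover have "U \<inter> X = {\<zero>\<^bsub>V\<^esub>}"
    proof
      show "U \<inter> X \<subseteq> {\<zero>\<^bsub>V\<^esub>}"
      proof
        fix u assume "u \<in> U \<inter> X"
        then obtain w a where *: "u \<in> U" "u = w \<oplus>\<^bsub>V\<^esub> a \<odot>\<^bsub>V\<^esub> v" "w \<in> W" "a \<in> carrier k"
          unfolding X_def by blast
        \<comment> \<open>If a were invertible, dividing u = w + a v by it would write v as an
          element of \<open>U\<close> plus an element of \<open>W\<close>, against the choice of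
          v.\<close>
        have "a = \<zero>\<^bsub>k\<^esub>"
        proof (rule ccontr)
          assume "a \<noteq> \<zero>\<^bsub>k\<^esub>"
          then have a: "inv\<^bsub>k\<^esub> a \<in> carrier k" "inv\<^bsub>k\<^esub> a \<otimes>\<^bsub>k\<^esub> a = \<one>\<^bsub>k\<^esub>"
            using * k.field_Units by auto
          have "inv\<^bsub>k\<^esub> a \<odot>\<^bsub>V\<^esub> u = inv\<^bsub>k\<^esub> a \<odot>\<^bsub>V\<^esub> w \<oplus>\<^bsub>V\<^esub> v"
            using * a v Wc by (simp add: V.smult_r_distr V.smult_assoc1[symmetric])
          then have "v \<ominus>\<^bsub>V\<^esub> inv\<^bsub>k\<^esub> a \<odot>\<^bsub>V\<^esub> u = (\<ominus>\<^bsub>k\<^esub> (inv\<^bsub>k\<^esub> a)) \<odot>\<^bsub>V\<^esub> w"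
            using * a v Wc by (simp add: a_minus_def V.M.minus_add V.smult_l_minus V.M.a_lcomm[of v] V.M.r_neg)
          then show False
            using no * a submodule_smult[OF U] submodule_smult[OF W(1)] by (metis k.a_inv_closed)
        qed
        then show "u \<in> {\<zero>\<^bsub>V\<^esub>}" using * W(2) v Wc by auto
      qed
      show "{\<zero>\<^bsub>V\<^esub>} \<subseteq> U \<inter> X" using \<open>submodule X k V\<close> U submodule_zero by blast
    qed
    ultimately have "X = W" by (intro max)
    moreover have "\<zero>\<^bsub>V\<^esub> \<oplus>\<^bsub>V\<^esub> \<one>\<^bsub>k\<^esub> \<odot>\<^bsub>V\<^esub> v \<in> X"
      unfolding X_def using submodule_zero[OF W(1)] k.one_closed by blast
    ultimately have "v \<ominus>\<^bsub>V\<^esub> \<zero>\<^bsub>V\<^esub> \<in> W" using v by (simp add: a_minus_def V.M.a_inv_zero)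
    then show False using no submodule_zero[OF U] by blast
  qed
  then show ?thesis by (rule that[OF W])
qed

text \<open>The projection onto \<open>U\<close> along a complement \<open>W\<close>.\<close>

lemma submodule_retraction:
  assumes k: "field k" and V: "module k V" and U: "submodule U k V"
  shows "\<exists>r\<in>linmap k V V. (\<forall>v\<in>carrier V. r v \<in> U) \<and> (\<forall>u\<in>U. r u = u)"
proof -
  interpret V: module k V by (rule V)
  obtain W where W: "submodule W k V" "U \<inter> W = {\<zero>\<^bsub>V\<^esub>}"
    and ex: "\<And>v. v \<in> carrier V \<Longrightarrow> \<exists>u\<in>U. v \<ominus>\<^bsub>V\<^esub> u \<in> W"
    using submodule_complement[OF assms] by blast
  have Uc: "\<And>x. x \<in> U \<Longrightarrow> x \<in> carrier V" and Wc: "\<And>x. x \<in> W \<Longrightarrow> x \<in> carrier V"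
    using submodule_subset[OF U] submodule_subset[OF W(1)] by auto
  define r where "r v = (SOME u. u \<in> U \<and> v \<ominus>\<^bsub>V\<^esub> u \<in> W)" for v
  have r: "r v \<in> U \<and> v \<ominus>\<^bsub>V\<^esub> r v \<in> W" if "v \<in> carrier V" for v
    unfolding r_def by (rule someI_ex) (use ex[OF that] in blast)
  \<comment> \<open>Two candidates for the \<open>U\<close>-component differ by an element of both
    \<open>U\<close> and \<open>W\<close>, hence by zero. Linearity of \<open>r\<close> then only
    needs the obvious candidates to be tested.\<close>
  have r_eq: "r v = u" if v: "v \<in> carrier V" and u: "u \<in> U" "v \<ominus>\<^bsub>V\<^esub> u \<in> W" for v u
  proof -
    have "(v \<ominus>\<^bsub>V\<^esub> u) \<ominus>\<^bsub>V\<^esub> (v \<ominus>\<^bsub>V\<^esub> r v) \<in> W"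
      using r[OF v] u by (blast intro: submodule_minus[OF V W(1)])
    moreover have "(v \<ominus>\<^bsub>V\<^esub> u) \<ominus>\<^bsub>V\<^esub> (v \<ominus>\<^bsub>V\<^esub> r v) = r v \<ominus>\<^bsub>V\<^esub> u"
      using v Uc[OF u(1)] Uc[of "r v"] r[OF v] by (simp add: V.M.minus_minus_cancel)
    moreover have "r v \<ominus>\<^bsub>V\<^esub> u \<in> U" using r[OF v] u submodule_minus[OF V U] by blast
    ultimately have "r v \<ominus>\<^bsub>V\<^esub> u = \<zero>\<^bsub>V\<^esub>" using W(2) by auto
    then show ?thesis using V.M.minus_eq_zero_iff Uc u r[OF v] by blast
  qed
  show ?thesis
  proof (intro bexI[of _ r] conjI ballI)
    show "r v \<in> U" if "v \<in> carrier V" for v using r that by blast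
    show "r u = u" if "u \<in> U" for u
      using that Uc submodule_zero[OF W(1)] by (intro r_eq) (auto simp: a_minus_def V.M.r_neg)
    show "r \<in> linmap k V V"
    proof (rule linmapI)
      show "r v \<in> carrier V" if "v \<in> carrier V" for v using r that Uc by blast
    next
      fix x y assume *: "x \<in> carrier V" "y \<in> carrier V"
      note rx = r[OF *(1)] and ry = r[OF *(2)]
      have "(x \<oplus>\<^bsub>V\<^esub> y) \<ominus>\<^bsub>V\<^esub> (r x \<oplus>\<^bsub>V\<^esub> r y) = (x \<ominus>\<^bsub>V\<^esub> r x) \<oplus>\<^bsub>V\<^esub> (y \<ominus>\<^bsub>V\<^esub> r y)"
        using * rx ry Uc[of "r x"] Uc[of "r y"] by (simp add: a_minus_def V.M.minus_add V.M.a_ac)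
      also have "\<dots> \<in> W" using rx ry submodule_add[OF W(1)] by blast
      finally show "r (x \<oplus>\<^bsub>V\<^esub> y) = r x \<oplus>\<^bsub>V\<^esub> r y"
        using * rx ry submodule_add[OF U] by (intro r_eq) auto
    next
      fix a x assume *: "a \<in> carrier k" "x \<in> carrier V"
      note rx = r[OF *(2)]
      have "a \<odot>\<^bsub>V\<^esub> x \<ominus>\<^bsub>V\<^esub> a \<odot>\<^bsub>V\<^esub> r x = a \<odot>\<^bsub>V\<^esub> (x \<ominus>\<^bsub>V\<^esub> r x)"
        using * rx Uc[of "r x"] by (simp add: a_minus_def V.smult_r_distr V.smult_r_minus)
      also have "\<dots> \<in> W" using rx * submodule_smult[OF W(1)] by blast
      finally show "r (a \<odot>\<^bsub>V\<^esub> x) = a \<odot>\<^bsub>V\<^esub> r x"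
        using * rx submodule_smult[OF U] by (intro r_eq) auto
    qed
  qed
qed

text \<open>Retract W onto the image of d, choose preimages there, and remove the kernel component
  of the preimage. The choice itself need not be linear; removing the kernel component makes the
  result independent of it.\<close>

lemma linmap_generalized_inverse:
  assumes k: "field k" and V: "module k V" and W: "module k W" and d: "d \<in> linmap k V W"
  shows "\<exists>s\<in>linmap k W V. \<forall>v\<in>carrier V. d (s (d v)) = d v"
proof -
  interpret V: module k V by (rule V)
  interpret W: module k W by (rule W)
  let ?K = "{x \<in> carrier V. d x = \<zero>\<^bsub>W\<^esub>}"
  obtain p where p: "p \<in> linmap k V V" "\<And>v. v \<in> carrier V \<Longrightarrow> p v \<in> ?K" "\<And>u. u \<in> ?K \<Longrightarrow> p u = u"
    using submodule_retraction[OF k V submodule_kernel[OF V W d]]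
    by (elim bexE conjE) (rule that; (assumption | (erule bspec, assumption)))
  obtain r where r: "r \<in> linmap k W W" "\<And>w. w \<in> carrier W \<Longrightarrow> r w \<in> d ` carrier V"
      "\<And>u. u \<in> d ` carrier V \<Longrightarrow> r u = u"
    using submodule_retraction[OF k W submodule_image[OF V W d]]
    by (elim bexE conjE) (rule that; (assumption | (erule bspec, assumption)))
  \<comment> \<open>\<open>q\<close> annihilates ker d, so q v depends only on d v, and d q =
    d.\<close>
  define q where "q v = v \<ominus>\<^bsub>V\<^esub> p v" for v
  have q: "q \<in> linmap k V V"
    unfolding q_def by (rule linmap_diff[OF V V linmap_id p(1)])
  have q0: "q v = \<zero>\<^bsub>V\<^esub>" if "v \<in> ?K" for v
    using p(3)[OF that] that V.M.minus_eq_zero_iff[of v v] by (simp add: q_def)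
  have q_cong: "q v = q v'" if "v \<in> carrier V" "v' \<in> carrier V" "d v = d v'" for v v'
  proof -
    have "v \<ominus>\<^bsub>V\<^esub> v' \<in> ?K"
      using that W.M.minus_eq_zero_iff[of "d v'" "d v'"] linmap_closed[OF d] by (simp add: linmap_minus[OF V W d])
    then have "q v \<ominus>\<^bsub>V\<^esub> q v' = \<zero>\<^bsub>V\<^esub>" using q0 linmap_minus[OF V V q] that by metis
    then show ?thesis using V.M.minus_eq_zero_iff linmap_closed[OF q] that by blast
  qed
  have dq: "d (q v) = d v" if "v \<in> carrier V" for v
    using p(2)[OF that] that linmap_closed[OF p(1)] linmap_closed[OF d]
    by (simp add: q_def linmap_minus[OF V W d]) (simp add: a_minus_def W.M.a_inv_zero)
  \<comment> \<open>\<open>t\<close> is an arbitrary section over the image, not linear in general;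
    \<open>q \<circ> t\<close> is linear because sums and multiples of chosen preimages have the
    right image under d.\<close>
  define t where "t w = (SOME v. v \<in> carrier V \<and> d v = r w)" for w
  have t: "t w \<in> carrier V \<and> d (t w) = r w" if "w \<in> carrier W" for w
    unfolding t_def by (rule someI_ex) (use r(2)[OF that] in auto)
  show ?thesis
  proof (intro bexI[of _ "\<lambda>w. q (t w)"] ballI)
    show "d (q (t (d v))) = d v" if "v \<in> carrier V" for v
      using that dq t[of "d v"] linmap_closed[OF d that] r(3)[of "d v"] by simp
    show "(\<lambda>w. q (t w)) \<in> linmap k W V"
    proof (rule linmapI)
      show "q (t w) \<in> carrier V" if "w \<in> carrier W" for w
        using that t linmap_closed[OF q] by blast
    next
      fix x y assume *: "x \<in> carrier W" "y \<in> carrier W"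
      have "q (t (x \<oplus>\<^bsub>W\<^esub> y)) = q (t x \<oplus>\<^bsub>V\<^esub> t y)"
        using * t[of x] t[of y] t[of "x \<oplus>\<^bsub>W\<^esub> y"] by (intro q_cong) (auto simp: linmap_add[OF d] linmap_add[OF r(1)])
      then show "q (t (x \<oplus>\<^bsub>W\<^esub> y)) = q (t x) \<oplus>\<^bsub>V\<^esub> q (t y)"
        using * t by (simp add: linmap_add[OF q])
    next
      fix a x assume *: "a \<in> carrier k" "x \<in> carrier W"
      have "q (t (a \<odot>\<^bsub>W\<^esub> x)) = q (a \<odot>\<^bsub>V\<^esub> t x)"
        using * t[of x] t[of "a \<odot>\<^bsub>W\<^esub> x"] by (intro q_cong) (auto simp: linmap_smult[OF d] linmap_smult[OF r(1)])
      then show "q (t (a \<odot>\<^bsub>W\<^esub> x)) = a \<odot>\<^bsub>V\<^esub> q (t x)"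
        using * t by (simp add: linmap_smult[OF q])
    qed
  qed
qed

text \<open>Let w = u - r u with \<open>r\<close> a retraction onto \<open>U\<close>; w is nonzero
  since u is outside \<open>U\<close>. A generalised inverse s of a \<mapsto> a w satisfies (s w) w
  = w, which over a field forces s w = 1. Composing s with 1 - r makes it vanish on
  \<open>U\<close>.\<close>

lemma separating_functional:
  assumes k: "field k" and V: "module k V" and U: "submodule U k V" and u: "u \<in> carrier V" "u \<notin> U"
  shows "\<exists>f\<in>linmap k V (scalar_space k). f u = \<one>\<^bsub>k\<^esub> \<and> (\<forall>x\<in>U. f x = \<zero>\<^bsub>k\<^esub>)"
proof -
  interpret k: field k by (rule k)
  interpret V: module k V by (rule V)
  have K: "module k (scalar_space k)" by (rule scalar_space_module[OF k.is_cring])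
  obtain r where r: "r \<in> linmap k V V" "\<And>v. v \<in> carrier V \<Longrightarrow> r v \<in> U" "\<And>u. u \<in> U \<Longrightarrow> r u = u"
    using submodule_retraction[OF k V U]
    by (elim bexE conjE) (rule that; (assumption | (erule bspec, assumption)))
  define w where "w = u \<ominus>\<^bsub>V\<^esub> r u"
  have w: "w \<in> carrier V" using u linmap_closed[OF r(1)] by (simp add: w_def)
  have w0: "w \<noteq> \<zero>\<^bsub>V\<^esub>"
    using u r(2)[OF u(1)] V.M.minus_eq_zero_iff[OF u(1) linmap_closed[OF r(1) u(1)]] by (auto simp: w_def)
  have j: "(\<lambda>a. a \<odot>\<^bsub>V\<^esub> w) \<in> linmap k (scalar_space k) V"
    by (rule linmapI) (use w in \<open>auto simp: V.smult_l_distr V.smult_assoc1\<close>)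
  obtain s where s: "s \<in> linmap k V (scalar_space k)"
      "\<And>a. a \<in> carrier (scalar_space k) \<Longrightarrow> s (a \<odot>\<^bsub>V\<^esub> w) \<odot>\<^bsub>V\<^esub> w = a \<odot>\<^bsub>V\<^esub> w"
    using linmap_generalized_inverse[OF k K V j]
    by (elim bexE conjE) (rule that; (assumption | (erule bspec, assumption)))
  have sw: "s w \<in> carrier k" "s w \<odot>\<^bsub>V\<^esub> w = w"
    using s(2)[of "\<one>\<^bsub>k\<^esub>"] linmap_closed[OF s(1) w] w by auto
  have s1: "s w = \<one>\<^bsub>k\<^esub>"
  proof (rule ccontr)
    assume "s w \<noteq> \<one>\<^bsub>k\<^esub>"
    let ?a = "s w \<ominus>\<^bsub>k\<^esub> \<one>\<^bsub>k\<^esub>"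
    have a: "?a \<in> carrier k" "?a \<noteq> \<zero>\<^bsub>k\<^esub>"
      using sw \<open>s w \<noteq> \<one>\<^bsub>k\<^esub>\<close> by (auto simp: k.minus_eq_zero_iff)
    have "?a \<odot>\<^bsub>V\<^esub> w = \<zero>\<^bsub>V\<^esub>"
      using sw w by (simp add: a_minus_def V.smult_l_distr V.smult_l_minus V.M.r_neg)
    then have "inv\<^bsub>k\<^esub> ?a \<odot>\<^bsub>V\<^esub> (?a \<odot>\<^bsub>V\<^esub> w) = \<zero>\<^bsub>V\<^esub>" using a k.field_Units by simp
    then have "w = \<zero>\<^bsub>V\<^esub>" using a w k.field_Units by (simp add: V.smult_assoc1[symmetric])
    then show False using w0 by simp
  qed
  show ?thesis
  proof (intro bexI[of _ "\<lambda>x. s (x \<ominus>\<^bsub>V\<^esub> r x)"] conjI ballI)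
    show "(\<lambda>x. s (x \<ominus>\<^bsub>V\<^esub> r x)) \<in> linmap k V (scalar_space k)"
      by (rule linmap_comp[OF linmap_diff[OF V V linmap_id r(1)] s(1)])
    show "s (u \<ominus>\<^bsub>V\<^esub> r u) = \<one>\<^bsub>k\<^esub>" using s1 by (simp add: w_def)
    show "s (x \<ominus>\<^bsub>V\<^esub> r x) = \<zero>\<^bsub>k\<^esub>" if "x \<in> U" for x
      using that r(3)[OF that] submodule_subset[OF U] V.M.minus_eq_zero_iff[of x x] linmap_zero[OF V K s(1)] by auto
  qed
qed

text \<open>The explicit formula for \<pi> is part of the conclusion because, being an equation
  between linear maps, it can be tensored with another space.\<close>

lemma kernel_projection:
  assumes k: "field k" and V: "module k V" and W: "module k W" and d: "d \<in> linmap k V W"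
  shows "\<exists>s\<in>linmap k W V. \<exists>\<pi>\<in>linmap k V V.
    (\<forall>v\<in>carrier V. d (\<pi> v) = \<zero>\<^bsub>W\<^esub>) \<and> (\<forall>v\<in>carrier V. \<pi> v = v \<ominus>\<^bsub>V\<^esub> s (d v))"
proof -
  interpret V: module k V by (rule V)
  interpret W: module k W by (rule W)
  obtain s where s: "s \<in> linmap k W V" "\<And>v. v \<in> carrier V \<Longrightarrow> d (s (d v)) = d v"
    using linmap_generalized_inverse[OF assms]
    by (elim bexE conjE) (rule that; (assumption | (erule bspec, assumption)))
  show ?thesis
  proof (intro bexI[OF _ s(1)] bexI[of _ "\<lambda>v. v \<ominus>\<^bsub>V\<^esub> s (d v)"] conjI ballI)
    show "(\<lambda>v. v \<ominus>\<^bsub>V\<^esub> s (d v)) \<in> linmap k V V"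
      by (rule linmap_diff[OF V V linmap_id linmap_comp[OF d s(1)]])
    show "d (v \<ominus>\<^bsub>V\<^esub> s (d v)) = \<zero>\<^bsub>W\<^esub>" if "v \<in> carrier V" for v
      using that s linmap_closed[OF d] linmap_closed[OF s(1)]
      by (simp add: linmap_minus[OF V W d] W.M.minus_eq_zero_iff)
  qed simp
qed

section \<open>Contraction with functionals and integrals\<close>

text \<open>Linearity in t comes with the inner lift. Linearity in w does not, since w is a
  parameter of the lifted map; it is proved by induction on t.\<close>

lemma tensor_lift_assoc_bilinear:
  assumes U: "module k U" and V: "module k V" and W: "module k W"
  shows "bilinear_map k (tensor k U V) W (tensor k U (tensor k V W))
    (\<lambda>t w. tensor_lift k U V (tensor k U (tensor k V W)) (\<lambda>u v. tens k U (tensor k V W) u (tens k V W v w)) t)"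
    (is "bilinear_map k _ W ?Z (\<lambda>t w. ?L w t)")
    and "w \<in> carrier W \<Longrightarrow> u \<in> carrier U \<Longrightarrow> v \<in> carrier V \<Longrightarrow>
      tensor_lift k U V (tensor k U (tensor k V W)) (\<lambda>u v. tens k U (tensor k V W) u (tens k V W v w))
        (tens k U V u v) = tens k U (tensor k V W) u (tens k V W v w)"
proof -
  interpret U: module k U by (rule U)
  interpret V: module k V by (rule V)
  interpret W: module k W by (rule W)
  note VW = tensor_module[OF V W] and Z = tensor_module[OF U tensor_module[OF V W]]
  interpret Z: module k ?Z by (rule Z)
  have inner: "bilinear_map k U V ?Z (\<lambda>u v. tens k U (tensor k V W) u (tens k V W v w))"
    if "w \<in> carrier W" for w
    using bilinear_map_comp[OF tens_bilinear[OF U VW] linmap_id, of "\<lambda>v. tens k V W v w" V]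
      tens_bilinear[OF V W] that by (simp add: bilinear_map_def)
  note L = tensor_lift_linmap[OF U V Z inner] and Lt = tensor_lift_tens[OF U V Z inner]
  show "w \<in> carrier W \<Longrightarrow> u \<in> carrier U \<Longrightarrow> v \<in> carrier V \<Longrightarrow>
      ?L w (tens k U V u v) = tens k U (tensor k V W) u (tens k V W v w)"
    by (rule Lt)
  show "bilinear_map k (tensor k U V) W ?Z (\<lambda>t w. ?L w t)"
  proof (rule bilinear_mapI)
    fix t w w' assume t: "t \<in> carrier (tensor k U V)" and w: "w \<in> carrier W" "w' \<in> carrier W"
    note ww = W.M.a_closed[OF w]
    show "?L (w \<oplus>\<^bsub>W\<^esub> w') t = ?L w t \<oplus>\<^bsub>?Z\<^esub> ?L w' t"
      using t
    proof (induction t rule: tensor_induct[OF U V, consumes 1, case_names tens add])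
      case (tens u v)
      then show ?case
        using w ww by (simp add: Lt tens_simps(2)[OF V W] tens_simps(2)[OF U VW] tens_closed[OF V W])
    next
      case (add s t)
      then show ?case
        using w ww by (simp add: linmap_add[OF L] linmap_closed[OF L] Z.M.a_ac)
    qed
  next
    fix a t w assume a: "a \<in> carrier k" and t: "t \<in> carrier (tensor k U V)" and w: "w \<in> carrier W"
    note aw = W.smult_closed[OF a w]
    show "?L (a \<odot>\<^bsub>W\<^esub> w) t = a \<odot>\<^bsub>?Z\<^esub> ?L w t"
      using t
    proof (induction t rule: tensor_induct[OF U V, consumes 1, case_names tens add])
      case (tens u v)
      then show ?case
        using a w aw by (simp add: Lt tens_simps(4)[OF V W] tens_simps(4)[OF U VW] tens_closed[OF V W])
    next
      case (add s t)
      then show ?case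
        using a w aw by (simp add: linmap_add[OF L] linmap_closed[OF L] Z.smult_r_distr)
    qed
  qed (simp_all add: linmap_closed[OF L] linmap_add[OF L] linmap_smult[OF L])
qed

lemma tensor_assoc_linmap:
  assumes "module k U" "module k V" "module k W"
  shows "tensor_assoc k U V W \<in> linmap k (tensor k (tensor k U V) W) (tensor k U (tensor k V W))"
  unfolding tensor_assoc_def
  by (intro tensor_lift_linmap tensor_lift_assoc_bilinear tensor_module assms)

lemma tensor_assoc_tens:
  assumes "module k U" "module k V" "module k W"
    and "u \<in> carrier U" "v \<in> carrier V" "w \<in> carrier W"
  shows "tensor_assoc k U V W (tens k (tensor k U V) W (tens k U V u v) w) =
    tens k U (tensor k V W) u (tens k V W v w)"
  unfolding tensor_assoc_def
  using assms tensor_lift_tens[OF tensor_module[OF assms(1,2)] assms(3) _ tensor_lift_assoc_bilinear(1)[OF assms(1-3)]]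
  by (simp add: tens_closed tensor_module tensor_lift_assoc_bilinear(2))

text \<open>This is I \<otimes> id followed by k \<otimes> E = E, in the form used by the counit law
  and the definition of integrals, so that one set of lemmas serves both \<epsilon> and an
  integral.\<close>

abbreviation contract ::
    "'k ring \<Rightarrow> ('k, 'p) module \<Rightarrow> ('k, 'e) module \<Rightarrow> ('p \<Rightarrow> 'k) \<Rightarrow> ('k, 'p, 'e) tens \<Rightarrow> 'e"
  where "contract k P E I \<equiv> tensor_lift k P E E (\<lambda>p x. I p \<odot>\<^bsub>E\<^esub> x)"

lemma contract_bilinear:
  assumes E: "module k E" and I: "I \<in> linmap k P (scalar_space k)"
  shows "bilinear_map k P E E (\<lambda>p x. I p \<odot>\<^bsub>E\<^esub> x)"
proof -
  interpret E: module k E by (rule E)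
  have c: "I p \<in> carrier k" if "p \<in> carrier P" for p using linmap_closed[OF I that] by simp
  show ?thesis
    by (rule bilinear_mapI)
      (simp_all add: c linmap_add[OF I] linmap_smult[OF I] E.smult_l_distr E.smult_r_distr
        E.smult_assoc1[symmetric] E.R.m_comm)
qed

context
  fixes k :: "'k ring" and P :: "('k, 'p) module" and I :: "'p \<Rightarrow> 'k"
  assumes P: "module k P" and I: "I \<in> linmap k P (scalar_space k)"
begin

lemma contract_linmap: "module k E \<Longrightarrow> contract k P E I \<in> linmap k (tensor k P E) E"
  by (rule tensor_lift_linmap[OF P _ _ contract_bilinear[OF _ I]])

lemma contract_tens:
  "\<lbrakk>module k E; p \<in> carrier P; x \<in> carrier E\<rbrakk> \<Longrightarrow> contract k P E I (tens k P E p x) = I p \<odot>\<^bsub>E\<^esub> x"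
  by (rule tensor_lift_tens[OF P _ _ contract_bilinear[OF _ I]])

text \<open>Naturality in the comodule variable: I \<otimes> id and id \<otimes> g act on different
  factors. It makes averaging commute with the differential and lets contraction pass through
  coactions and class maps.\<close>

lemma contract_tensor_map:
  assumes E: "module k E" and E': "module k E'" and g: "g \<in> linmap k E E'"
    and t: "t \<in> carrier (tensor k P E)"
  shows "contract k P E' I (tensor_map k P E P E' (\<lambda>x. x) g t) = g (contract k P E I t)"
proof (rule linmap_tensor_eqI[OF P E _ _ _ t])
  show "(\<lambda>t. contract k P E' I (tensor_map k P E P E' (\<lambda>x. x) g t)) \<in> linmap k (tensor k P E) E'"
    by (rule linmap_comp[OF tensor_map_linmap[OF P E P E' linmap_id g] contract_linmap[OF E']])
  show "(\<lambda>t. g (contract k P E I t)) \<in> linmap k (tensor k P E) E'"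
    by (rule linmap_comp[OF contract_linmap[OF E] g])
  show "contract k P E' I (tensor_map k P E P E' (\<lambda>x. x) g (tens k P E p x)) = g (contract k P E I (tens k P E p x))"
    if "p \<in> carrier P" "x \<in> carrier E" for p x
    using that linmap_closed[OF g] linmap_closed[OF I]
    by (simp add: tensor_map_tens[OF P E P E' linmap_id g] contract_tens E E' linmap_smult[OF g])
qed

text \<open>After reassociation the contracted leg is still the first leg of \<open>u\<close>; this
  makes the integral meet a comultiplication in the next argument.\<close>

lemma contract_assoc:
  assumes E: "module k E" and u: "u \<in> carrier (tensor k P P)" and x: "x \<in> carrier E"
  shows "contract k P (tensor k P E) I (tensor_assoc k P P E (tens k (tensor k P P) E u x)) =
    tens k P E (contract k P P I u) x"
proof -
  note PP = tensor_module[OF P P] and PE = tensor_module[OF P E]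
  have l: "(\<lambda>u. tens k (tensor k P P) E u x) \<in> linmap k (tensor k P P) (tensor k (tensor k P P) E)"
      "(\<lambda>p. tens k P E p x) \<in> linmap k P (tensor k P E)"
    using tens_bilinear[OF PP E] tens_bilinear[OF P E] x by (simp_all add: bilinear_map_def)
  show ?thesis
  proof (rule linmap_tensor_eqI[OF P P _ _ _ u])
    show "(\<lambda>u. contract k P (tensor k P E) I (tensor_assoc k P P E (tens k (tensor k P P) E u x)))
        \<in> linmap k (tensor k P P) (tensor k P E)"
      by (rule linmap_comp[OF linmap_comp[OF l(1) tensor_assoc_linmap[OF P P E]] contract_linmap[OF PE]])
    show "(\<lambda>u. tens k P E (contract k P P I u) x) \<in> linmap k (tensor k P P) (tensor k P E)"
      by (rule linmap_comp[OF contract_linmap[OF P] l(2)])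
  next
    fix p q assume "p \<in> carrier P" "q \<in> carrier P"
    then show "contract k P (tensor k P E) I
          (tensor_assoc k P P E (tens k (tensor k P P) E (tens k P P p q) x)) =
        tens k P E (contract k P P I (tens k P P p q)) x"
      using x linmap_closed[OF I]
      by (simp add: tensor_assoc_tens P E contract_tens PE tens_closed tens_simps(3)[OF P E])
  qed
qed

end

section \<open>Averaging over a left integral\<close>

context
  fixes k :: "'k ring" and P :: "('k, 'p) module" and \<Delta> :: "'p \<Rightarrow> ('k, 'p, 'p) tens"
    and \<epsilon> :: "'p \<Rightarrow> 'k" and I :: "'p \<Rightarrow> 'k"
    and E :: "('k, 'e) module" and \<rho> :: "'e \<Rightarrow> ('k, 'p, 'e) tens"
  assumes coalg: "coalgebra k P \<Delta> \<epsilon>" and one: "\<one>\<^bsub>P\<^esub> \<in> carrier P"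
    and integral: "left_integral k P \<Delta> I"
    and E: "module k E" and coaction: "left_coaction k P \<Delta> \<epsilon> E \<rho>"
begin

text \<open>By naturality and coassociativity, \<rho> of the average of e is (I \<otimes> id
  \<otimes> id)(id \<otimes> \<rho>) \<rho>(e) = (I \<otimes> id \<otimes> id)(\<Delta> \<otimes>
  id) \<rho>(e), and left invariance of \<open>I\<close> replaces (I \<otimes> id) \<Delta> by I(-)
  1.\<close>

lemma average_coinvariant:
  assumes e: "e \<in> carrier E"
  shows "contract k P E I (\<rho> e) \<in> coinvariants k P E \<rho>"
proof -
  have P: "module k P" and \<Delta>: "\<Delta> \<in> linmap k P (tensor k P P)"
    using coalg by (auto simp: coalgebra_def)
  have I: "I \<in> linmap k P (scalar_space k)"
    and inv: "\<And>p. p \<in> carrier P \<Longrightarrow> contract k P P I (\<Delta> p) = I p \<odot>\<^bsub>P\<^esub> \<one>\<^bsub>P\<^esub>"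
    using integral by (auto simp: left_integral_def)
  have \<rho>: "\<rho> \<in> linmap k E (tensor k P E)"
    and coassoc: "tensor_assoc k P P E (tensor_map k P E (tensor k P P) E \<Delta> (\<lambda>x. x) (\<rho> e)) =
      tensor_map k P E P (tensor k P E) (\<lambda>x. x) \<rho> (\<rho> e)"
    using coaction e by (auto simp: left_coaction_def)
  note PP = tensor_module[OF P P] and PE = tensor_module[OF P E]
  have re: "\<rho> e \<in> carrier (tensor k P E)" by (rule linmap_closed[OF \<rho> e])
  have "contract k P (tensor k P E) I (tensor_assoc k P P E (tensor_map k P E (tensor k P P) E \<Delta> (\<lambda>x. x) t)) =
      tens k P E \<one>\<^bsub>P\<^esub> (contract k P E I t)" if t: "t \<in> carrier (tensor k P E)" for t
  proof (rule linmap_tensor_eqI[OF P E _ _ _ t])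
    show "(\<lambda>t. contract k P (tensor k P E) I (tensor_assoc k P P E (tensor_map k P E (tensor k P P) E \<Delta> (\<lambda>x. x) t)))
        \<in> linmap k (tensor k P E) (tensor k P E)"
      by (rule linmap_comp[OF linmap_comp[OF tensor_map_linmap[OF P E PP E \<Delta> linmap_id]
            tensor_assoc_linmap[OF P P E]] contract_linmap[OF P I PE]])
    show "(\<lambda>t. tens k P E \<one>\<^bsub>P\<^esub> (contract k P E I t)) \<in> linmap k (tensor k P E) (tensor k P E)"
      by (rule linmap_comp[OF contract_linmap[OF P I E] tens_linmap_right[OF P E one]])
  next
    fix p x assume p: "p \<in> carrier P" and x: "x \<in> carrier E"
    show "contract k P (tensor k P E) I (tensor_assoc k P P E
          (tensor_map k P E (tensor k P P) E \<Delta> (\<lambda>x. x) (tens k P E p x))) =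
        tens k P E \<one>\<^bsub>P\<^esub> (contract k P E I (tens k P E p x))"
      using p x one linmap_closed[OF I p] linmap_closed[OF \<Delta> p]
      by (simp add: tensor_map_tens[OF P E PP E \<Delta> linmap_id] contract_assoc[OF P I E] inv
          contract_tens[OF P I E] tens_simps[OF P E])
  qed
  from this[OF re] have "\<rho> (contract k P E I (\<rho> e)) = tens k P E \<one>\<^bsub>P\<^esub> (contract k P E I (\<rho> e))"
    by (simp add: coassoc contract_tensor_map[OF P I E PE \<rho> re])
  then show ?thesis
    using linmap_closed[OF contract_linmap[OF P I E] re] by (simp add: coinvariants_def)
qed

lemma average_of_coinvariant:
  assumes I1: "I \<one>\<^bsub>P\<^esub> = \<one>\<^bsub>k\<^esub>" and e: "e \<in> coinvariants k P E \<rho>"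
  shows "contract k P E I (\<rho> e) = e"
proof -
  interpret E: module k E by (rule E)
  have "module k P" "I \<in> linmap k P (scalar_space k)"
    using coalg integral by (auto simp: coalgebra_def left_integral_def)
  then show ?thesis
    using e one I1 by (simp add: coinvariants_def contract_tens E)
qed

end

section \<open>The integral of a cosemisimple Hopf algebra\<close>

text \<open>\<Delta> c is the image of a tensor over \<open>C\<close>, and the lift of \<phi> pulled
  back to C \<otimes> C vanishes on pure tensors. No injectivity of C \<otimes> C \<rightarrow> P
  \<otimes> P is involved.\<close>

lemma subcoalgebra_kill:
  assumes P: "module k P" and C: "subcoalgebra k P \<Delta> C" and Z: "module k Z"
    and \<phi>: "bilinear_map k P P Z \<phi>" and c: "c \<in> C"
    and zero: "\<And>x y. \<lbrakk>x \<in> C; y \<in> C\<rbrakk> \<Longrightarrow> \<phi> x y = \<zero>\<^bsub>Z\<^esub>"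
  shows "tensor_lift k P P Z \<phi> (\<Delta> c) = \<zero>\<^bsub>Z\<^esub>"
proof -
  interpret Z: module k Z by (rule Z)
  let ?C = "P\<lparr>carrier := C\<rparr>"
  have sub: "submodule C k P" using C by (simp add: subcoalgebra_def)
  have C': "module k ?C" by (rule submodule_module[OF P sub])
  have incl: "(\<lambda>x. x) \<in> linmap k ?C P" by (rule linmap_inclusion[OF submodule_subset[OF sub]])
  let ?i = "tensor_map k ?C ?C P P (\<lambda>x. x) (\<lambda>x. x)"
  obtain s where s: "s \<in> carrier (tensor k ?C ?C)" "\<Delta> c = ?i s"
    using C c by (auto simp: subcoalgebra_def Let_def)
  have "tensor_lift k P P Z \<phi> (?i s) = \<zero>\<^bsub>Z\<^esub>"
  proof (rule linmap_tensor_eqI[OF C' C' _ linmap_const_zero[OF Z] _ s(1)])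
    show "(\<lambda>s. tensor_lift k P P Z \<phi> (?i s)) \<in> linmap k (tensor k ?C ?C) Z"
      by (rule linmap_comp[OF tensor_map_linmap[OF C' C' P P incl incl] tensor_lift_linmap[OF P P Z \<phi>]])
    show "tensor_lift k P P Z \<phi> (?i (tens k ?C ?C x y)) = \<zero>\<^bsub>Z\<^esub>" if "x \<in> carrier ?C" "y \<in> carrier ?C" for x y
      using that submodule_subset[OF sub] zero
      by (simp add: tensor_map_tens[OF C' C' P P incl incl] tensor_lift_tens[OF P P Z \<phi>] subset_eq)
  qed
  then show ?thesis using s by simp
qed

context hopf_algebra
begin

lemma field: "field k" and P: "module k P" and one_closed: "\<one>\<^bsub>P\<^esub> \<in> carrier P"
  using algebra by (auto simp: assoc_algebra_def ring.is_monoid monoid.one_closed)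

lemma \<Delta>: "\<Delta> \<in> linmap k P (tensor k P P)" and \<epsilon>: "\<epsilon> \<in> linmap k P (scalar_space k)"
  using coalgebra by (auto simp: coalgebra_def)

lemma scalars: "module k (scalar_space k)"
  by (rule scalar_space_module[OF field_cring[OF field]])

text \<open>Lifting this map to P \<otimes> P and composing with \<Delta> gives the convolution of
  \<open>f\<close> and \<open>g\<close>.\<close>

lemma functional_mult_bilinear:
  assumes f: "f \<in> linmap k P (scalar_space k)" and g: "g \<in> linmap k P (scalar_space k)"
  shows "bilinear_map k P P (scalar_space k) (\<lambda>x y. f x \<otimes>\<^bsub>k\<^esub> g y)"
proof -
  interpret k: field k by (rule field)
  have c: "f p \<in> carrier k" "g p \<in> carrier k" if "p \<in> carrier P" for p
    using linmap_closed[OF f that] linmap_closed[OF g that] by auto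
  show ?thesis
    by (rule bilinear_mapI)
      (simp_all add: c linmap_add[OF f] linmap_smult[OF f] linmap_add[OF g] linmap_smult[OF g]
        k.l_distr k.r_distr k.m_ac)
qed

text \<open>The convolution product of one functional per subcoalgebra vanishes on all of them.\<close>

lemma functional_killing_subcoalgebras:
  assumes "finite \<C>" "\<And>C. C \<in> \<C> \<Longrightarrow> subcoalgebra k P \<Delta> C \<and> \<one>\<^bsub>P\<^esub> \<notin> C"
  shows "\<exists>g\<in>linmap k P (scalar_space k). g \<one>\<^bsub>P\<^esub> = \<one>\<^bsub>k\<^esub> \<and> (\<forall>C\<in>\<C>. \<forall>c\<in>C. g c = \<zero>\<^bsub>k\<^esub>)"
  using assms
proof (induction \<C> rule: finite_induct)
  case empty
  \<comment> \<open>For the empty family the counit serves, being the unit for convolution.\<close>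
  then show ?case using \<epsilon> counit_one by blast
next
  case (insert C \<C>)
  interpret k: field k by (rule field)
  obtain g where g: "g \<in> linmap k P (scalar_space k)" "g \<one>\<^bsub>P\<^esub> = \<one>\<^bsub>k\<^esub>"
      and g0: "\<And>C c. \<lbrakk>C \<in> \<C>; c \<in> C\<rbrakk> \<Longrightarrow> g c = \<zero>\<^bsub>k\<^esub>"
    using insert by blast
  have C: "subcoalgebra k P \<Delta> C" "\<one>\<^bsub>P\<^esub> \<notin> C" using insert by auto
  obtain f where f: "f \<in> linmap k P (scalar_space k)" "f \<one>\<^bsub>P\<^esub> = \<one>\<^bsub>k\<^esub>"
      and f0: "\<And>c. c \<in> C \<Longrightarrow> f c = \<zero>\<^bsub>k\<^esub>"
    using separating_functional[OF field P _ one_closed C(2)] C(1) by (auto simp: subcoalgebra_def)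
  note fg = functional_mult_bilinear[OF f(1) g(1)]
  have c: "f p \<in> carrier k" "g p \<in> carrier k" if "p \<in> carrier P" for p
    using linmap_closed[OF f(1) that] linmap_closed[OF g(1) that] by auto
  define h where "h p = tensor_lift k P P (scalar_space k) (\<lambda>x y. f x \<otimes>\<^bsub>k\<^esub> g y) (\<Delta> p)" for p
  have "h \<in> linmap k P (scalar_space k)"
    unfolding h_def by (rule linmap_comp[OF \<Delta> tensor_lift_linmap[OF P P scalars fg]])
  moreover have "h \<one>\<^bsub>P\<^esub> = \<one>\<^bsub>k\<^esub>"
    using one_closed f g by (simp add: h_def comult_one tensor_lift_tens[OF P P scalars fg])
  moreover have "h c = \<zero>\<^bsub>k\<^esub>" if "D \<in> insert C \<C>" "c \<in> D" for D c
  proof -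
    have D: "subcoalgebra k P \<Delta> D" using insert that by auto
    then have Dc: "x \<in> carrier P" if "x \<in> D" for x
      using that submodule_subset by (auto simp: subcoalgebra_def)
    \<comment> \<open>On \<open>D \<times> D\<close> one factor vanishes identically:
      \<open>f\<close> if D is the new \<open>C\<close>, and \<open>g\<close> if D belongs to the
      old family.\<close>
    have "tensor_lift k P P (scalar_space k) (\<lambda>x y. f x \<otimes>\<^bsub>k\<^esub> g y) (\<Delta> c) = \<zero>\<^bsub>scalar_space k\<^esub>"
      by (rule subcoalgebra_kill[OF P D scalars fg that(2)])
        (use that(1) f0 g0 Dc c in auto)
    then show ?thesis by (simp add: h_def)
  qed
  ultimately show ?case by blast
qed

text \<open>The family may be infinite while convolution handles only finite ones. The subspace
  \<open>?D\<close> records finiteness by duality: p is in it if some finite subfamily has the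
  property that each functional killing it also kills p. It contains the span, and 1 is not in it,
  by the functional normalised at 1.\<close>

lemma one_notin_span_subcoalgebras:
  assumes \<C>: "\<And>C. C \<in> \<C> \<Longrightarrow> subcoalgebra k P \<Delta> C \<and> \<one>\<^bsub>P\<^esub> \<notin> C"
  shows "\<one>\<^bsub>P\<^esub> \<notin> lin_span k P (\<Union>\<C>)"
proof
  interpret k: field k by (rule field)
  interpret P: module k P by (rule P)
  let ?D = "{p \<in> carrier P. \<exists>F. finite F \<and> F \<subseteq> \<C> \<and>
    (\<forall>g\<in>linmap k P (scalar_space k). (\<forall>C\<in>F. \<forall>c\<in>C. g c = \<zero>\<^bsub>k\<^esub>) \<longrightarrow> g p = \<zero>\<^bsub>k\<^esub>)}"
  have "submodule ?D k P"
  proof (rule submoduleI'[OF P])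
    have "g \<zero>\<^bsub>P\<^esub> = \<zero>\<^bsub>k\<^esub>" if "g \<in> linmap k P (scalar_space k)" for g
      using linmap_zero[OF P scalars that] by simp
    then show "\<zero>\<^bsub>P\<^esub> \<in> ?D" by auto
  next
    fix x y assume "x \<in> ?D" "y \<in> ?D"
    then obtain F G where *: "x \<in> carrier P" "y \<in> carrier P" "finite F" "finite G" "F \<subseteq> \<C>" "G \<subseteq> \<C>"
      "\<And>g. \<lbrakk>g \<in> linmap k P (scalar_space k); \<forall>C\<in>F. \<forall>c\<in>C. g c = \<zero>\<^bsub>k\<^esub>\<rbrakk> \<Longrightarrow> g x = \<zero>\<^bsub>k\<^esub>"
      "\<And>g. \<lbrakk>g \<in> linmap k P (scalar_space k); \<forall>C\<in>G. \<forall>c\<in>C. g c = \<zero>\<^bsub>k\<^esub>\<rbrakk> \<Longrightarrow> g y = \<zero>\<^bsub>k\<^esub>"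
      by auto
    have "g (x \<oplus>\<^bsub>P\<^esub> y) = \<zero>\<^bsub>k\<^esub>"
      if "g \<in> linmap k P (scalar_space k)" "\<forall>C\<in>F \<union> G. \<forall>c\<in>C. g c = \<zero>\<^bsub>k\<^esub>" for g
    proof -
      have "g x = \<zero>\<^bsub>k\<^esub>" "g y = \<zero>\<^bsub>k\<^esub>" using *(7,8)[OF that(1)] that(2) by auto
      then show ?thesis using * by (simp add: linmap_add[OF that(1)])
    qed
    then show "x \<oplus>\<^bsub>P\<^esub> y \<in> ?D"
      using * by (intro CollectI conjI exI[of _ "F \<union> G"]) auto
  next
    fix a x assume a: "a \<in> carrier k" and "x \<in> ?D"
    then obtain F where *: "x \<in> carrier P" "finite F" "F \<subseteq> \<C>"
      "\<And>g. \<lbrakk>g \<in> linmap k P (scalar_space k); \<forall>C\<in>F. \<forall>c\<in>C. g c = \<zero>\<^bsub>k\<^esub>\<rbrakk> \<Longrightarrow> g x = \<zero>\<^bsub>k\<^esub>"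
      by auto
    have "g (a \<odot>\<^bsub>P\<^esub> x) = \<zero>\<^bsub>k\<^esub>"
      if "g \<in> linmap k P (scalar_space k)" "\<forall>C\<in>F. \<forall>c\<in>C. g c = \<zero>\<^bsub>k\<^esub>" for g
      using *(4)[OF that] a * by (simp add: linmap_smult[OF that(1)])
    then show "a \<odot>\<^bsub>P\<^esub> x \<in> ?D"
      using a * by (intro CollectI conjI exI[of _ F]) auto
  qed auto
  moreover have "\<Union>\<C> \<subseteq> ?D"
  proof
    fix x assume "x \<in> \<Union>\<C>"
    then obtain C where C: "C \<in> \<C>" "x \<in> C" by blast
    then have "x \<in> carrier P" using \<C> submodule_subset by (fastforce simp: subcoalgebra_def)
    then show "x \<in> ?D" using C by (intro CollectI conjI exI[of _ "{C}"]) auto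
  qed
  ultimately have "lin_span k P (\<Union>\<C>) \<subseteq> ?D" by (rule lin_span_minimal)
  moreover assume "\<one>\<^bsub>P\<^esub> \<in> lin_span k P (\<Union>\<C>)"
  ultimately obtain F where F: "finite F" "F \<subseteq> \<C>"
      "\<And>g. \<lbrakk>g \<in> linmap k P (scalar_space k); \<forall>C\<in>F. \<forall>c\<in>C. g c = \<zero>\<^bsub>k\<^esub>\<rbrakk> \<Longrightarrow> g \<one>\<^bsub>P\<^esub> = \<zero>\<^bsub>k\<^esub>"
    by auto
  obtain g where "g \<in> linmap k P (scalar_space k)" "g \<one>\<^bsub>P\<^esub> = \<one>\<^bsub>k\<^esub>" "\<forall>C\<in>F. \<forall>c\<in>C. g c = \<zero>\<^bsub>k\<^esub>"
    using functional_killing_subcoalgebras[OF F(1)] \<C> F(2) by blast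
  then show False using F(3) by force
qed

lemma one_nonzero: "\<one>\<^bsub>P\<^esub> \<noteq> \<zero>\<^bsub>P\<^esub>"
proof -
  interpret k: field k by (rule field)
  show ?thesis using linmap_zero[OF P scalars \<epsilon>] counit_one by auto
qed

text \<open>The comparison object for a simple subcoalgebra containing 1; the preimage of \<Delta>
  (a 1) is (a 1) \<otimes> 1.\<close>

lemma span_one_subcoalgebra: "subcoalgebra k P \<Delta> {a \<odot>\<^bsub>P\<^esub> \<one>\<^bsub>P\<^esub> | a. a \<in> carrier k}"
    (is "subcoalgebra k P \<Delta> ?K")
proof -
  interpret P: module k P by (rule P)
  have K_image: "?K = (\<lambda>a. a \<odot>\<^bsub>P\<^esub> \<one>\<^bsub>P\<^esub>) ` carrier (scalar_space k)" by auto
  have "(\<lambda>a. a \<odot>\<^bsub>P\<^esub> \<one>\<^bsub>P\<^esub>) \<in> linmap k (scalar_space k) P"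
    by (rule linmapI) (use one_closed in \<open>auto simp: P.smult_l_distr P.smult_assoc1\<close>)
  then have sub: "submodule ?K k P" unfolding K_image by (rule submodule_image[OF scalars P])
  let ?C = "P\<lparr>carrier := ?K\<rparr>"
  have C': "module k ?C" by (rule submodule_module[OF P sub])
  have incl: "(\<lambda>x. x) \<in> linmap k ?C P" by (rule linmap_inclusion[OF submodule_subset[OF sub]])
  have "\<one>\<^bsub>P\<^esub> = \<one>\<^bsub>k\<^esub> \<odot>\<^bsub>P\<^esub> \<one>\<^bsub>P\<^esub>" using one_closed by simp
  then have one: "\<one>\<^bsub>P\<^esub> \<in> carrier ?C" using P.R.one_closed by auto
  have "\<Delta> (a \<odot>\<^bsub>P\<^esub> \<one>\<^bsub>P\<^esub>) \<in> tensor_map k ?C ?C P P (\<lambda>x. x) (\<lambda>x. x) ` carrier (tensor k ?C ?C)"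
    if a: "a \<in> carrier k" for a
  proof (rule image_eqI)
    let ?t = "tens k ?C ?C (a \<odot>\<^bsub>P\<^esub> \<one>\<^bsub>P\<^esub>) \<one>\<^bsub>P\<^esub>"
    have ac: "a \<odot>\<^bsub>P\<^esub> \<one>\<^bsub>P\<^esub> \<in> carrier ?C" using a by auto
    show "?t \<in> carrier (tensor k ?C ?C)" by (rule tens_closed[OF C' C' ac one])
    show "\<Delta> (a \<odot>\<^bsub>P\<^esub> \<one>\<^bsub>P\<^esub>) = tensor_map k ?C ?C P P (\<lambda>x. x) (\<lambda>x. x) ?t"
      using a one_closed
      by (simp add: tensor_map_tens[OF C' C' P P incl incl ac one] linmap_smult[OF \<Delta>] comult_one tens_simps(3)[OF P P])
  qed
  then show ?thesis using sub by (auto simp: subcoalgebra_def Let_def)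
qed

theorem cosemisimple_integral:
  assumes css: "cosemisimple k P \<Delta>"
  shows "\<exists>I. normalised_left_integral k P \<Delta> I"
proof -
  interpret k: field k by (rule field)
  interpret P: module k P by (rule P)
  let ?\<C> = "{C. simple_subcoalgebra k P \<Delta> C \<and> \<one>\<^bsub>P\<^esub> \<notin> C}"
  have sc: "subcoalgebra k P \<Delta> C" if "simple_subcoalgebra k P \<Delta> C" for C
    using that by (simp add: simple_subcoalgebra_def)
  have sub: "C \<subseteq> carrier P" if "simple_subcoalgebra k P \<Delta> C" for C
    using sc[OF that] submodule_subset by (auto simp: subcoalgebra_def)
  have sp: "submodule (lin_span k P (\<Union>?\<C>)) k P"
    by (rule lin_span_submodule[OF P]) (use sub in blast)
  have "\<one>\<^bsub>P\<^esub> \<notin> lin_span k P (\<Union>?\<C>)" by (rule one_notin_span_subcoalgebras) (use sc in blast)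
  then obtain I where I: "I \<in> linmap k P (scalar_space k)" "I \<one>\<^bsub>P\<^esub> = \<one>\<^bsub>k\<^esub>"
      and I0: "\<And>x. x \<in> lin_span k P (\<Union>?\<C>) \<Longrightarrow> I x = \<zero>\<^bsub>k\<^esub>"
    using separating_functional[OF field P sp one_closed] by blast
  \<comment> \<open>The two sides of the invariance equation. Both are linear in p, so it is enough
    to compare them on the simple subcoalgebras, which span \<open>P\<close>.\<close>
  let ?l = "\<lambda>p. contract k P P I (\<Delta> p)" and ?r = "\<lambda>p. I p \<odot>\<^bsub>P\<^esub> \<one>\<^bsub>P\<^esub>"
  have l: "?l \<in> linmap k P P" by (rule linmap_comp[OF \<Delta> contract_linmap[OF P I(1) P]])
  have Ic: "I p \<in> carrier k" if "p \<in> carrier P" for p using linmap_closed[OF I(1) that] by simp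
  have r: "?r \<in> linmap k P P"
    by (rule linmapI) (use one_closed Ic in
      \<open>auto simp: linmap_add[OF I(1)] linmap_smult[OF I(1)] P.smult_l_distr P.smult_assoc1\<close>)
  have "\<Union>{C. simple_subcoalgebra k P \<Delta> C} \<subseteq> {p \<in> carrier P. ?l p = ?r p}"
  proof
    fix x assume "x \<in> \<Union>{C. simple_subcoalgebra k P \<Delta> C}"
    then obtain C where C: "simple_subcoalgebra k P \<Delta> C" and x: "x \<in> C" by blast
    have xP: "x \<in> carrier P" using sub[OF C] x by blast
    have "?l x = ?r x"
    proof (cases "\<one>\<^bsub>P\<^esub> \<in> C")
      case True
      \<comment> \<open>The nonzero subcoalgebra k1 lies in \<open>C\<close>, so simplicity gives C
        = k1, and invariance need only be checked at 1.\<close>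
      let ?K = "{a \<odot>\<^bsub>P\<^esub> \<one>\<^bsub>P\<^esub> | a. a \<in> carrier k}"
      have "submodule C k P" using sc[OF C] by (simp add: subcoalgebra_def)
      then have KC: "?K \<subseteq> C" using submodule_smult[OF _ _ True] by auto
      have "\<one>\<^bsub>P\<^esub> = \<one>\<^bsub>k\<^esub> \<odot>\<^bsub>P\<^esub> \<one>\<^bsub>P\<^esub>" using one_closed by simp
      then have "\<one>\<^bsub>P\<^esub> \<in> ?K" using k.one_closed by auto
      then have "?K \<noteq> {\<zero>\<^bsub>P\<^esub>}" using one_nonzero by (metis singletonD)
      moreover have "\<forall>D. subcoalgebra k P \<Delta> D \<and> D \<subseteq> C \<longrightarrow> D = {\<zero>\<^bsub>P\<^esub>} \<or> D = C"
        using C unfolding simple_subcoalgebra_def by (elim conjE)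
      from spec[OF this, THEN mp, OF conjI[OF span_one_subcoalgebra KC]]
      have "?K = {\<zero>\<^bsub>P\<^esub>} \<or> ?K = C" .
      ultimately have "C = ?K" by metis
      then have "x \<in> ?K" using x by metis
      then obtain a where a: "a \<in> carrier k" "x = a \<odot>\<^bsub>P\<^esub> \<one>\<^bsub>P\<^esub>" by auto
      have "?l \<one>\<^bsub>P\<^esub> = \<one>\<^bsub>P\<^esub>"
        using one_closed I by (simp add: comult_one contract_tens[OF P I(1) P])
      then show ?thesis
        using a one_closed I(2) by (simp add: linmap_smult[OF l] linmap_smult[OF I(1)])
    next
      case False
      then have "C \<subseteq> lin_span k P (\<Union>?\<C>)" using C lin_span_superset[of "\<Union>?\<C>" k P] by blast
      then have IC: "I y = \<zero>\<^bsub>k\<^esub>" if "y \<in> C" for y using I0 that by blast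
      \<comment> \<open>\<open>I\<close> is zero on \<open>C\<close>, and \<Delta> x comes from C
        \<otimes> C; hence both sides vanish.\<close>
      have "?l x = \<zero>\<^bsub>P\<^esub>"
        by (rule subcoalgebra_kill[OF P sc[OF C] P contract_bilinear[OF P I(1)] x])
          (use IC sub[OF C] in auto)
      then show ?thesis using IC[OF x] one_closed by simp
    qed
    then show "x \<in> {p \<in> carrier P. ?l p = ?r p}" using xP by simp
  qed
  then have "carrier P \<subseteq> {p \<in> carrier P. ?l p = ?r p}"
    using css lin_span_minimal[OF submodule_equalizer[OF P P l r]] by (simp add: cosemisimple_def)
  then have "normalised_left_integral k P \<Delta> I"
    using I by (auto simp: normalised_left_integral_def left_integral_def)
  then show ?thesis by blast
qed

end

section \<open>Cohomology\<close>

text \<open>Stated abstractly so that the same facts apply to all forms on \<open>M\<close> and to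
  the left invariant ones.\<close>

locale cochain_complex =
  fixes k :: "'k ring" and V :: "nat \<Rightarrow> ('k, 'w) module" and d :: "nat \<Rightarrow> 'w \<Rightarrow> 'w"
  assumes V: "\<And>n. module k (V n)"
    and d: "\<And>n. d n \<in> linmap k (V n) (V (Suc n))"
    and dd: "\<And>n x. x \<in> carrier (V n) \<Longrightarrow> d (Suc n) (d n x) = \<zero>\<^bsub>V (Suc (Suc n))\<^esub>"
begin

lemma cocycles_submodule: "submodule (cocycles V d n) k (V n)"
  unfolding cocycles_def by (rule submodule_kernel[OF V V d])

lemma cocycles_carrier: "x \<in> cocycles V d n \<Longrightarrow> x \<in> carrier (V n)"
  by (simp add: cocycles_def)

lemma cocycle_space_module: "module k (cocycle_space V d n)"
  unfolding cocycle_space_def by (rule submodule_module[OF V cocycles_submodule])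

lemma cocycle_space_carrier: "carrier (cocycle_space V d n) = cocycles V d n"
  by (simp add: cocycle_space_def)

lemma cocycle_inclusion: "(\<lambda>x. x) \<in> linmap k (cocycle_space V d n) (V n)"
  unfolding cocycle_space_def by (rule linmap_inclusion[OF submodule_subset[OF cocycles_submodule]])

lemma coboundaries_submodule_V: "submodule (coboundaries V d n) k (V n)"
proof (cases n)
  case 0
  interpret V0: module k "V 0" by (rule V)
  show ?thesis using 0 by (auto simp: coboundaries_def intro!: submoduleI'[OF V])
next
  case (Suc m)
  then show ?thesis using submodule_image[OF V V d] by (simp add: coboundaries_def)
qed

lemma coboundaries_subset: "coboundaries V d n \<subseteq> cocycles V d n"
proof (cases n)
  case 0
  then show ?thesis using submodule_zero[OF cocycles_submodule[of 0]] by (simp add: coboundaries_def)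
next
  case (Suc m)
  then show ?thesis using dd linmap_closed[OF d] by (auto simp: coboundaries_def cocycles_def)
qed

lemma quotient_coboundaries: "quotient k (cocycle_space V d n) (coboundaries V d n)"
  unfolding quotient_def
  using cocycle_space_module submodule_restrict[OF coboundaries_submodule_V cocycles_submodule V coboundaries_subset]
  by (simp add: cocycle_space_def)

lemma cohomology_module: "module k (cohomology V d n)"
  unfolding cohomology_def by (rule quotient.quot_module[OF quotient_coboundaries])

lemma cohomology_carrier: "carrier (cohomology V d n) = coh_class V d n ` cocycles V d n"
  unfolding cohomology_def coh_class_def
  by (simp add: quotient.quot_carrier[OF quotient_coboundaries] cocycle_space_carrier)

lemma class_linmap: "coh_class V d n \<in> linmap k (cocycle_space V d n) (cohomology V d n)"
  unfolding cohomology_def coh_class_def by (rule quotient.coset_linmap[OF quotient_coboundaries])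

lemma class_closed: "x \<in> cocycles V d n \<Longrightarrow> coh_class V d n x \<in> carrier (cohomology V d n)"
  by (simp add: cohomology_carrier)

text \<open>The difference is taken in \<open>V n\<close>. Negation refers to the carrier of the
  record, so its agreement with negation in the cocycle space has to be deduced from linearity of
  the inclusion.\<close>

lemma class_eq_iff:
  assumes "x \<in> cocycles V d n" "y \<in> cocycles V d n"
  shows "coh_class V d n x = coh_class V d n y \<longleftrightarrow> x \<ominus>\<^bsub>V n\<^esub> y \<in> coboundaries V d n"
  using quotient.coset_eq_iff[OF quotient_coboundaries, of x n y] assms
    linmap_minus[OF cocycle_space_module V cocycle_inclusion, of x n y]
  by (simp add: coh_class_def cocycle_space_carrier)

lemma class_coboundary:
  assumes "x \<in> coboundaries V d n"
  shows "coh_class V d n x = \<zero>\<^bsub>cohomology V d n\<^esub>"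
  using quotient.coset_eq_zero_iff[OF quotient_coboundaries, of x n] assms coboundaries_subset
  by (auto simp: coh_class_def cohomology_def cocycle_space_carrier)

section \<open>Subcomplexes and the map induced by the inclusion\<close>

context
  fixes S :: "nat \<Rightarrow> 'w set" and V'
  assumes S: "\<And>n. submodule (S n) k (V n)" and dS: "\<And>n x. x \<in> S n \<Longrightarrow> d n x \<in> S (Suc n)"
    and V': "V' = (\<lambda>n. (V n)\<lparr>carrier := S n\<rparr>)"
begin

lemma subcomplex: "cochain_complex k V' d"
proof (rule cochain_complex.intro)
  show "module k (V' n)" for n unfolding V' by (rule submodule_module[OF V S])
  show "d n \<in> linmap k (V' n) (V' (Suc n))" for n
    unfolding V'
    by (rule linmap_restrict_codom[OF linmap_restrict_dom[OF d submodule_subset[OF S]]]) (simp add: dS)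
  show "d (Suc n) (d n x) = \<zero>\<^bsub>V' (Suc (Suc n))\<^esub>" if "x \<in> carrier (V' n)" for n x
    using that dd submodule_subset[OF S[of n]] by (auto simp: V')
qed

lemma subcomplex_cocycles: "cocycles V' d n = S n \<inter> cocycles V d n"
  using submodule_subset[OF S[of n]] by (auto simp: cocycles_def V')

text \<open>Only an inclusion: a form in \<open>S\<close> may have primitives only outside
  \<open>S\<close>. This gap is what injectivity of H(i) has to close.\<close>

lemma subcomplex_coboundaries: "coboundaries V' d n \<subseteq> coboundaries V d n"
  using submodule_subset[OF S] by (auto simp: coboundaries_def V' split: nat.splits)

lemma subcomplex_class_eq_iff:
  assumes "x \<in> cocycles V' d n" "y \<in> cocycles V' d n"
  shows "coh_class V' d n x = coh_class V' d n y \<longleftrightarrow> x \<ominus>\<^bsub>V n\<^esub> y \<in> coboundaries V' d n"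
proof -
  have "x \<ominus>\<^bsub>V' n\<^esub> y = x \<ominus>\<^bsub>V n\<^esub> y"
    unfolding V'
    using linmap_minus[OF submodule_module[OF V S] V linmap_inclusion[OF submodule_subset[OF S]], of x n y] assms
    by (simp add: subcomplex_cocycles)
  then show ?thesis using cochain_complex.class_eq_iff[OF subcomplex assms] by simp
qed

text \<open>The definite description is resolved here: cochains with the same class in the
  subcomplex differ by one of its coboundaries, which is a coboundary of the full complex.\<close>

lemma cohomology_map_inclusion:
  assumes x: "x \<in> cocycles V' d n"
  shows "cohomology_map V' d V d (\<lambda>_ x. x) n (coh_class V' d n x) = coh_class V d n x"
  unfolding cohomology_map_def
proof (rule the_equality)
  show "\<exists>y\<in>cocycles V' d n. coh_class V' d n x = coh_class V' d n y \<and> coh_class V d n x = coh_class V d n y"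
    using x by blast
next
  fix c assume "\<exists>y\<in>cocycles V' d n. coh_class V' d n x = coh_class V' d n y \<and> c = coh_class V d n y"
  then obtain y where y: "y \<in> cocycles V' d n" "coh_class V' d n x = coh_class V' d n y"
    and c: "c = coh_class V d n y" by blast
  have "x \<ominus>\<^bsub>V n\<^esub> y \<in> coboundaries V d n"
    using subcomplex_class_eq_iff[OF x y(1)] y(2) subcomplex_coboundaries by auto
  then show "c = coh_class V d n x"
    using c x y(1) class_eq_iff[of x n y] by (simp add: subcomplex_cocycles)
qed

lemma cohomology_map_inclusion_linmap:
  "cohomology_map V' d V d (\<lambda>_ x. x) n \<in> linmap k (cohomology V' d n) (cohomology V d n)"
    (is "?H \<in> _")
proof -
  interpret V': cochain_complex k V' d by (rule subcomplex)
  interpret Z': module k "cocycle_space V' d n" by (rule V'.cocycle_space_module)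
  have add: "x \<oplus>\<^bsub>cocycle_space V' d n\<^esub> y = x \<oplus>\<^bsub>cocycle_space V d n\<^esub> y"
    and smult: "a \<odot>\<^bsub>cocycle_space V' d n\<^esub> x = a \<odot>\<^bsub>cocycle_space V d n\<^esub> x" for a x y
    by (simp_all add: cocycle_space_def V')
  have Z: "x \<in> cocycles V d n" if "x \<in> cocycles V' d n" for x
    using that by (simp add: subcomplex_cocycles)
  note H = cohomology_map_inclusion
  note carr = cocycle_space_carrier V'.cocycle_space_carrier
  show ?thesis
  proof (rule linmapI)
    fix h assume "h \<in> carrier (cohomology V' d n)"
    then show "?H h \<in> carrier (cohomology V d n)"
      using H Z by (auto simp: V'.cohomology_carrier cohomology_carrier)
  next
    fix h h' assume "h \<in> carrier (cohomology V' d n)" "h' \<in> carrier (cohomology V' d n)"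
    then obtain x y where *: "x \<in> cocycles V' d n" "y \<in> cocycles V' d n"
      "h = coh_class V' d n x" "h' = coh_class V' d n y"
      by (auto simp: V'.cohomology_carrier)
    then have xy: "x \<oplus>\<^bsub>cocycle_space V' d n\<^esub> y \<in> cocycles V' d n"
      using Z'.M.a_closed by (simp add: carr)
    have "h \<oplus>\<^bsub>cohomology V' d n\<^esub> h' = coh_class V' d n (x \<oplus>\<^bsub>cocycle_space V' d n\<^esub> y)"
      using * linmap_add[OF V'.class_linmap, of x n y] by (simp add: carr)
    then have "?H (h \<oplus>\<^bsub>cohomology V' d n\<^esub> h') = coh_class V d n (x \<oplus>\<^bsub>cocycle_space V d n\<^esub> y)"
      using H[OF xy] by (simp add: add)
    also have "\<dots> = coh_class V d n x \<oplus>\<^bsub>cohomology V d n\<^esub> coh_class V d n y"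
      using * Z by (intro linmap_add[OF class_linmap]) (auto simp: carr)
    finally show "?H (h \<oplus>\<^bsub>cohomology V' d n\<^esub> h') = ?H h \<oplus>\<^bsub>cohomology V d n\<^esub> ?H h'"
      using * by (simp add: H)
  next
    fix a h assume a: "a \<in> carrier k" and "h \<in> carrier (cohomology V' d n)"
    then obtain x where *: "x \<in> cocycles V' d n" "h = coh_class V' d n x"
      by (auto simp: V'.cohomology_carrier)
    then have ax: "a \<odot>\<^bsub>cocycle_space V' d n\<^esub> x \<in> cocycles V' d n"
      using a Z'.smult_closed by (simp add: carr)
    have "a \<odot>\<^bsub>cohomology V' d n\<^esub> h = coh_class V' d n (a \<odot>\<^bsub>cocycle_space V' d n\<^esub> x)"
      using * a linmap_smult[OF V'.class_linmap, of a x n] by (simp add: carr)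
    then have "?H (a \<odot>\<^bsub>cohomology V' d n\<^esub> h) = coh_class V d n (a \<odot>\<^bsub>cocycle_space V d n\<^esub> x)"
      using H[OF ax] by (simp add: smult)
    also have "\<dots> = a \<odot>\<^bsub>cohomology V d n\<^esub> coh_class V d n x"
      using a * Z by (intro linmap_smult[OF class_linmap]) (auto simp: carr)
    finally show "?H (a \<odot>\<^bsub>cohomology V' d n\<^esub> h) = a \<odot>\<^bsub>cohomology V d n\<^esub> ?H h"
      using * by (simp add: H)
  qed
qed

end

end

lemma (in differential_calculus) forms_complex: "cochain_complex k (forms \<Omega>) (diff \<Omega>)"
  by (rule cochain_complex.intro) (simp_all add: forms_space diff_lin diff_diff)

section \<open>Kernels of id \<otimes> d and d \<otimes> id\<close>

text \<open>On pure tensors, hence everywhere, id \<otimes> \<pi> = 1 - (id \<otimes> s)(id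
  \<otimes> d), and the last term vanishes at u. This is the substitute for ker (id \<otimes> d) = P
  \<otimes> ker d.\<close>

lemma tensor_map_kernel_projection_right:
  assumes P: "module k P" and V: "module k V" and W: "module k W" and d: "d \<in> linmap k V W"
    and s: "s \<in> linmap k W V" and \<pi>: "\<pi> \<in> linmap k V V"
    and \<pi>_eq: "\<And>v. v \<in> carrier V \<Longrightarrow> \<pi> v = v \<ominus>\<^bsub>V\<^esub> s (d v)"
    and u: "u \<in> carrier (tensor k P V)" "tensor_map k P V P W (\<lambda>x. x) d u = \<zero>\<^bsub>tensor k P W\<^esub>"
  shows "tensor_map k P V P V (\<lambda>x. x) \<pi> u = u"
proof -
  interpret V: module k V by (rule V)
  note PV = tensor_module[OF P V] and PW = tensor_module[OF P W]
  interpret PV: module k "tensor k P V" by (rule PV)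
  note id = linmap_id[of k P]
  note sd = linmap_comp[OF tensor_map_linmap[OF P V P W id d] tensor_map_linmap[OF P W P V id s]]
  have "tensor_map k P V P V (\<lambda>x. x) \<pi> u =
      u \<ominus>\<^bsub>tensor k P V\<^esub> tensor_map k P W P V (\<lambda>x. x) s (tensor_map k P V P W (\<lambda>x. x) d u)"
  proof (rule linmap_tensor_eqI[OF P V tensor_map_linmap[OF P V P V id \<pi>] linmap_diff[OF PV PV linmap_id sd] _ u(1)])
    fix p v assume p: "p \<in> carrier P" and v: "v \<in> carrier V"
    note sdv = linmap_closed[OF s linmap_closed[OF d v]]
    show "tensor_map k P V P V (\<lambda>x. x) \<pi> (tens k P V p v) = tens k P V p v \<ominus>\<^bsub>tensor k P V\<^esub>
        tensor_map k P W P V (\<lambda>x. x) s (tensor_map k P V P W (\<lambda>x. x) d (tens k P V p v))"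
      using p v sdv linmap_closed[OF d v]
      by (simp add: tensor_map_tens P V W d s \<pi> \<pi>_eq linmap_minus[OF V PV tens_linmap_right[OF P V]])
  qed
  then show ?thesis
    using u linmap_zero[OF PW PV tensor_map_linmap[OF P W P V id s]] PV.M.a_inv_zero by (simp add: a_minus_def)
qed

text \<open>The mirror image, by which an element of \<open>P \<otimes> H n\<close> killed by d
  \<otimes> id is traced back to the kernel of d on \<open>P\<close>.\<close>

lemma tensor_map_kernel_projection_left:
  assumes P: "module k P" and V: "module k V" and W: "module k W" and d: "d \<in> linmap k V W"
    and s: "s \<in> linmap k W V" and \<pi>: "\<pi> \<in> linmap k V V"
    and \<pi>_eq: "\<And>v. v \<in> carrier V \<Longrightarrow> \<pi> v = v \<ominus>\<^bsub>V\<^esub> s (d v)"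
    and u: "u \<in> carrier (tensor k V P)" "tensor_map k V P W P d (\<lambda>x. x) u = \<zero>\<^bsub>tensor k W P\<^esub>"
  shows "tensor_map k V P V P \<pi> (\<lambda>x. x) u = u"
proof -
  interpret V: module k V by (rule V)
  note PV = tensor_module[OF V P] and PW = tensor_module[OF W P]
  interpret PV: module k "tensor k V P" by (rule PV)
  note id = linmap_id[of k P]
  note sd = linmap_comp[OF tensor_map_linmap[OF V P W P d id] tensor_map_linmap[OF W P V P s id]]
  have "tensor_map k V P V P \<pi> (\<lambda>x. x) u =
      u \<ominus>\<^bsub>tensor k V P\<^esub> tensor_map k W P V P s (\<lambda>x. x) (tensor_map k V P W P d (\<lambda>x. x) u)"
  proof (rule linmap_tensor_eqI[OF V P tensor_map_linmap[OF V P V P \<pi> id] linmap_diff[OF PV PV linmap_id sd] _ u(1)])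
    fix v p assume p: "p \<in> carrier P" and v: "v \<in> carrier V"
    note sdv = linmap_closed[OF s linmap_closed[OF d v]]
    have "(\<lambda>v. tens k V P v p) \<in> linmap k V (tensor k V P)"
      using tens_bilinear[OF V P] p by (simp add: bilinear_map_def)
    from linmap_minus[OF V PV this]
    show "tensor_map k V P V P \<pi> (\<lambda>x. x) (tens k V P v p) = tens k V P v p \<ominus>\<^bsub>tensor k V P\<^esub>
        tensor_map k W P V P s (\<lambda>x. x) (tensor_map k V P W P d (\<lambda>x. x) (tens k V P v p))"
      using p v sdv linmap_closed[OF d v]
      by (simp add: tensor_map_tens P V W d s \<pi> \<pi>_eq)
  qed
  then show ?thesis
    using u linmap_zero[OF PW PV tensor_map_linmap[OF W P V P s id]] PV.M.a_inv_zero by (simp add: a_minus_def)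
qed

section \<open>Differentiable coactions\<close>

locale differentiable_coaction =
  hopf_algebra k P \<Delta> \<epsilon> S + P: differential_calculus k P \<Omega>P + M: differential_calculus k M \<Omega>M
  for k :: "'k ring" and P :: "('k, 'p) module" and \<Delta> \<epsilon> S
    and \<Omega>P :: "('k, 'p) dga" and M :: "('k, 'm) module" and \<Omega>M :: "('k, 'm) dga" +
  fixes lam :: "'m \<Rightarrow> ('k, 'p, 'm) tens"
    and lam_star :: "nat \<Rightarrow> 'm \<Rightarrow> nat \<Rightarrow> ('k, 'p, 'm) tens"
  assumes extension: "differentiable_extension k M \<Omega>P \<Omega>M lam lam_star"
    and coaction: "\<And>n. left_coaction k P \<Delta> \<epsilon> (forms \<Omega>M n) (lam_bar lam_star n)"
begin

abbreviation "V \<equiv> forms \<Omega>M"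
abbreviation "d \<equiv> diff \<Omega>M"
abbreviation "L \<equiv> lam_bar lam_star"
abbreviation "H \<equiv> de_rham \<Omega>M"

sublocale cochain_complex k V d
  by (rule M.forms_complex)

lemma L: "L n \<in> linmap k (V n) (tensor k P (V n))"
  using coaction by (simp add: left_coaction_def)

lemma counit_L: "\<omega> \<in> carrier (V n) \<Longrightarrow> contract k P (V n) \<epsilon> (L n \<omega>) = \<omega>"
  using coaction by (simp add: left_coaction_def)

lemma lam_star_d:
  "\<omega> \<in> carrier (V n) \<Longrightarrow> lam_star (Suc n) (d n \<omega>) = tensor_diff k \<Omega>P \<Omega>M n (lam_star n \<omega>)"
  using extension by (simp add: differentiable_extension_def)

lemma lam_star_component:
  assumes "\<omega> \<in> carrier (V n)" "r \<le> n"
  shows "lam_star n \<omega> r \<in> carrier (tensor k (forms \<Omega>P r) (V (n - r)))"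
proof -
  have "lam_star n \<in> linmap k (V n) (tensor_forms k \<Omega>P \<Omega>M n)"
    using extension by (simp add: differentiable_extension_def)
  from linmap_closed[OF this assms(1)] show ?thesis
    using assms(2) by (auto simp: tensor_forms_def Let_def)
qed

text \<open>Obtained from homogeneity for the scalar zero, read off in one component. The general
  fact about linear maps would require \<open>tensor_forms\<close> to be shown a module
  first.\<close>

lemma lam_star_zero:
  assumes r: "r \<le> n"
  shows "lam_star n \<zero>\<^bsub>V n\<^esub> r = \<zero>\<^bsub>tensor k (forms \<Omega>P r) (V (n - r))\<^esub>"
proof -
  interpret Vn: module k "V n" by (rule V)
  interpret T: module k "tensor k (forms \<Omega>P r) (V (n - r))" by (rule tensor_module[OF P.forms_space V])
  have "lam_star n \<in> linmap k (V n) (tensor_forms k \<Omega>P \<Omega>M n)"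
    using extension by (simp add: differentiable_extension_def)
  from linmap_smult[OF this, of "\<zero>\<^bsub>k\<^esub>" "\<zero>\<^bsub>V n\<^esub>"]
  have "lam_star n \<zero>\<^bsub>V n\<^esub> = \<zero>\<^bsub>k\<^esub> \<odot>\<^bsub>tensor_forms k \<Omega>P \<Omega>M n\<^esub> lam_star n \<zero>\<^bsub>V n\<^esub>"
    by simp
  then have "lam_star n \<zero>\<^bsub>V n\<^esub> r = (\<zero>\<^bsub>k\<^esub> \<odot>\<^bsub>tensor_forms k \<Omega>P \<Omega>M n\<^esub> lam_star n \<zero>\<^bsub>V n\<^esub>) r"
    by (rule fun_cong)
  also have "\<dots> = \<zero>\<^bsub>k\<^esub> \<odot>\<^bsub>tensor k (forms \<Omega>P r) (V (n - r))\<^esub> lam_star n \<zero>\<^bsub>V n\<^esub> r"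
    using r by (simp add: tensor_forms_def Let_def)
  finally show ?thesis using T.smult_l_null[OF lam_star_component[OF Vn.M.zero_closed r]] by simp
qed

text \<open>This is component 0 of the compatibility with d: there is no d \<otimes> id term in this
  component, and the sign is positive.\<close>

lemma L_d:
  assumes \<omega>: "\<omega> \<in> carrier (V n)"
  shows "L (Suc n) (d n \<omega>) = tensor_map k P (V n) P (V (Suc n)) (\<lambda>x. x) (d n) (L n \<omega>)"
proof -
  interpret T: module k "tensor k P (V (Suc n))" by (rule tensor_module[OF P V])
  show ?thesis
    using \<omega> tensor_map_closed[OF P V P V linmap_id d linmap_closed[OF L \<omega>]]
    by (simp add: lam_bar_def form_proj_def lam_star_d tensor_diff_def koszul_sign_def P.forms_0)
qed

text \<open>This is component 1 of the compatibility with d, whose left side is zero on a cocycle.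
  The sign of id \<otimes> d in this component is negative, so the two terms are equal. For n = 0
  there is no component of degree 1 in \<open>lam_star 0\<close>, which accounts for the zero on the
  right.\<close>

lemma d_L_cocycle:
  assumes \<omega>: "\<omega> \<in> cocycles V d n"
  shows "tensor_map k P (V n) (forms \<Omega>P 1) (V n) (diff \<Omega>P 0) (\<lambda>x. x) (L n \<omega>) =
    (case n of 0 \<Rightarrow> \<zero>\<^bsub>tensor k (forms \<Omega>P 1) (V n)\<^esub>
     | Suc m \<Rightarrow> tensor_map k (forms \<Omega>P 1) (V m) (forms \<Omega>P 1) (V n) (\<lambda>x. x) (d m) (lam_star n \<omega> 1))"
    (is "?a = ?b")
proof -
  have \<omega>V: "\<omega> \<in> carrier (V n)" by (rule cocycles_carrier[OF \<omega>])
  let ?T = "tensor k (forms \<Omega>P 1) (V n)"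
  note P1 = P.forms_space[of 1]
  interpret T: module k ?T by (rule tensor_module[OF P1 V])
  have dP: "diff \<Omega>P 0 \<in> linmap k P (forms \<Omega>P 1)" using P.diff_lin[of 0] by (simp add: P.forms_0)
  have a: "?a \<in> carrier ?T"
    by (rule tensor_map_closed[OF P V P1 V dP linmap_id linmap_closed[OF L \<omega>V]])
  have b: "?b \<in> carrier ?T"
  proof (cases n)
    case (Suc m)
    have "lam_star n \<omega> 1 \<in> carrier (tensor k (forms \<Omega>P 1) (V m))"
      using lam_star_component[OF \<omega>V, of 1] Suc by simp
    then have "tensor_map k (forms \<Omega>P 1) (V m) (forms \<Omega>P 1) (V (Suc m)) (\<lambda>x. x) (d m) (lam_star n \<omega> 1)
        \<in> carrier (tensor k (forms \<Omega>P 1) (V (Suc m)))"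
      by (rule tensor_map_closed[OF P1 V P1 V linmap_id d])
    then show ?thesis using Suc by simp
  next
    case 0
    then show ?thesis using T.M.zero_closed by simp
  qed
  have "\<zero>\<^bsub>?T\<^esub> = lam_star (Suc n) (d n \<omega>) 1"
    using \<omega> lam_star_zero[of 1 "Suc n"] by (simp add: cocycles_def)
  also have "\<dots> = ?a \<ominus>\<^bsub>?T\<^esub> ?b"
    using \<omega>V by (simp add: lam_star_d tensor_diff_def koszul_sign_def P.forms_0 lam_bar_def form_proj_def
        a_minus_def Let_def
        abelian_group.a_inv_zero[OF module.axioms(2)[OF tensor_module[OF P.forms_space V]]] split: nat.split)
  finally show "?a = ?b" using T.M.minus_eq_zero_iff[OF a b] by simp
qed

text \<open>(id \<otimes> q) applied to the coaction of d \<eta> equals (id \<otimes> q d) applied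
  to that of \<eta>, and q d = 0. This gives independence of the representative in
  \<open>lam_tilde\<close>.\<close>

lemma L_coboundary:
  assumes b: "b \<in> coboundaries V d n" and q: "q \<in> linmap k (V n) (H n)"
    and q0: "\<And>x. x \<in> coboundaries V d n \<Longrightarrow> q x = \<zero>\<^bsub>H n\<^esub>"
  shows "tensor_map k P (V n) P (H n) (\<lambda>x. x) q (L n b) = \<zero>\<^bsub>tensor k P (H n)\<^esub>"
proof (cases n)
  case 0
  then have "b = \<zero>\<^bsub>V n\<^esub>" using b by (simp add: coboundaries_def)
  then show ?thesis
    using linmap_zero[OF V tensor_module[OF P V] L]
      linmap_zero[OF tensor_module[OF P V] tensor_module[OF P cohomology_module]
        tensor_map_linmap[OF P V P cohomology_module linmap_id q]] by simp
next
  case (Suc m)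
  then obtain \<eta> where \<eta>: "\<eta> \<in> carrier (V m)" "b = d m \<eta>" using b by (auto simp: coboundaries_def)
  have q': "q \<in> linmap k (V (Suc m)) (H n)" using q Suc by simp
  have "tensor_map k P (V (Suc m)) P (H n) (\<lambda>x. x) q (L (Suc m) (d m \<eta>)) =
      tensor_map k P (V m) P (H n) (\<lambda>x. x) (\<lambda>y. q (d m y)) (L m \<eta>)"
    unfolding L_d[OF \<eta>(1)]
    by (rule tensor_map_comp[OF P V P V P cohomology_module linmap_id d linmap_id q' linmap_closed[OF L \<eta>(1)]])
  also have "\<dots> = tensor_map k P (V m) P (H n) (\<lambda>x. x) (\<lambda>y. \<zero>\<^bsub>H n\<^esub>) (L m \<eta>)"
  proof (rule tensor_map_cong[OF P V P cohomology_module linmap_id linmap_comp[OF d q'] linmap_id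
        linmap_const_zero[OF cohomology_module] _ _ linmap_closed[OF L \<eta>(1)]])
    show "q (d m y) = \<zero>\<^bsub>H n\<^esub>" if "y \<in> carrier (V m)" for y
      using that Suc by (intro q0) (simp add: coboundaries_def)
  qed simp
  also have "\<dots> = \<zero>\<^bsub>tensor k P (H n)\<^esub>"
    by (rule tensor_map_zero_right[OF P V P cohomology_module linmap_id linmap_closed[OF L \<eta>(1)]])
  finally show ?thesis using Suc \<eta> by simp
qed

section \<open>The coaction on cohomology\<close>

text \<open>The coaction of a cocycle is killed by id \<otimes> d, hence fixed by id \<otimes> \<pi>
  for a projection \<pi> onto the cocycles. Since \<pi> can be given the cocycle space as codomain,
  this supplies preimages in P \<otimes> Z.\<close>

lemma class_extension:
  "\<exists>\<pi>\<in>linmap k (V n) (cocycle_space V d n). (\<forall>x\<in>cocycles V d n. \<pi> x = x) \<and>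
    (\<forall>\<omega>\<in>cocycles V d n. tensor_map k P (V n) P (V n) (\<lambda>x. x) \<pi> (L n \<omega>) = L n \<omega>)"
proof -
  interpret Vn: module k "V n" by (rule V)
  obtain s \<pi> where s: "s \<in> linmap k (V (Suc n)) (V n)" and \<pi>: "\<pi> \<in> linmap k (V n) (V n)"
    and d\<pi>: "\<And>v. v \<in> carrier (V n) \<Longrightarrow> d n (\<pi> v) = \<zero>\<^bsub>V (Suc n)\<^esub>"
    and \<pi>_eq: "\<And>v. v \<in> carrier (V n) \<Longrightarrow> \<pi> v = v \<ominus>\<^bsub>V n\<^esub> s (d n v)"
    using kernel_projection[OF field V V d, of n] by blast
  have "\<pi> \<in> linmap k (V n) (cocycle_space V d n)"
    unfolding cocycle_space_def
    by (rule linmap_restrict_codom[OF \<pi>]) (simp add: cocycles_def d\<pi> linmap_closed[OF \<pi>])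
  moreover have "\<pi> x = x" if "x \<in> cocycles V d n" for x
    using that \<pi>_eq[of x] linmap_zero[OF V V s] by (simp add: cocycles_def a_minus_def Vn.M.a_inv_zero)
  moreover have "tensor_map k P (V n) P (V n) (\<lambda>x. x) \<pi> (L n \<omega>) = L n \<omega>"
    if \<omega>: "\<omega> \<in> cocycles V d n" for \<omega>
  proof (rule tensor_map_kernel_projection_right[OF P V V d s \<pi> \<pi>_eq])
    show "L n \<omega> \<in> carrier (tensor k P (V n))" by (rule linmap_closed[OF L cocycles_carrier[OF \<omega>]])
    have "L (Suc n) (d n \<omega>) = \<zero>\<^bsub>tensor k P (V (Suc n))\<^esub>"
      using \<omega> linmap_zero[OF V tensor_module[OF P V] L] by (simp add: cocycles_def)
    then show "tensor_map k P (V n) P (V (Suc n)) (\<lambda>x. x) (d n) (L n \<omega>) = \<zero>\<^bsub>tensor k P (V (Suc n))\<^esub>"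
      by (simp add: L_d cocycles_carrier[OF \<omega>])
  qed
  ultimately show ?thesis by blast
qed

text \<open>Any linear extension \<open>q\<close> of the class map from cocycles to all forms computes the coaction
  on cohomology without a choice of preimage in \<open>P \<otimes> Z\<close>.\<close>

lemma lam_tilde_class:
  "\<exists>q\<in>linmap k (V n) (H n). (\<forall>x\<in>cocycles V d n. q x = coh_class V d n x) \<and>
    (\<forall>\<omega>\<in>cocycles V d n. lam_tilde k P \<Omega>M lam_star n (coh_class V d n \<omega>) =
      tensor_map k P (V n) P (H n) (\<lambda>x. x) q (L n \<omega>))"
proof -
  interpret Vn: module k "V n" by (rule V)
  let ?Z = "cocycle_space V d n"
  note Z = cocycle_space_module and HM = cohomology_module
  obtain \<pi> where \<pi>: "\<pi> \<in> linmap k (V n) ?Z" and \<pi>_id: "\<And>x. x \<in> cocycles V d n \<Longrightarrow> \<pi> x = x"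
    and \<pi>_L: "\<And>\<omega>. \<omega> \<in> cocycles V d n \<Longrightarrow> tensor_map k P (V n) P (V n) (\<lambda>x. x) \<pi> (L n \<omega>) = L n \<omega>"
    using class_extension[of n] by blast
  \<comment> \<open>The class map is defined on cocycles only; \<pi> extends it linearly to all
    forms.\<close>
  define q where "q x = coh_class V d n (\<pi> x)" for x
  have q: "q \<in> linmap k (V n) (H n)" unfolding q_def by (rule linmap_comp[OF \<pi> class_linmap])
  have q_class: "q x = coh_class V d n x" if "x \<in> cocycles V d n" for x
    using that by (simp add: q_def \<pi>_id)
  have q0: "q x = \<zero>\<^bsub>H n\<^esub>" if "x \<in> coboundaries V d n" for x
    using that by (simp add: q_class subsetD[OF coboundaries_subset] class_coboundary)
  let ?Q = "tensor_map k P (V n) P (H n) (\<lambda>x. x) q"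
  let ?i = "tensor_map k P ?Z P (V n) (\<lambda>x. x) (\<lambda>x. x)"
  let ?c = "tensor_map k P ?Z P (H n) (\<lambda>x. x) (coh_class V d n)"
  \<comment> \<open>\<open>?c\<close> factors through \<open>?i\<close>, so the value proposed by
    \<open>lam_tilde\<close> depends only on the image of t in \<open>P \<otimes> V n\<close>;
    injectivity of \<open>?i\<close> need not be discussed.\<close>
  have Q_i: "?Q (?i t) = ?c t" if t: "t \<in> carrier (tensor k P ?Z)" for t
  proof -
    have "?Q (?i t) = tensor_map k P ?Z P (H n) (\<lambda>x. x) (\<lambda>x. q x) t"
      by (rule tensor_map_comp[OF P Z P V P HM linmap_id cocycle_inclusion linmap_id q t])
    also have "\<dots> = ?c t"
      by (rule tensor_map_cong[OF P Z P HM linmap_id linmap_comp[OF cocycle_inclusion q] linmap_id class_linmap _ _ t])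
        (auto simp: q_class cocycle_space_carrier)
    finally show ?thesis .
  qed
  have "lam_tilde k P \<Omega>M lam_star n (coh_class V d n \<omega>) = ?Q (L n \<omega>)"
    if \<omega>: "\<omega> \<in> cocycles V d n" for \<omega>
    unfolding lam_tilde_def Let_def
  proof (rule the_equality)
    have LV: "L n \<omega> \<in> carrier (tensor k P (V n))" by (rule linmap_closed[OF L cocycles_carrier[OF \<omega>]])
    \<comment> \<open>The preimage over the cocycles supplied by id \<otimes> \<pi>.\<close>
    let ?t = "tensor_map k P (V n) P ?Z (\<lambda>x. x) \<pi> (L n \<omega>)"
    have t: "?t \<in> carrier (tensor k P ?Z)" by (rule tensor_map_closed[OF P V P Z linmap_id \<pi> LV])
    have i: "?i ?t = L n \<omega>"
      unfolding tensor_map_comp[OF P V P Z P V linmap_id \<pi> linmap_id cocycle_inclusion LV] by (rule \<pi>_L[OF \<omega>])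
    show "\<exists>\<omega>'\<in>carrier ?Z. \<exists>t\<in>carrier (tensor k P ?Z). coh_class V d n \<omega> = coh_class V d n \<omega>' \<and>
        ?i t = L n \<omega>' \<and> ?Q (L n \<omega>) = ?c t"
      using \<omega> t i Q_i[OF t] by (intro bexI[of _ \<omega>] bexI[of _ ?t]) (simp_all add: cocycle_space_carrier)
  next
    fix y assume "\<exists>\<omega>'\<in>carrier ?Z. \<exists>t\<in>carrier (tensor k P ?Z). coh_class V d n \<omega> = coh_class V d n \<omega>' \<and>
        ?i t = L n \<omega>' \<and> y = ?c t"
    then obtain \<omega>' t where \<omega>': "\<omega>' \<in> cocycles V d n" and t: "t \<in> carrier (tensor k P ?Z)"
      and eq: "coh_class V d n \<omega> = coh_class V d n \<omega>'" "?i t = L n \<omega>'" "y = ?c t"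
      by (auto simp: cocycle_space_carrier)
    note c = cocycles_carrier[OF \<omega>] cocycles_carrier[OF \<omega>']
    have Q: "(\<lambda>x. ?Q (L n x)) \<in> linmap k (V n) (tensor k P (H n))"
      by (rule linmap_comp[OF L tensor_map_linmap[OF P V P HM linmap_id q]])
    \<comment> \<open>A second representative differs by a coboundary, whose coaction is annihilated
      by id \<otimes> q.\<close>
    have "\<omega> \<ominus>\<^bsub>V n\<^esub> \<omega>' \<in> coboundaries V d n" using eq(1) class_eq_iff[OF \<omega> \<omega>'] by simp
    then have "?Q (L n (\<omega> \<ominus>\<^bsub>V n\<^esub> \<omega>')) = \<zero>\<^bsub>tensor k P (H n)\<^esub>" by (rule L_coboundary[OF _ q q0])
    then have "?Q (L n \<omega>) \<ominus>\<^bsub>tensor k P (H n)\<^esub> ?Q (L n \<omega>') = \<zero>\<^bsub>tensor k P (H n)\<^esub>"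
      using linmap_minus[OF V tensor_module[OF P HM] Q c] by simp
    then have "?Q (L n \<omega>) = ?Q (L n \<omega>')"
      using abelian_group.minus_eq_zero_iff[OF module.axioms(2)[OF tensor_module[OF P HM]]
        linmap_closed[OF Q c(1)] linmap_closed[OF Q c(2)]] by simp
    then show "y = ?Q (L n \<omega>)" using eq Q_i[OF t] by simp
  qed
  then show ?thesis using q q_class by blast
qed

section \<open>The subcomplex of left invariant forms\<close>

lemma inv_forms_eq:
  "inv_forms k P \<Omega>M lam_star = (\<lambda>n. (V n)\<lparr>carrier := coinvariants k P (V n) (L n)\<rparr>)"
  by (rule ext) (simp add: inv_forms_def coinv_space_def)

lemma coinvariants_submodule: "submodule (coinvariants k P (V n) (L n)) k (V n)"
  unfolding coinvariants_def
  by (rule submodule_equalizer[OF V tensor_module[OF P V] L tens_linmap_right[OF P V one_closed]])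

text \<open>d is a comodule map, so the coaction of d \<omega> is (id \<otimes> d)(1 \<otimes>
  \<omega>).\<close>

lemma d_coinvariant:
  assumes "\<omega> \<in> coinvariants k P (V n) (L n)"
  shows "d n \<omega> \<in> coinvariants k P (V (Suc n)) (L (Suc n))"
  using assms one_closed
  by (simp add: coinvariants_def L_d linmap_closed[OF d] tensor_map_tens[OF P V P V linmap_id d])

text \<open>The three premises of the subcomplex lemmas, in their order, for the left invariant
  forms.\<close>

lemmas inv_subcomplex = coinvariants_submodule d_coinvariant inv_forms_eq

lemma H_incl_class:
  assumes "\<omega> \<in> coinvariants k P (V n) (L n)" "\<omega> \<in> cocycles V d n"
  shows "H_incl k P \<Omega>M lam_star n (coh_class (inv_forms k P \<Omega>M lam_star) d n \<omega>) = coh_class V d n \<omega>"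
  unfolding H_incl_def
  by (rule cohomology_map_inclusion[OF inv_subcomplex])
    (use assms in \<open>simp_all add: subcomplex_cocycles[OF inv_subcomplex]\<close>)

lemma inv_cohomology_carrier:
  "carrier (inv_cohomology k P \<Omega>M lam_star n) =
    coh_class (inv_forms k P \<Omega>M lam_star) d n ` (coinvariants k P (V n) (L n) \<inter> cocycles V d n)"
  using cochain_complex.cohomology_carrier[OF subcomplex[OF inv_subcomplex]]
    subcomplex_cocycles[OF inv_subcomplex] by simp

theorem H_incl_iso:
  assumes I: "normalised_left_integral k P \<Delta> I"
  shows "lin_iso k (inv_cohomology k P \<Omega>M lam_star n) (coinv_cohomology k P \<Omega>M lam_star n)
    (H_incl k P \<Omega>M lam_star n)"
proof -
  let ?V' = "inv_forms k P \<Omega>M lam_star" and ?H = "H_incl k P \<Omega>M lam_star n"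
  let ?C = "coinvariants k P (H n) (lam_tilde k P \<Omega>M lam_star n)"
  have int: "left_integral k P \<Delta> I" and I1: "I \<one>\<^bsub>P\<^esub> = \<one>\<^bsub>k\<^esub>"
    using I by (auto simp: normalised_left_integral_def)
  have Ilin: "I \<in> linmap k P (scalar_space k)" using int by (simp add: left_integral_def)
  note HM = cohomology_module
  \<comment> \<open>The average is set up in all degrees at once, since injectivity in degree
    \<open>n\<close> averages a primitive in the degree below.\<close>
  define R where "R n \<omega> = contract k P (V n) I (L n \<omega>)" for n \<omega>
  have R: "R n \<in> linmap k (V n) (V n)" for n
    unfolding R_def by (rule linmap_comp[OF L contract_linmap[OF P Ilin V]])
  have R_inv: "R n \<omega> \<in> coinvariants k P (V n) (L n)" if "\<omega> \<in> carrier (V n)" for n \<omega>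
    unfolding R_def by (rule average_coinvariant[OF coalgebra one_closed int V coaction that])
  have R_id: "R n \<omega> = \<omega>" if "\<omega> \<in> coinvariants k P (V n) (L n)" for n \<omega>
    unfolding R_def by (rule average_of_coinvariant[OF coalgebra one_closed int V coaction I1 that])
  have d_R: "d n (R n \<omega>) = R (Suc n) (d n \<omega>)" if "\<omega> \<in> carrier (V n)" for n \<omega>
    unfolding R_def L_d[OF that]
    by (rule contract_tensor_map[OF P Ilin V V d linmap_closed[OF L that], symmetric])
  obtain q where q: "q \<in> linmap k (V n) (H n)"
    and q_class: "\<And>x. x \<in> cocycles V d n \<Longrightarrow> q x = coh_class V d n x"
    and tilde: "\<And>\<omega>. \<omega> \<in> cocycles V d n \<Longrightarrow> lam_tilde k P \<Omega>M lam_star n (coh_class V d n \<omega>) =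
      tensor_map k P (V n) P (H n) (\<lambda>x. x) q (L n \<omega>)"
    using lam_tilde_class[of n] by blast
  \<comment> \<open>The coaction of an invariant form is 1 \<otimes> \<omega>, which id \<otimes> q
    sends to 1 \<otimes> [\<omega>].\<close>
  have inv_image: "coh_class V d n \<omega> \<in> ?C"
    if "\<omega> \<in> coinvariants k P (V n) (L n)" "\<omega> \<in> cocycles V d n" for \<omega>
    using that one_closed
    by (simp add: coinvariants_def tilde tensor_map_tens[OF P V P HM linmap_id q] q_class class_closed)
  have image: "?H h \<in> ?C" if "h \<in> carrier (inv_cohomology k P \<Omega>M lam_star n)" for h
    using that inv_image by (auto simp: inv_cohomology_carrier H_incl_class)
  have lin: "?H \<in> linmap k (inv_cohomology k P \<Omega>M lam_star n) (coinv_cohomology k P \<Omega>M lam_star n)"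
    unfolding coinv_space_def
    by (rule linmap_restrict_codom[OF _ image])
      (use cohomology_map_inclusion_linmap[OF inv_subcomplex] in \<open>simp_all add: H_incl_def\<close>)
  have "inj_on ?H (carrier (inv_cohomology k P \<Omega>M lam_star n))"
  proof (rule inj_onI)
    fix g h assume "g \<in> carrier (inv_cohomology k P \<Omega>M lam_star n)" "h \<in> carrier (inv_cohomology k P \<Omega>M lam_star n)"
      and eq: "?H g = ?H h"
    then obtain x y where x: "x \<in> coinvariants k P (V n) (L n)" "x \<in> cocycles V d n" "g = coh_class ?V' d n x"
      and y: "y \<in> coinvariants k P (V n) (L n)" "y \<in> cocycles V d n" "h = coh_class ?V' d n y"
      unfolding inv_cohomology_carrier by blast
    have xy: "x \<ominus>\<^bsub>V n\<^esub> y \<in> coinvariants k P (V n) (L n)"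
      by (rule submodule_minus[OF V coinvariants_submodule x(1) y(1)])
    have b: "x \<ominus>\<^bsub>V n\<^esub> y \<in> coboundaries V d n"
      using eq x y class_eq_iff by (simp add: H_incl_class)
    have "x \<ominus>\<^bsub>V n\<^esub> y \<in> coboundaries ?V' d n"
    proof (cases n)
      case 0
      then show ?thesis using b by (simp add: coboundaries_def inv_forms_eq)
    next
      case (Suc m)
      then obtain \<eta> where \<eta>: "\<eta> \<in> carrier (V m)" "x \<ominus>\<^bsub>V n\<^esub> y = d m \<eta>"
        using b by (auto simp: coboundaries_def)
      \<comment> \<open>The difference is invariant, so it equals its own average, and averaging
        commutes with d: the averaged \<eta> is an invariant primitive.\<close>
      then have "x \<ominus>\<^bsub>V n\<^esub> y = d m (R m \<eta>)" using R_id[OF xy] Suc by (simp add: d_R)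
      then show ?thesis using Suc R_inv[OF \<eta>(1)] by (simp add: coboundaries_def inv_forms_eq)
    qed
    then show "g = h"
      using x y subcomplex_class_eq_iff[OF inv_subcomplex, of x n y]
      by (simp add: subcomplex_cocycles[OF inv_subcomplex])
  qed
  moreover have "h \<in> ?H ` carrier (inv_cohomology k P \<Omega>M lam_star n)" if h: "h \<in> ?C" for h
  proof -
    obtain \<omega> where \<omega>: "\<omega> \<in> cocycles V d n" "h = coh_class V d n \<omega>"
      using h by (auto simp: coinvariants_def cohomology_carrier)
    note \<omega>V = cocycles_carrier[OF \<omega>(1)]
    interpret HM: module k "H n" by (rule HM)
    \<comment> \<open>Coinvariance of the class, expressed through the coaction on forms. Applying I
      \<otimes> id to both sides gives h on the left and q of the averaged form on the
      right.\<close>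
    have "tens k P (H n) \<one>\<^bsub>P\<^esub> h = tensor_map k P (V n) P (H n) (\<lambda>x. x) q (L n \<omega>)"
      using h \<omega> tilde by (simp add: coinvariants_def)
    then have "contract k P (H n) I (tens k P (H n) \<one>\<^bsub>P\<^esub> h) = q (R n \<omega>)"
      unfolding R_def by (simp add: contract_tensor_map[OF P Ilin V HM q linmap_closed[OF L \<omega>V]])
    moreover have "contract k P (H n) I (tens k P (H n) \<one>\<^bsub>P\<^esub> h) = h"
      using h one_closed I1 by (simp add: contract_tens[OF P Ilin HM] coinvariants_def)
    \<comment> \<open>The average of a cocycle is a cocycle, so there \<open>q\<close> is the class
      map and h is the class of an invariant cocycle.\<close>
    moreover have R\<omega>: "R n \<omega> \<in> cocycles V d n"
      using \<omega> \<omega>V linmap_zero[OF V V R] by (simp add: cocycles_def d_R linmap_closed[OF R])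
    ultimately have "h = ?H (coh_class ?V' d n (R n \<omega>))"
      using R_inv[OF \<omega>V] by (simp add: H_incl_class q_class)
    then show ?thesis using R_inv[OF \<omega>V] R\<omega> unfolding inv_cohomology_carrier by blast
  qed
  ultimately have "bij_betw ?H (carrier (inv_cohomology k P \<Omega>M lam_star n)) ?C"
    using image unfolding bij_betw_def by blast
  then show ?thesis using lin by (simp add: lin_iso_def coinv_space_def)
qed

text \<open>An equality of records, not merely an isomorphism: \<open>coinv_space\<close> changes
  only the carrier, so it is enough that each class is coinvariant.\<close>

theorem connected_coinvariant:
  assumes conn: "connected_calculus k P \<Omega>P"
  shows "coinv_cohomology k P \<Omega>M lam_star n = H n"
proof -
  note HM = cohomology_module and P1 = P.forms_space[of 1]
  interpret P: module k P by (rule P)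
  interpret HM: module k "H n" by (rule HM)
  have dP: "diff \<Omega>P 0 \<in> linmap k P (forms \<Omega>P 1)" using P.diff_lin[of 0] by (simp add: P.forms_0)
  obtain s \<pi> where s: "s \<in> linmap k (forms \<Omega>P 1) P" and \<pi>: "\<pi> \<in> linmap k P P"
    and d\<pi>: "\<And>p. p \<in> carrier P \<Longrightarrow> diff \<Omega>P 0 (\<pi> p) = \<zero>\<^bsub>forms \<Omega>P 1\<^esub>"
    and \<pi>_eq: "\<And>p. p \<in> carrier P \<Longrightarrow> \<pi> p = p \<ominus>\<^bsub>P\<^esub> s (diff \<Omega>P 0 p)"
    using kernel_projection[OF field P P1 dP] by blast
  \<comment> \<open>Connectedness enters here: \<pi> takes values in ker d, which is k1.\<close>
  have \<pi>_one: "\<exists>a\<in>carrier k. \<pi> p = a \<odot>\<^bsub>P\<^esub> \<one>\<^bsub>P\<^esub>" if "p \<in> carrier P" for p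
    using conn d\<pi>[OF that] linmap_closed[OF \<pi> that] unfolding connected_calculus_def by blast
  \<comment> \<open>On a pure tensor the scalar in \<pi> p = a 1 moves to the right factor; sums
    stay in 1 \<otimes> H.\<close>
  have tens_one: "\<exists>h\<in>carrier (H n). tensor_map k P (H n) P (H n) \<pi> (\<lambda>x. x) u = tens k P (H n) \<one>\<^bsub>P\<^esub> h"
    if "u \<in> carrier (tensor k P (H n))" for u
    using that
  proof (induction u rule: tensor_induct[OF P HM, consumes 1, case_names tens add])
    case (tens p x)
    then obtain a where "a \<in> carrier k" "\<pi> p = a \<odot>\<^bsub>P\<^esub> \<one>\<^bsub>P\<^esub>" using \<pi>_one by blast
    then show ?case
      using tens one_closed
      by (intro bexI[of _ "a \<odot>\<^bsub>H n\<^esub> x"])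
        (simp_all add: tensor_map_tens[OF P HM P HM \<pi> linmap_id] tens_simps(3,4)[OF P HM])
  next
    case (add s t)
    then obtain g h where gh: "g \<in> carrier (H n)" "h \<in> carrier (H n)"
      "tensor_map k P (H n) P (H n) \<pi> (\<lambda>x. x) s = tens k P (H n) \<one>\<^bsub>P\<^esub> g"
      "tensor_map k P (H n) P (H n) \<pi> (\<lambda>x. x) t = tens k P (H n) \<one>\<^bsub>P\<^esub> h" by blast
    then show ?case
      using add.hyps one_closed
      by (intro bexI[of _ "g \<oplus>\<^bsub>H n\<^esub> h"])
        (simp_all add: linmap_add[OF tensor_map_linmap[OF P HM P HM \<pi> linmap_id]] tens_simps(2)[OF P HM])
  qed
  obtain q where q: "q \<in> linmap k (V n) (H n)"
    and q_class: "\<And>x. x \<in> cocycles V d n \<Longrightarrow> q x = coh_class V d n x"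
    and tilde: "\<And>\<omega>. \<omega> \<in> cocycles V d n \<Longrightarrow> lam_tilde k P \<Omega>M lam_star n (coh_class V d n \<omega>) =
      tensor_map k P (V n) P (H n) (\<lambda>x. x) q (L n \<omega>)"
    using lam_tilde_class[of n] by blast
  have "lam_tilde k P \<Omega>M lam_star n h = tens k P (H n) \<one>\<^bsub>P\<^esub> h" if h: "h \<in> carrier (H n)" for h
  proof -
    obtain \<omega> where \<omega>: "\<omega> \<in> cocycles V d n" "h = coh_class V d n \<omega>"
      using h by (auto simp: cohomology_carrier)
    note \<omega>V = cocycles_carrier[OF \<omega>(1)]
    note L\<omega> = linmap_closed[OF L \<omega>V]
    let ?y = "tensor_map k P (V n) P (H n) (\<lambda>x. x) q (L n \<omega>)"
    have y: "?y \<in> carrier (tensor k P (H n))" by (rule tensor_map_closed[OF P V P HM linmap_id q L\<omega>])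
    \<comment> \<open>d \<otimes> id and id \<otimes> q commute, so the relation for cocycles can be
      applied first; what remains contains q d = 0.\<close>
    have "tensor_map k P (H n) (forms \<Omega>P 1) (H n) (diff \<Omega>P 0) (\<lambda>x. x) ?y =
        tensor_map k P (V n) (forms \<Omega>P 1) (H n) (diff \<Omega>P 0) q (L n \<omega>)"
      by (rule tensor_map_comp[OF P V P HM P1 HM linmap_id q dP linmap_id L\<omega>])
    also have "\<dots> = tensor_map k (forms \<Omega>P 1) (V n) (forms \<Omega>P 1) (H n) (\<lambda>x. x) q
        (tensor_map k P (V n) (forms \<Omega>P 1) (V n) (diff \<Omega>P 0) (\<lambda>x. x) (L n \<omega>))"
      by (rule tensor_map_comp[OF P V P1 V P1 HM dP linmap_id linmap_id q L\<omega>, symmetric])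
    also have "\<dots> = \<zero>\<^bsub>tensor k (forms \<Omega>P 1) (H n)\<^esub>"
    proof (cases n)
      case 0
      then show ?thesis
        using d_L_cocycle[OF \<omega>(1)] linmap_zero[OF tensor_module[OF P1 V] tensor_module[OF P1 HM]
            tensor_map_linmap[OF P1 V P1 HM linmap_id q]] by simp
    next
      case (Suc m)
      have t: "lam_star n \<omega> 1 \<in> carrier (tensor k (forms \<Omega>P 1) (V m))"
        using lam_star_component[OF \<omega>V, of 1] Suc by simp
      have q': "q \<in> linmap k (V (Suc m)) (H n)" using q Suc by simp
      have "tensor_map k (forms \<Omega>P 1) (V (Suc m)) (forms \<Omega>P 1) (H n) (\<lambda>x. x) q
          (tensor_map k (forms \<Omega>P 1) (V m) (forms \<Omega>P 1) (V (Suc m)) (\<lambda>x. x) (d m) (lam_star n \<omega> 1)) =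
          tensor_map k (forms \<Omega>P 1) (V m) (forms \<Omega>P 1) (H n) (\<lambda>x. x) (\<lambda>y. q (d m y)) (lam_star n \<omega> 1)"
        by (rule tensor_map_comp[OF P1 V P1 V P1 HM linmap_id d linmap_id q' t])
      also have "\<dots> = tensor_map k (forms \<Omega>P 1) (V m) (forms \<Omega>P 1) (H n) (\<lambda>x. x) (\<lambda>y. \<zero>\<^bsub>H n\<^esub>) (lam_star n \<omega> 1)"
      proof (rule tensor_map_cong[OF P1 V P1 HM linmap_id linmap_comp[OF d q'] linmap_id linmap_const_zero[OF HM] _ _ t])
        fix y assume "y \<in> carrier (V m)"
        then have "d m y \<in> coboundaries V d n" using Suc by (simp add: coboundaries_def)
        then show "q (d m y) = \<zero>\<^bsub>H n\<^esub>"
          by (simp add: q_class subsetD[OF coboundaries_subset] class_coboundary)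
      qed simp
      also have "\<dots> = \<zero>\<^bsub>tensor k (forms \<Omega>P 1) (H n)\<^esub>"
        by (rule tensor_map_zero_right[OF P1 V P1 HM linmap_id t])
      finally show ?thesis using d_L_cocycle[OF \<omega>(1)] Suc by simp
    qed
    finally have "tensor_map k P (H n) (forms \<Omega>P 1) (H n) (diff \<Omega>P 0) (\<lambda>x. x) ?y =
        \<zero>\<^bsub>tensor k (forms \<Omega>P 1) (H n)\<^esub>" .
    \<comment> \<open>Being killed by d \<otimes> id, \<open>?y\<close> is fixed by \<pi> \<otimes>
      id and hence has the form 1 \<otimes> g.\<close>
    from tensor_map_kernel_projection_left[OF HM P P1 dP s \<pi> _ y this] \<pi>_eq
    have "tensor_map k P (H n) P (H n) \<pi> (\<lambda>x. x) ?y = ?y" by simp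
    then obtain g where g: "g \<in> carrier (H n)" "?y = tens k P (H n) \<one>\<^bsub>P\<^esub> g"
      using tens_one[OF y] by auto
    \<comment> \<open>The counit identifies g: \<epsilon> \<otimes> id sends 1 \<otimes> g to g, and
      by naturality and the counit law it sends \<open>?y\<close> to q \<omega> = h.\<close>
    have "g = contract k P (H n) \<epsilon> ?y"
      using g one_closed counit_one by (simp add: contract_tens[OF P \<epsilon> HM])
    also have "\<dots> = q (contract k P (V n) \<epsilon> (L n \<omega>))"
      by (rule contract_tensor_map[OF P \<epsilon> V HM q L\<omega>])
    also have "\<dots> = h" using \<omega> \<omega>V by (simp add: counit_L q_class)
    finally show ?thesis using tilde[OF \<omega>(1)] g \<omega>(2) by simp
  qed
  then have "coinvariants k P (H n) (lam_tilde k P \<Omega>M lam_star n) = carrier (H n)"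
    by (auto simp: coinvariants_def)
  then show ?thesis by (simp add: coinv_space_def)
qed

end

theorem theorem3p4:
  fixes k :: "'k ring"
    and P :: "('k, 'p) module" and \<Delta> :: "'p \<Rightarrow> ('k, 'p, 'p) tens"
    and \<epsilon> :: "'p \<Rightarrow> 'k" and S :: "'p \<Rightarrow> 'p" and \<Omega>P :: "('k, 'p) dga"
    and M :: "('k, 'm) module" and \<Omega>M :: "('k, 'm) dga"
    and lam :: "'m \<Rightarrow> ('k, 'p, 'm) tens"
    and lam_star :: "nat \<Rightarrow> 'm \<Rightarrow> nat \<Rightarrow> ('k, 'p, 'm) tens"
  assumes "field k"
    and "hopf_algebra k P \<Delta> \<epsilon> S"
    and "differential_calculus k P \<Omega>P"
    and "bicovariant k P \<Delta> \<Omega>P"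
    and "differential_calculus k M \<Omega>M"
    and "left_coaction k P \<Delta> \<epsilon> M lam"
    and "differentiable_extension k M \<Omega>P \<Omega>M lam lam_star"
    and "\<And>n. left_coaction k P \<Delta> \<epsilon> (forms \<Omega>M n) (lam_bar lam_star n)"
  shows "((\<exists>I. normalised_left_integral k P \<Delta> I) \<longrightarrow>
      (\<forall>n. lin_iso k (inv_cohomology k P \<Omega>M lam_star n) (coinv_cohomology k P \<Omega>M lam_star n)
        (H_incl k P \<Omega>M lam_star n))) \<and>
    (connected_calculus k P \<Omega>P \<longrightarrow>
      (\<forall>n. coinv_cohomology k P \<Omega>M lam_star n = de_rham \<Omega>M n)) \<and>
    (connected_calculus k P \<Omega>P \<and> cosemisimple k P \<Delta> \<longrightarrow>
      (\<forall>n. coinv_cohomology k P \<Omega>M lam_star n = de_rham \<Omega>M n \<and>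
        lin_iso k (inv_cohomology k P \<Omega>M lam_star n) (de_rham \<Omega>M n) (H_incl k P \<Omega>M lam_star n)))"
proof -
  interpret differentiable_coaction k P \<Delta> \<epsilon> S \<Omega>P M \<Omega>M lam lam_star
    using assms by (simp add: differentiable_coaction_def differentiable_coaction_axioms_def)
  show ?thesis
    \<comment> \<open>For the third claim, cosemisimplicity supplies the integral, and the record
      equality from connectedness rewrites the target of H(i) to the whole cohomology.\<close>
    using H_incl_iso connected_coinvariant cosemisimple_integral by metis
qed

end
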